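(* Let $d\ge2$, $1\le m\le d$, $n=d+m$, let $\omega:\{1,\dots,d\}\to\{1,\dots,m\}$ be an onto map, and let $\gamma:[0,1]\to\mathbb R^d$ be a smooth finite type curve. Let $0<\alpha\le n$, $1<p<\infty$, $\sigma\in\mathbb R$, and suppose that there is a constant $C$ such that $$\|\mathcal A^\omega_\gamma f\|_{L^p(\mathbb R^n,\,d\mu)}\le C\langle\mu\rangle_\alpha^{\frac1p}\|f\|_{L^p_\sigma(\mathbb R^d)}$$ holds for all $\mu\in\mathfrak C^n(\alpha)$ and all Schwartz functions $f$ on $\mathbb R^d$. (i) If $m\le d-1$, then $$\sigma\ge\begin{cases}(n-\alpha-2)/p,&\text{if } n-k(\omega)-1<\alpha\le n,\\ (k(\omega)-1)/p,&\text{if } 0<\alpha\le n-k(\omega)-1.\end{cases}$$ (ii) If $m=d$ and $\gamma(s)=(s^{a_1},\dots,s^{a_d})$ for integers $1\le a_1<\dots<a_d$ and $s\in[0,1]$, then $$\sigma\ge\begin{cases}(n-\alpha-2)/p,&\text{if } n-3<\alpha\le n,\\ 1/p,&\text{if } 0<\alpha\le n-3.\end{cases}$$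
   Context: A smooth curve $\gamma:I_\circ=[0,1]\to\mathbb R^d$ is of finite type if for each $s\in I_\circ$ there is a $d$-tuple of positive integers $(a_1,\dots,a_d)$ with $\det\begin{pmatrix}\gamma^{(a_1)}(s)&\cdots&\gamma^{(a_d)}(s)\end{pmatrix}\ne0$. For $\mathbf t=(t_1,\dots,t_m)$ and $\gamma=(\gamma_1,\dots,\gamma_d)$, $\gamma^\omega_{\mathbf t}(s)=(t_{\omega(1)}\gamma_1(s),\dots,t_{\omega(d)}\gamma_d(s))$, and $$k(\omega)=\max_{1\le j\le m}\big|\{i\in\{1,\dots,d\}:\omega(i)=j\}\big|.$$ The averaging operator is $$\mathcal A^\omega_\gamma f(x,\mathbf t)=\prod_{j=1}^m\chi(t_j)\int f(x+\gamma^\omega_{\mathbf t}(s))\,\psi(s)\,ds,$$ where $\chi\in C_0^\infty((1/2,4))$ with $\chi=1$ on $[1,2]$, and $\psi$ is a nonnegative smooth function with $\operatorname{supp}\psi\subset I_\circ$ and $\psi=1$ on a fixed subinterval $I\subset\subset I_\circ$ of positive length. $\|f\|_{L^p_\sigma(\mathbb R^d)}=\|(1-\Delta)^{\sigma/2}f\|_{L^p(\mathbb R^d)}$. $\mathfrak C^n(\alpha)$ is the set of nonnegative Borel measures $\mu$ on $\mathbb R^n$ for which there is $C_\mu$ with $\mu(\mathbb B^n(z,\rho))\le C_\mu\rho^\alpha$ for all $z\in\mathbb R^n$, $\rho>0$ ($\mathbb B^n(z,\rho)$ being the ball of radius $\rho$ centered at $z$), and $\langle\mu\rangle_\alpha=\sup_{z,\rho>0}\rho^{-\alpha}\mu(\mathbb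 B^n(z,\rho))$. *)

theory Defs
  imports "HOL-Analysis.Analysis"
begin

definition iter_deriv ::
  "'a::euclidean_space list \<Rightarrow> ('a \<Rightarrow> 'b::real_normed_vector) \<Rightarrow> 'a \<Rightarrow> 'b" where
  "iter_deriv bs f = foldr (\<lambda>b g x. frechet_derivative g (at x) b) bs f"

(* A list of basis vectors plays the role of a multi-index. Differentiability of every iterated
   partial derivative makes them all continuous, so this is C-infinity on the whole space. *)
definition smooth :: "('a::euclidean_space \<Rightarrow> 'b::real_normed_vector) \<Rightarrow> bool" where
  "smooth f \<longleftrightarrow> (\<forall>bs\<in>lists Basis. \<forall>x. iter_deriv bs f differentiable (at x))"

definition schwartz :: "('a::euclidean_space \<Rightarrow> complex) \<Rightarrow> bool" where
  "schwartz f \<longleftrightarrow> smooth f \<and>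
     (\<forall>bs\<in>lists Basis. \<forall>\<beta>::'a \<Rightarrow> nat.
        bounded (range (\<lambda>x. (\<Prod>b\<in>Basis. (x \<bullet> b) ^ \<beta> b) *\<^sub>R iter_deriv bs f x)))"

definition supp :: "(real \<Rightarrow> real) \<Rightarrow> real set" where
  "supp g = closure {t. g t \<noteq> 0}"

(* One-sided derivatives at the endpoints; only the values of the curve on [0,1] matter. *)
definition curve_deriv ::
  "nat \<Rightarrow> (real \<Rightarrow> 'b::real_normed_vector) \<Rightarrow> real \<Rightarrow> 'b" where
  "curve_deriv k \<gamma> = ((\<lambda>g s. vector_derivative g (at s within {0..1})) ^^ k) \<gamma>"

definition smooth_curve :: "(real \<Rightarrow> 'b::real_normed_vector) \<Rightarrow> bool" where
  "smooth_curve \<gamma> \<longleftrightarrow>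
     (\<forall>k. \<forall>s\<in>{0..1}. curve_deriv k \<gamma> differentiable (at s within {0..1}))"

definition finite_type :: "(real \<Rightarrow> real ^ 'd::finite) \<Rightarrow> bool" where
  "finite_type \<gamma> \<longleftrightarrow>
     (\<forall>s\<in>{0..1}. \<exists>a :: 'd \<Rightarrow> nat. (\<forall>j. a j > 0) \<and>
        det (\<chi> i j. curve_deriv (a j) \<gamma> s $ i) \<noteq> 0)"

definition scaled_curve ::
  "('d::finite \<Rightarrow> 'm::finite) \<Rightarrow> (real \<Rightarrow> real ^ 'd) \<Rightarrow> real ^ 'm \<Rightarrow> real \<Rightarrow> real ^ 'd" where
  "scaled_curve \<omega> \<gamma> t s = (\<chi> i. t $ \<omega> i * \<gamma> s $ i)"

definition max_fibre :: "('d::finite \<Rightarrow> 'm::finite) \<Rightarrow> nat" where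
  "max_fibre \<omega> = (MAX j\<in>UNIV. card {i. \<omega> i = j})"

(* The type product (real^'d) \<times> (real^'m) carries the Euclidean norm of R^(d+m). *)
definition averaging ::
  "(real \<Rightarrow> real) \<Rightarrow> (real \<Rightarrow> real) \<Rightarrow> ('d::finite \<Rightarrow> 'm::finite) \<Rightarrow> (real \<Rightarrow> real ^ 'd) \<Rightarrow>
   (real ^ 'd \<Rightarrow> complex) \<Rightarrow> (real ^ 'd) \<times> (real ^ 'm) \<Rightarrow> complex" where
  "averaging \<chi>0 \<psi> \<omega> \<gamma> f = (\<lambda>(x, t).
     of_real (\<Prod>j\<in>UNIV. \<chi>0 (t $ j)) *
     (LINT s:{0..1}|lborel. f (x + scaled_curve \<omega> \<gamma> t s) * of_real (\<psi> s)))"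

(* Power with positive exponent a. *)
definition ennpowr :: "ennreal \<Rightarrow> real \<Rightarrow> ennreal" where
  "ennpowr x a = (if x = \<infinity> then \<infinity> else ennreal (enn2real x powr a))"

definition Lp_norm :: "real \<Rightarrow> 'a measure \<Rightarrow> ('a \<Rightarrow> complex) \<Rightarrow> ennreal" where
  "Lp_norm p M g = ennpowr (\<integral>\<^sup>+ x. ennreal (norm (g x) powr p) \<partial>M) (1 / p)"

definition fourier :: "('a::euclidean_space \<Rightarrow> complex) \<Rightarrow> 'a \<Rightarrow> complex" where
  "fourier f \<xi> = (LINT x|lborel. cis (- (x \<bullet> \<xi>)) * f x)"

(* (1 - Laplacian)^(\<sigma>/2) f as the Fourier multiplier with symbol (1 + |\<xi>|^2)^(\<sigma>/2); all
   integrals converge absolutely for Schwartz f. *)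
definition bessel_pot :: "real \<Rightarrow> ('a::euclidean_space \<Rightarrow> complex) \<Rightarrow> 'a \<Rightarrow> complex" where
  "bessel_pot \<sigma> f x = of_real (1 / (2 * pi) ^ DIM('a)) *
     (LINT \<xi>|lborel. cis (x \<bullet> \<xi>) * of_real ((1 + (norm \<xi>)\<^sup>2) powr (\<sigma> / 2)) * fourier f \<xi>)"

definition Sobolev_norm :: "real \<Rightarrow> real \<Rightarrow> ('a::euclidean_space \<Rightarrow> complex) \<Rightarrow> ennreal" where
  "Sobolev_norm p \<sigma> f = Lp_norm p lborel (bessel_pot \<sigma> f)"

definition frostman :: "real \<Rightarrow> 'a::euclidean_space measure set" where
  "frostman \<alpha> = {\<mu>. sets \<mu> = sets borel \<and>
     (\<exists>C::real. \<forall>z. \<forall>\<rho>>0. emeasure \<mu> (ball z \<rho>) \<le> ennreal (C * \<rho> powr \<alpha>))}"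

definition frostman_const :: "real \<Rightarrow> 'a::euclidean_space measure \<Rightarrow> ennreal" where
  "frostman_const \<alpha> \<mu> =
     (SUP z. SUP \<rho>\<in>{0<..}. ennreal (\<rho> powr (- \<alpha>)) * emeasure \<mu> (ball z \<rho>))"

end

theory Submission
  imports Defs "HOL-Probability.Probability"
begin

text \<open>
  The test functions are sums of Gaussians along a curve, transported by Bessel potentials. Let \<open>S\<close> be
  a set of \<open>k \<ge> 2\<close> coordinates and let \<open>\<Gamma>\<close> be a fixed curve in these coordinates such that all dilates of
  the given curve whose parameters lie in a suitable set of thickness \<open>1/N\<close> stay within \<open>O(1/N)\<close> of \<open>\<Gamma>\<close>.
  Let \<open>u\<close> be the sum of Gaussians of width \<open>1/N\<close> in the directions \<open>S\<close> and width \<open>1\<close> in the others, centred at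
  \<open>1/N\<close>-separated points of \<open>\<Gamma>\<close>. For \<open>\<sigma> \<ge> 0\<close> let \<open>f\<close> be \<open>1 - \<Delta>\<close> to the power \<open>-\<sigma>/2\<close> applied to \<open>u\<close>.
  Then \<open>f\<close> is at least of order \<open>k - \<sigma>\<close> in \<open>N\<close> near \<open>\<Gamma>\<close>, hence so is its average on a box with \<open>k + 1\<close>
  sides of length \<open>1/N\<close>, while the Sobolev norm of \<open>f\<close> is the \<open>L\<^sup>p\<close> norm of \<open>u\<close>, of order at most
  \<open>k - (k - 1)/p\<close> in \<open>N\<close>. Lebesgue measure on the box times \<open>N\<close> to the power \<open>n - \<beta>\<close>, where
  \<open>\<beta> = max \<alpha> (n - k - 1)\<close>, is \<open>\<alpha>\<close>-dimensional uniformly in \<open>N\<close> and has mass \<open>N\<close> to the power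
  \<open>n - k - 1 - \<beta>\<close>. Comparing powers of \<open>N\<close> gives
  \<open>\<sigma> \<ge> (k - 1 + (n - k - 1) - \<beta>) / p\<close>.

  In part (i), \<open>S\<close> is a largest fibre of \<open>\<omega>\<close>, whose coordinates are all dilated by the same parameter. In part (ii),
  \<open>S\<close> consists of two coordinates with exponents \<open>a < b\<close>, and the curve \<open>(s\<^sup>a, s\<^sup>b)\<close> is invariant
  under the dilations \<open>(y\<^sup>a, y\<^sup>b)\<close>, so the parameters form a neighbourhood of a curved hypersurface.

  Bessel potentials of positive order are positive superpositions of heat flows, and the heat flow only increases the
  variances of a Gaussian, so elementary bounds for Gaussians suffice. For \<open>\<sigma> < 0\<close> the function \<open>f\<close> is
  \<open>u\<close> minus its damped heat flow at time \<open>(B/N)\<^sup>2\<close> for a large constant \<open>B\<close>; this cancellation gains the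
  factor \<open>N\<close> to the power \<open>max \<sigma> (-2)\<close> in the Sobolev norm, and the blurred part is small against the peaks of \<open>u\<close>.
\<close>

subsection \<open>Superpositions of Gaussians\<close>

text \<open>Parametrized by the variance instead of the standard deviation, because the heat flow
  acts by adding to \<open>v\<close>.\<close>

definition gauss :: "real \<Rightarrow> real \<Rightarrow> real" where
  "gauss v x = exp (- (x\<^sup>2) / (2 * v)) / sqrt (2 * pi * v)"

lemma gauss_measurable [measurable]:
  assumes [measurable]: "f \<in> borel_measurable M" "g \<in> borel_measurable M"
  shows "(\<lambda>x. gauss (f x) (g x)) \<in> borel_measurable M"
  unfolding gauss_def by measurable

lemma gauss_nonneg: "v > 0 \<Longrightarrow> gauss v x \<ge> 0"
  by (simp add: gauss_def)

lemma gauss_le: "v > 0 \<Longrightarrow> gauss v x \<le> 1 / sqrt v"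
proof -
  assume v: "v > 0"
  have "exp (- (x\<^sup>2) / (2 * v)) \<le> 1" using v by simp
  moreover have "sqrt v \<le> sqrt (2 * pi * v)"
  proof (rule real_sqrt_le_mono)
    have "1 * v \<le> (2 * pi) * v" using v pi_gt3 by (intro mult_right_mono) auto
    then show "v \<le> 2 * pi * v" by simp
  qed
  ultimately show ?thesis unfolding gauss_def using v by (intro frac_le) auto
qed

lemma gauss_normal_density: "v > 0 \<Longrightarrow> gauss v = normal_density 0 (sqrt v)"
  by (simp add: gauss_def normal_density_def fun_eq_iff)

lemma integrable_gauss: "v > 0 \<Longrightarrow> integrable lborel (gauss v)"
  using integrable_normal_density[of "sqrt v" 0]
  by (simp add: gauss_normal_density)

lemma integral_gauss: "v > 0 \<Longrightarrow> (LINT x|lborel. gauss v x) = 1"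
  using integral_normal_density[of "sqrt v" 0]
  by (simp add: gauss_normal_density)

text \<open>The substitution \<open>x = sqrt v * y\<close> reduces this to the characteristic
  function of the standard normal distribution.\<close>

lemma gauss_fourier:
  assumes v: "v > 0"
  shows "(LINT x|lborel. cis (a * x) * of_real (gauss v x)) = of_real (exp (- (v * a\<^sup>2) / 2))"
proof -
  have std: "(LINT x|lborel. cis (b * x) * of_real (std_normal_density x)) = of_real (exp (- (b\<^sup>2) / 2))" for b
  proof -
    have "char std_normal_distribution b = (LINT x|lborel. std_normal_density x *\<^sub>R iexp (b * x))"
      unfolding char_def by (subst integral_density) auto
    also have "\<dots> = (LINT x|lborel. cis (b * x) * of_real (std_normal_density x))"
      by (intro Bochner_Integration.integral_cong) (auto simp: cis_conv_exp scaleR_conv_of_real mult.commute)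
    finally show ?thesis by (simp add: char_std_normal_distribution)
  qed
  have "(LINT x|lborel. cis (a * x) * of_real (gauss v x)) =
      sqrt v *\<^sub>R (LINT x|lborel. cis (a * (0 + sqrt v * x)) * of_real (gauss v (0 + sqrt v * x)))"
    using v by (subst lborel_integral_real_affine[where c = "sqrt v" and t = 0]) auto
  also have "\<dots> = (LINT x|lborel. cis ((a * sqrt v) * x) * of_real (std_normal_density x))"
    unfolding integral_scaleR_right[symmetric]
    using v by (intro Bochner_Integration.integral_cong)
      (auto simp: gauss_def std_normal_density_def scaleR_conv_of_real power_mult_distrib real_sqrt_mult mult_ac)
  also have "\<dots> = of_real (exp (- ((a * sqrt v)\<^sup>2) / 2))" by (rule std)
  finally show ?thesis using v by (simp add: power_mult_distrib mult.commute)
qed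

text \<open>The transform of a Gaussian is a multiple of the Gaussian with reciprocal variance, so
  that inverse transforms are again instances of \<open>gauss_fourier\<close>.\<close>

lemma exp_eq_gauss:
  assumes "v > 0"
  shows "exp (- (v * x\<^sup>2) / 2) = sqrt (2 * pi / v) * gauss (1 / v) x"
  using assms by (simp add: gauss_def real_sqrt_divide)

lemma integrable_exp_square: "v > 0 \<Longrightarrow> integrable lborel (\<lambda>x::real. exp (- (v * x\<^sup>2) / 2))"
  by (subst exp_eq_gauss) (auto intro: integrable_gauss)

lemma exp_square_fourier:
  assumes v: "v > 0"
  shows "(LINT x|lborel. cis (a * x) * of_real (exp (- (v * x\<^sup>2) / 2))) = of_real (2 * pi * gauss v a)"
proof -
  have "(LINT x|lborel. cis (a * x) * of_real (exp (- (v * x\<^sup>2) / 2)))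
      = (LINT x|lborel. of_real (sqrt (2 * pi / v)) * (cis (a * x) * of_real (gauss (1/v) x)))"
    by (subst exp_eq_gauss[OF v]) (simp only: of_real_mult mult.left_commute)
  also have "\<dots> = of_real (sqrt (2 * pi / v)) * of_real (exp (- (1 / v * a\<^sup>2) / 2))"
    using v by (subst integral_mult_right_zero) (auto simp: gauss_fourier)
  also have "\<dots> = of_real (2 * pi * gauss v a)"
  proof -
    have "sqrt (2 * pi / v) * exp (- (1 / v * a\<^sup>2) / 2) = 2 * pi * gauss v a"
    proof -
      have "sqrt (2 * pi / v) = sqrt ((2 * pi)\<^sup>2 / (2 * pi * v))"
        using v by (simp add: power2_eq_square)
      also have "\<dots> = 2 * pi / sqrt (2 * pi * v)" by (simp only: real_sqrt_divide real_sqrt_abs) simp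
      finally have "sqrt (2 * pi / v) = 2 * pi / sqrt (2 * pi * v)" .
      moreover have "- (1 / v * a\<^sup>2) / 2 = - (a\<^sup>2) / (2 * v)" by simp
      ultimately show ?thesis unfolding gauss_def by simp
    qed
    then show ?thesis by (metis of_real_mult)
  qed
  finally show ?thesis .
qed

section \<open>Product Gaussians and their Fourier transforms\<close>

lemma
  fixes f :: "'a::euclidean_space \<Rightarrow> real \<Rightarrow> 'b::{real_normed_field,banach,second_countable_topology}"
  assumes f: "\<And>b. b \<in> Basis \<Longrightarrow> integrable lborel (f b)"
  shows integrable_lborel_prod: "integrable lborel (\<lambda>x::'a. \<Prod>b\<in>Basis. f b (x \<bullet> b))"
    and integral_lborel_prod: "(LINT x::'a|lborel. (\<Prod>b\<in>Basis. f b (x \<bullet> b))) = (\<Prod>b\<in>Basis. (LINT y|lborel. f b y))"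
proof -
  interpret product_sigma_finite "\<lambda>_::'a. lborel :: real measure" ..
  have [measurable]: "\<And>b. b \<in> Basis \<Longrightarrow> f b \<in> borel_measurable borel" using f by (auto dest: borel_measurable_integrable)
  have [simp]: "(\<Sum>b'\<in>Basis. x b' *\<^sub>R b') \<bullet> b = x b" if "b \<in> Basis" for x and b::'a
    using that by (simp add: inner_sum_left inner_Basis if_distrib cong: if_cong)
  show "integrable lborel (\<lambda>x::'a. \<Prod>b\<in>Basis. f b (x \<bullet> b))"
    by (subst lborel_eq, subst integrable_distr_eq)
      (auto simp: product_integrable_prod f cong: Bochner_Integration.integrable_cong prod.cong)
  show "(LINT x::'a|lborel. (\<Prod>b\<in>Basis. f b (x \<bullet> b))) = (\<Prod>b\<in>Basis. (LINT y|lborel. f b y))"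
    by (subst lborel_eq, subst integral_distr)
      (auto simp: product_integral_prod f cong: Bochner_Integration.integral_cong prod.cong)
qed

definition Gauss :: "('a::euclidean_space \<Rightarrow> real) \<Rightarrow> 'a \<Rightarrow> real" where
  "Gauss w x = (\<Prod>b\<in>Basis. gauss (w b) (x \<bullet> b))"

text \<open>The Fourier transform of \<open>Gauss w\<close>. It is real and even, so it comes out
  the same for either sign in the exponential.\<close>

definition Gauss_symbol :: "('a::euclidean_space \<Rightarrow> real) \<Rightarrow> 'a \<Rightarrow> real" where
  "Gauss_symbol w \<xi> = (\<Prod>b\<in>Basis. exp (- (w b * (\<xi> \<bullet> b)\<^sup>2) / 2))"

lemma Gauss_nonneg: "(\<And>b. b \<in> Basis \<Longrightarrow> w b > 0) \<Longrightarrow> Gauss w x \<ge> 0"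
  unfolding Gauss_def by (intro prod_nonneg) (auto intro: gauss_nonneg)

lemma Gauss_symbol_nonneg: "Gauss_symbol w x \<ge> 0"
  unfolding Gauss_symbol_def by (intro prod_nonneg) auto

lemma integrable_Gauss: "(\<And>b. b \<in> Basis \<Longrightarrow> w b > 0) \<Longrightarrow> integrable lborel (Gauss w)"
  unfolding Gauss_def[abs_def] by (intro integrable_lborel_prod integrable_gauss)

lemma integral_Gauss: "(\<And>b. b \<in> Basis \<Longrightarrow> w b > 0) \<Longrightarrow> (LINT x|lborel. Gauss w x) = 1"
  unfolding Gauss_def[abs_def] by (subst integral_lborel_prod) (auto intro: integrable_gauss simp: integral_gauss)

lemma integrable_Gauss_symbol: "(\<And>b. b \<in> Basis \<Longrightarrow> w b > 0) \<Longrightarrow> integrable lborel (Gauss_symbol w)"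
  unfolding Gauss_symbol_def[abs_def] by (intro integrable_lborel_prod integrable_exp_square)

lemma cis_sum: "cis (sum f A) = (\<Prod>a\<in>A. cis (f a))"
  by (induction A rule: infinite_finite_induct) (auto simp: cis_mult[symmetric])

lemma cis_inner: "cis (x \<bullet> \<xi>) = (\<Prod>b\<in>Basis. cis ((x \<bullet> b) * (\<xi> \<bullet> b)))" for x :: "'a::euclidean_space"
  by (subst euclidean_inner) (simp add: cis_sum)

lemma integrable_cis_mult:
  assumes "integrable lborel (f :: 'a::euclidean_space \<Rightarrow> real)"
  shows "integrable lborel (\<lambda>x. cis (x \<bullet> a) * of_real (f x))"
proof (rule Bochner_Integration.integrable_bound)
  show "integrable lborel (\<lambda>x. complex_of_real (f x))" using assms by simp
  have [measurable]: "f \<in> borel_measurable borel" using assms by auto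
  have "(\<lambda>x. cis (x \<bullet> a)) \<in> borel_measurable borel"
    by (intro borel_measurable_continuous_onI continuous_intros)
  then show "(\<lambda>x. cis (x \<bullet> a) * of_real (f x)) \<in> borel_measurable lborel" by simp
qed (auto simp: norm_mult)

lemma integrable_cis_mult_real:
  "integrable lborel f \<Longrightarrow> integrable lborel (\<lambda>x. cis (a * x) * of_real (f x))"
  using integrable_cis_mult[of f a] by (simp add: mult.commute)

lemma Gauss_fourier:
  fixes \<xi> :: "'a::euclidean_space"
  assumes w: "\<And>b. b \<in> Basis \<Longrightarrow> w b > 0"
  shows "(LINT x|lborel. cis (x \<bullet> \<xi>) * of_real (Gauss w x)) = of_real (Gauss_symbol w \<xi>)"
proof -
  have "(LINT x|lborel. cis (x \<bullet> \<xi>) * of_real (Gauss w x)) =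
     (LINT x|lborel. (\<Prod>b\<in>Basis. cis ((\<xi> \<bullet> b) * (x \<bullet> b)) * of_real (gauss (w b) (x \<bullet> b))))"
    by (intro Bochner_Integration.integral_cong) (auto simp: cis_inner Gauss_def prod.distrib mult.commute)
  also have "\<dots> = (\<Prod>b\<in>Basis. (LINT y|lborel. cis ((\<xi> \<bullet> b) * y) * of_real (gauss (w b) y)))"
    using w by (subst integral_lborel_prod[where f = "\<lambda>b y. cis ((\<xi> \<bullet> b) * y) * of_real (gauss (w b) y)"]) (auto simp only: intro!: integrable_cis_mult_real integrable_gauss)
  also have "\<dots> = of_real (Gauss_symbol w \<xi>)"
    using w by (simp add: gauss_fourier Gauss_symbol_def del: of_real_exp)
  finally show ?thesis .
qed

lemma Gauss_symbol_fourier: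
  fixes x :: "'a::euclidean_space"
  assumes w: "\<And>b. b \<in> Basis \<Longrightarrow> w b > 0"
  shows "(LINT \<xi>|lborel. cis (\<xi> \<bullet> x) * of_real (Gauss_symbol w \<xi>)) = of_real ((2 * pi) ^ DIM('a) * Gauss w x)"
proof -
  have "(LINT \<xi>|lborel. cis (\<xi> \<bullet> x) * of_real (Gauss_symbol w \<xi>)) =
     (LINT \<xi>|lborel. (\<Prod>b\<in>Basis. cis ((x \<bullet> b) * (\<xi> \<bullet> b)) * of_real (exp (- (w b * (\<xi> \<bullet> b)\<^sup>2) / 2))))"
    by (intro Bochner_Integration.integral_cong) (auto simp: cis_inner Gauss_symbol_def prod.distrib mult.commute simp del: of_real_exp)
  also have "\<dots> = (\<Prod>b\<in>Basis. (LINT y|lborel. cis ((x \<bullet> b) * y) * of_real (exp (- (w b * y\<^sup>2) / 2))))"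
    using w by (subst integral_lborel_prod[where f = "\<lambda>b y. cis ((x \<bullet> b) * y) * of_real (exp (- (w b * y\<^sup>2) / 2))"]) (auto simp only: intro!: integrable_cis_mult_real integrable_exp_square)
  also have "\<dots> = of_real ((2 * pi) ^ DIM('a) * Gauss w x)"
    using w by (simp only: exp_square_fourier Gauss_def cong: prod.cong) (simp add: prod.distrib)
  finally show ?thesis .
qed

text \<open>The heat semigroup at time \<open>s\<close> adds \<open>2 s\<close> to every variance.\<close>

abbreviation heat :: "('a \<Rightarrow> real) \<Rightarrow> real \<Rightarrow> 'a \<Rightarrow> real" where
  "heat w s \<equiv> \<lambda>b. w b + 2 * s"

section \<open>Superpositions of heat flows\<close>

definition mix :: "'i measure \<Rightarrow> ('i \<Rightarrow> real) \<Rightarrow> ('i \<Rightarrow> real) \<Rightarrow> ('a::euclidean_space \<Rightarrow> real) \<Rightarrow> 'a \<Rightarrow> real" where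
  "mix M \<kappa> \<theta> w y = (LINT i|M. \<kappa> i * Gauss (heat w (\<theta> i)) y)"

lemma Gauss_measurable [measurable]:
  fixes g :: "'i \<Rightarrow> 'a::euclidean_space"
  assumes [measurable]: "\<And>b. b \<in> Basis \<Longrightarrow> (\<lambda>i. f i b) \<in> borel_measurable M" "g \<in> borel_measurable M"
  shows "(\<lambda>i. Gauss (f i) (g i)) \<in> borel_measurable M"
  unfolding Gauss_def by measurable

lemma Gauss_symbol_measurable [measurable]:
  fixes g :: "'i \<Rightarrow> 'a::euclidean_space"
  assumes [measurable]: "\<And>b. b \<in> Basis \<Longrightarrow> (\<lambda>i. f i b) \<in> borel_measurable M" "g \<in> borel_measurable M"
  shows "(\<lambda>i. Gauss_symbol (f i) (g i)) \<in> borel_measurable M"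
  unfolding Gauss_symbol_def by measurable

lemma norm_square_Basis: "(norm (x::'a::euclidean_space))\<^sup>2 = (\<Sum>b\<in>Basis. (x \<bullet> b)\<^sup>2)"
  unfolding power2_norm_eq_inner by (subst euclidean_inner) (simp add: power2_eq_square)

lemma Gauss_symbol_shift:
  "Gauss_symbol (heat w s) \<xi> = Gauss_symbol w \<xi> * exp (- (s * (norm \<xi>)\<^sup>2))"
proof -
  have "exp (- (s * (norm \<xi>)\<^sup>2)) = (\<Prod>b\<in>Basis. exp (- (s * (\<xi> \<bullet> b)\<^sup>2)))"
    by (simp add: norm_square_Basis exp_sum sum_distrib_left sum_negf[symmetric])
  moreover have "- ((w b + 2 * s) * t) / 2 = - (w b * t) / 2 + - (s * t)" for b t
    by (simp add: field_simps)
  ultimately show ?thesis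
    unfolding Gauss_symbol_def by (simp only: prod.distrib[symmetric] exp_add[symmetric])
qed

lemma cis_inner_measurable [measurable]:
  fixes f g :: "'i \<Rightarrow> 'a::euclidean_space"
  assumes [measurable]: "f \<in> borel_measurable M" "g \<in> borel_measurable M"
  shows "(\<lambda>x. cis (f x \<bullet> g x)) \<in> borel_measurable M"
  unfolding cis_conv_exp by measurable

text \<open>All three claims are Fubini on the product measure: the integrals of the
  \<open>g i\<close> are at most \<open>C\<close>, so \<open>C * |\<kappa> i|\<close> dominates the
  inner integrals.\<close>

lemma (in sigma_finite_measure)
  fixes g :: "'a \<Rightarrow> 'b::euclidean_space \<Rightarrow> real"
  assumes k: "integrable M \<kappa>"
    and g [measurable]: "(\<lambda>(i, y). g i y) \<in> borel_measurable (M \<Otimes>\<^sub>M lborel)"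
    and gi: "\<And>i. integrable lborel (g i)" and gn: "\<And>i y. g i y \<ge> 0"
    and gb: "\<And>i. (LINT y|lborel. g i y) \<le> C"
  shows integrable_average: "integrable lborel (\<lambda>y. LINT i|M. \<kappa> i * g i y)"
    and fourier_average: "(LINT y|lborel. cis (y \<bullet> a) * of_real (LINT i|M. \<kappa> i * g i y)) =
      (LINT i|M. of_real (\<kappa> i) * (LINT y|lborel. cis (y \<bullet> a) * of_real (g i y)))"
    and nn_average: "(\<integral>\<^sup>+ y. ennreal (LINT i|M. \<bar>\<kappa> i\<bar> * g i y) \<partial>lborel) \<le> ennreal (C * (LINT i|M. \<bar>\<kappa> i\<bar>))"
proof -
  interpret P: pair_sigma_finite M "lborel :: 'b measure" ..
  have [measurable]: "\<kappa> \<in> borel_measurable M" using k by auto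
  have "0 \<le> (LINT y|lborel. g undefined y)" using gn by (intro integral_nonneg_AE) auto
  then have C: "C \<ge> 0" using gb[of undefined] by linarith
  have [measurable]: "(\<lambda>x. g (fst x) (snd x)) \<in> borel_measurable (M \<Otimes>\<^sub>M lborel)"
    using g by (simp add: case_prod_beta')
  have I: "integrable (M \<Otimes>\<^sub>M lborel) (\<lambda>(i, y). cis (y \<bullet> a) * of_real (\<kappa> i * g i y))" for a
  proof (rule P.Fubini_integrable)
    show "(\<lambda>(i, y). cis (y \<bullet> a) * complex_of_real (\<kappa> i * g i y)) \<in> borel_measurable (M \<Otimes>\<^sub>M lborel)"
      unfolding case_prod_beta' by measurable
    show "integrable M (\<lambda>x. LINT y|lborel. norm (case (x, y) of (i, y) \<Rightarrow> cis (y \<bullet> a) * complex_of_real (\<kappa> i * g i y)))"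
    proof (rule Bochner_Integration.integrable_bound)
      show "integrable M (\<lambda>i. C * \<bar>\<kappa> i\<bar>)" using k by auto
      show "AE x in M. norm (LINT y|lborel. norm (case (x, y) of (i, y) \<Rightarrow> cis (y \<bullet> a) * complex_of_real (\<kappa> i * g i y)))
         \<le> norm (C * \<bar>\<kappa> x\<bar>)"
        using gn gb C by (intro AE_I2)
          (auto simp: norm_mult abs_mult integral_nonneg_AE mult.commute[of C] intro!: mult_left_mono)
    qed simp
    show "AE x in M. integrable lborel (\<lambda>y. case (x, y) of (i, y) \<Rightarrow> cis (y \<bullet> a) * complex_of_real (\<kappa> i * g i y))"
      using gi by (intro AE_I2) (auto intro!: integrable_cis_mult simp del: of_real_mult)
  qed
  \<comment> \<open>For \<open>a = 0\<close> the character is constantly 1, so the real part is the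
    integrand itself.\<close>
  have I1: "integrable (M \<Otimes>\<^sub>M lborel) (\<lambda>(i, y). \<kappa> i * g i y)"
    using integrable_Re[OF I[of 0]] by (simp add: case_prod_beta')
  show "integrable lborel (\<lambda>y. LINT i|M. \<kappa> i * g i y)"
    using P.integrable_snd[OF I1] by simp
  have "(LINT y|lborel. cis (y \<bullet> a) * of_real (LINT i|M. \<kappa> i * g i y)) =
      (LINT y|lborel. (LINT i|M. cis (y \<bullet> a) * of_real (\<kappa> i * g i y)))"
    by (simp only: integral_mult_right_zero integral_complex_of_real)
  also have "\<dots> = (LINT i|M. (LINT y|lborel. cis (y \<bullet> a) * of_real (\<kappa> i * g i y)))"
    using P.Fubini_integral[OF I[of a]] by simp
  also have "\<dots> = (LINT i|M. of_real (\<kappa> i) * (LINT y|lborel. cis (y \<bullet> a) * of_real (g i y)))"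
    by (simp only: of_real_mult mult.left_commute[of _ "complex_of_real (\<kappa> _)"] integral_mult_right_zero)
  finally show "(LINT y|lborel. cis (y \<bullet> a) * of_real (LINT i|M. \<kappa> i * g i y)) =
      (LINT i|M. of_real (\<kappa> i) * (LINT y|lborel. cis (y \<bullet> a) * of_real (g i y)))" .
  have "(\<integral>\<^sup>+ y. ennreal (LINT i|M. \<bar>\<kappa> i\<bar> * g i y) \<partial>lborel) \<le> (\<integral>\<^sup>+ y. (\<integral>\<^sup>+ i. ennreal (\<bar>\<kappa> i\<bar> * g i y) \<partial>M) \<partial>lborel)"
  proof (rule nn_integral_mono)
    fix y :: 'b
    show "ennreal (LINT i|M. \<bar>\<kappa> i\<bar> * g i y) \<le> (\<integral>\<^sup>+ i. ennreal (\<bar>\<kappa> i\<bar> * g i y) \<partial>M)"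
    \<comment> \<open>Without integrability the Bochner integral is 0 by convention, and the
      inequality is trivial.\<close>
    proof (cases "integrable M (\<lambda>i. \<bar>\<kappa> i\<bar> * g i y)")
      case True
      then show ?thesis using gn by (subst nn_integral_eq_integral) auto
    qed (simp add: not_integrable_integral_eq)
  qed
  also have "\<dots> = (\<integral>\<^sup>+ i. (\<integral>\<^sup>+ y. ennreal (\<bar>\<kappa> i\<bar> * g i y) \<partial>lborel) \<partial>M)"
    by (rule P.Fubini') (simp add: case_prod_beta')
  also have "\<dots> \<le> (\<integral>\<^sup>+ i. ennreal (C * \<bar>\<kappa> i\<bar>) \<partial>M)"
  proof (rule nn_integral_mono)
    fix i
    have "(\<integral>\<^sup>+ y. ennreal (\<bar>\<kappa> i\<bar> * g i y) \<partial>lborel) = ennreal (LINT y|lborel. \<bar>\<kappa> i\<bar> * g i y)"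
      using gi gn by (intro nn_integral_eq_integral) auto
    also have "\<dots> \<le> ennreal (C * \<bar>\<kappa> i\<bar>)"
      using mult_left_mono[OF gb[of i], of "\<bar>\<kappa> i\<bar>"] by (intro ennreal_leI) (auto simp: mult.commute)
    finally show "(\<integral>\<^sup>+ y. ennreal (\<bar>\<kappa> i\<bar> * g i y) \<partial>lborel) \<le> ennreal (C * \<bar>\<kappa> i\<bar>)" .
  qed
  also have "\<dots> = ennreal (C * (LINT i|M. \<bar>\<kappa> i\<bar>))"
    using k C by (subst nn_integral_eq_integral) auto
  finally show "(\<integral>\<^sup>+ y. ennreal (LINT i|M. \<bar>\<kappa> i\<bar> * g i y) \<partial>lborel) \<le> ennreal (C * (LINT i|M. \<bar>\<kappa> i\<bar>))" .
qed

text \<open>The weight may be signed, but time only runs forward. Hence all variances dominate those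
  of \<open>w\<close>, which yields bounds uniform in the index.\<close>

locale gauss_mix = sigma_finite_measure M
  for M :: "'i measure" +
  fixes \<kappa> \<theta> :: "'i \<Rightarrow> real" and w :: "'a::euclidean_space \<Rightarrow> real"
  assumes integrable_weight: "integrable M \<kappa>"
    and time_measurable [measurable]: "\<theta> \<in> borel_measurable M"
    and time_nonneg: "\<And>i. \<theta> i \<ge> 0"
    and variance_pos: "\<And>b. b \<in> Basis \<Longrightarrow> w b > 0"
begin

lemma weight_measurable [measurable]: "\<kappa> \<in> borel_measurable M"
  using integrable_weight by auto

lemma shifted_pos: "b \<in> Basis \<Longrightarrow> w b + 2 * \<theta> i > 0"
  using variance_pos[of b] time_nonneg[of i] by simp

lemma joint_measurable: "(\<lambda>(i, y). Gauss (heat w (\<theta> i)) y) \<in> borel_measurable (M \<Otimes>\<^sub>M lborel)"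
  unfolding case_prod_beta' by measurable

lemma joint_measurable_symbol: "(\<lambda>(i, y). Gauss_symbol (heat w (\<theta> i)) y) \<in> borel_measurable (M \<Otimes>\<^sub>M lborel)"
  unfolding case_prod_beta' by measurable

lemma integrable_mix: "integrable lborel (mix M \<kappa> \<theta> w)"
  unfolding mix_def[abs_def]
  by (rule integrable_average[OF integrable_weight joint_measurable, where C = 1])
    (auto intro: integrable_Gauss Gauss_nonneg shifted_pos simp: integral_Gauss shifted_pos)

definition symbol :: "'a \<Rightarrow> real" where
  "symbol \<xi> = (LINT i|M. \<kappa> i * Gauss_symbol (heat w (\<theta> i)) \<xi>)"

text \<open>The heat flow contributes a factor depending only on \<open>|\<xi>|^2\<close>.
  Multipliers that are functions of the Laplacian thereby turn into scalar identities for a Laplace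
  transform of the weight.\<close>

lemma symbol_eq: "symbol \<xi> = Gauss_symbol w \<xi> * (LINT i|M. \<kappa> i * exp (- (\<theta> i * (norm \<xi>)\<^sup>2)))"
  unfolding symbol_def Gauss_symbol_shift by (subst integral_mult_right_zero[symmetric]) (simp only: mult.left_commute)

lemma mix_fourier: "(LINT y|lborel. cis (y \<bullet> \<xi>) * of_real (mix M \<kappa> \<theta> w y)) = of_real (symbol \<xi>)"
proof -
  have "(LINT y|lborel. cis (y \<bullet> \<xi>) * of_real (mix M \<kappa> \<theta> w y)) =
    (LINT i|M. of_real (\<kappa> i) * (LINT y|lborel. cis (y \<bullet> \<xi>) * of_real (Gauss (heat w (\<theta> i)) y)))"
    unfolding mix_def
    by (rule fourier_average[OF integrable_weight joint_measurable, where C = 1])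
      (auto intro: integrable_Gauss Gauss_nonneg shifted_pos simp: integral_Gauss shifted_pos)
  also have "\<dots> = of_real (symbol \<xi>)"
    by (simp add: Gauss_fourier shifted_pos symbol_def flip: integral_complex_of_real)
  finally show ?thesis .
qed

lemma Gauss_symbol_shift_le: "Gauss_symbol (heat w (\<theta> i)) \<xi> \<le> Gauss_symbol w \<xi>"
  unfolding Gauss_symbol_shift using time_nonneg[of i] Gauss_symbol_nonneg
  by (intro mult_right_le_one_le) auto

text \<open>Fourier inversion for the mixture is that of the single Gaussians, averaged over the
  index. Forward heat flow only shrinks the symbols, so their integrals are uniformly bounded by
  that of \<open>Gauss_symbol w\<close>.\<close>

lemma
  shows symbol_fourier: "(LINT \<xi>|lborel. cis (\<xi> \<bullet> x) * of_real (symbol \<xi>)) = of_real ((2 * pi) ^ DIM('a) * mix M \<kappa> \<theta> w x)"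
    and integrable_symbol: "integrable lborel symbol"
proof -
  have B: "(LINT y|lborel. Gauss_symbol (heat w (\<theta> i)) y) \<le> (LINT y|lborel. Gauss_symbol w y)" for i
    by (intro integral_mono integrable_Gauss_symbol shifted_pos variance_pos Gauss_symbol_shift_le)
  show "integrable lborel symbol"
    unfolding symbol_def[abs_def]
    by (rule integrable_average[OF integrable_weight joint_measurable_symbol, where C = "LINT y|lborel. Gauss_symbol w y"])
      (auto intro: integrable_Gauss_symbol Gauss_symbol_nonneg shifted_pos B)
  have "(LINT \<xi>|lborel. cis (\<xi> \<bullet> x) * of_real (symbol \<xi>)) =
    (LINT i|M. of_real (\<kappa> i) * (LINT y|lborel. cis (y \<bullet> x) * of_real (Gauss_symbol (heat w (\<theta> i)) y)))"
    unfolding symbol_def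
    by (rule fourier_average[OF integrable_weight joint_measurable_symbol, where C = "LINT y|lborel. Gauss_symbol w y"])
      (auto intro: integrable_Gauss_symbol Gauss_symbol_nonneg shifted_pos B)
  also have "\<dots> = (LINT i|M. complex_of_real ((2 * pi) ^ DIM('a)) * of_real (\<kappa> i * Gauss (heat w (\<theta> i)) x))"
    by (simp only: Gauss_symbol_fourier shifted_pos of_real_mult mult.left_commute)
  also have "\<dots> = of_real ((2 * pi) ^ DIM('a) * mix M \<kappa> \<theta> w x)"
    by (simp only: integral_mult_right_zero integral_complex_of_real mix_def) simp
  finally show "(LINT \<xi>|lborel. cis (\<xi> \<bullet> x) * of_real (symbol \<xi>)) = of_real ((2 * pi) ^ DIM('a) * mix M \<kappa> \<theta> w x)" .
qed

lemma abs_mix_le: "\<bar>mix M \<kappa> \<theta> w y\<bar> \<le> mix M (\<lambda>i. \<bar>\<kappa> i\<bar>) \<theta> w y"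
proof -
  have "\<bar>mix M \<kappa> \<theta> w y\<bar> \<le> (LINT i|M. \<bar>\<kappa> i * Gauss (heat w (\<theta> i)) y\<bar>)"
    unfolding mix_def by (rule integral_abs_bound)
  also have "\<dots> = mix M (\<lambda>i. \<bar>\<kappa> i\<bar>) \<theta> w y"
    unfolding mix_def by (intro Bochner_Integration.integral_cong) (auto simp: abs_mult Gauss_nonneg shifted_pos)
  finally show ?thesis .
qed

lemma nn_integral_mix_le:
  "(\<integral>\<^sup>+ y. ennreal (mix M (\<lambda>i. \<bar>\<kappa> i\<bar>) \<theta> w y) \<partial>lborel) \<le> ennreal (LINT i|M. \<bar>\<kappa> i\<bar>)"
  using nn_average[OF integrable_weight joint_measurable, where C = 1] unfolding mix_def
  by (auto intro: integrable_Gauss Gauss_nonneg shifted_pos simp: integral_Gauss shifted_pos)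

end

section \<open>Sums of translates and their Bessel potentials\<close>

lemma
  fixes f :: "'a::euclidean_space \<Rightarrow> 'b::{banach,second_countable_topology}"
  assumes [measurable]: "f \<in> borel_measurable borel"
  shows lborel_integral_translation: "(LINT x|lborel. f (x - c)) = (LINT x|lborel. f x)"
    and lborel_integrable_translation: "integrable lborel (\<lambda>x. f (x - c)) \<longleftrightarrow> integrable lborel f"
proof -
  have "distr lborel lborel ((+) c) = (lborel :: 'a measure)"
    using lborel_distr_plus[of c] by (simp cong: distr_cong)
  then show "(LINT x|lborel. f (x - c)) = (LINT x|lborel. f x)"
    and "integrable lborel (\<lambda>x. f (x - c)) \<longleftrightarrow> integrable lborel f"
    using integral_distr[of "(+) c" lborel lborel "\<lambda>x. f (x - c)"]
      integrable_distr_eq[of "(+) c" lborel lborel "\<lambda>x. f (x - c)"] by simp_all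
qed

abbreviation packet ::
  "'i measure \<Rightarrow> ('i \<Rightarrow> real) \<Rightarrow> ('i \<Rightarrow> real) \<Rightarrow> ('a::euclidean_space \<Rightarrow> real) \<Rightarrow> 'j set \<Rightarrow> ('j \<Rightarrow> 'a) \<Rightarrow> 'a \<Rightarrow> complex" where
  "packet M \<kappa> \<theta> w J Y \<equiv> \<lambda>y. of_real (\<Sum>j\<in>J. mix M \<kappa> \<theta> w (y - Y j))"

lemma (in gauss_mix) fourier_sum_mix:
  assumes "finite J"
  shows "fourier (packet M \<kappa> \<theta> w J Y) \<xi> = (\<Sum>j\<in>J. cis (- (Y j \<bullet> \<xi>))) * of_real (symbol (- \<xi>))"
proof -
  have [measurable]: "mix M \<kappa> \<theta> w \<in> borel_measurable borel"
    using integrable_mix by auto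
  \<comment> \<open>Translation by \<open>c\<close> becomes a phase. The argument is
    \<open>- \<xi>\<close> because \<open>fourier\<close> and \<open>mix_fourier\<close> use
    opposite signs.\<close>
  have eq: "cis (- (y \<bullet> \<xi>)) * of_real (mix M \<kappa> \<theta> w (y - c)) = cis (- (c \<bullet> \<xi>)) * (cis ((y - c) \<bullet> (- \<xi>)) * of_real (mix M \<kappa> \<theta> w (y - c)))" for y c
    by (simp add: inner_diff_left cis_mult mult.assoc[symmetric] del: of_real_mult)
  have I: "integrable lborel (\<lambda>y. cis (- (y \<bullet> \<xi>)) * of_real (mix M \<kappa> \<theta> w (y - c)))" for c
  proof -
    have "integrable lborel (\<lambda>y. cis (y \<bullet> (- \<xi>)) * of_real (mix M \<kappa> \<theta> w (y - c)))"
      using integrable_mix by (intro integrable_cis_mult) (simp add: lborel_integrable_translation)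
    then show ?thesis by simp
  qed
  have "fourier (packet M \<kappa> \<theta> w J Y) \<xi> = (LINT y|lborel. (\<Sum>j\<in>J. cis (- (y \<bullet> \<xi>)) * of_real (mix M \<kappa> \<theta> w (y - Y j))))"
    unfolding fourier_def by (simp add: sum_distrib_left)
  also have "\<dots> = (\<Sum>j\<in>J. LINT y|lborel. cis (- (y \<bullet> \<xi>)) * of_real (mix M \<kappa> \<theta> w (y - Y j)))"
    by (rule Bochner_Integration.integral_sum) (rule I)
  also have "\<dots> = (\<Sum>j\<in>J. cis (- (Y j \<bullet> \<xi>)) * of_real (symbol (- \<xi>)))"
  proof (rule sum.cong)
    fix j
    show "(LINT y|lborel. cis (- (y \<bullet> \<xi>)) * of_real (mix M \<kappa> \<theta> w (y - Y j))) = cis (- (Y j \<bullet> \<xi>)) * of_real (symbol (- \<xi>))"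
      unfolding eq integral_mult_right_zero
      by (subst lborel_integral_translation[where f = "\<lambda>y. cis (y \<bullet> (-\<xi>)) * of_real (mix M \<kappa> \<theta> w y)"])
        (simp_all only: mix_fourier, measurable)
  qed simp
  finally show ?thesis by (simp add: sum_distrib_right)
qed

text \<open>Both symbols contain the factor \<open>Gauss_symbol w\<close>, and the translations
  contribute the same phases. So the Bessel potential maps one packet to another with the same
  centres and initial variances as soon as the Laplace transforms of the weights match at
  \<open>q = |\<xi>|^2\<close>.\<close>

lemma bessel_pot_sum_mix:
  fixes w :: "'a::euclidean_space \<Rightarrow> real" and x :: 'a
  assumes 1: "gauss_mix M \<kappa> \<theta> w" and 2: "gauss_mix M' \<kappa>' \<theta>' w" and J: "finite J"
    and eq: "\<And>q. q \<ge> 0 \<Longrightarrow> (1 + q) powr (\<sigma> / 2) * (LINT i|M. \<kappa> i * exp (- (\<theta> i * q))) = (LINT i|M'. \<kappa>' i * exp (- (\<theta>' i * q)))"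
  shows "bessel_pot \<sigma> (packet M \<kappa> \<theta> w J Y) x = of_real (\<Sum>j\<in>J. mix M' \<kappa>' \<theta>' w (x - Y j))"
proof -
  interpret A: gauss_mix M \<kappa> \<theta> w by fact
  interpret B: gauss_mix M' \<kappa>' \<theta>' w by fact
  have ev: "A.symbol (- \<xi>) = A.symbol \<xi>" for \<xi> by (simp add: A.symbol_def Gauss_symbol_def)
  have s: "(1 + (norm \<xi>)\<^sup>2) powr (\<sigma> / 2) * A.symbol \<xi> = B.symbol \<xi>" for \<xi>
    unfolding A.symbol_eq B.symbol_eq using eq[of "(norm \<xi>)\<^sup>2"] by (simp add: mult.left_commute)
  have "cis (x \<bullet> \<xi>) * of_real ((1 + (norm \<xi>)\<^sup>2) powr (\<sigma> / 2)) * fourier (packet M \<kappa> \<theta> w J Y) \<xi>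
      = (\<Sum>j\<in>J. cis (\<xi> \<bullet> (x - Y j)) * of_real (B.symbol \<xi>))" for \<xi>
  proof -
    have "cis (x \<bullet> \<xi>) * of_real ((1 + (norm \<xi>)\<^sup>2) powr (\<sigma> / 2)) * ((\<Sum>j\<in>J. cis (- (Y j \<bullet> \<xi>))) * of_real (A.symbol \<xi>))
       = (\<Sum>j\<in>J. cis (x \<bullet> \<xi>) * cis (- (Y j \<bullet> \<xi>))) * of_real ((1 + (norm \<xi>)\<^sup>2) powr (\<sigma> / 2) * A.symbol \<xi>)"
      by (simp only: sum_distrib_left[symmetric] of_real_mult) (simp only: mult_ac)
    also have "\<dots> = (\<Sum>j\<in>J. cis (\<xi> \<bullet> (x - Y j)) * of_real (B.symbol \<xi>))"
      unfolding s by (simp add: sum_distrib_right cis_mult inner_diff_right inner_commute)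
    finally show ?thesis unfolding A.fourier_sum_mix[OF J] ev .
  qed
  then have "bessel_pot \<sigma> (packet M \<kappa> \<theta> w J Y) x =
     of_real (1 / (2 * pi) ^ DIM('a)) * (LINT \<xi>|lborel. (\<Sum>j\<in>J. cis (\<xi> \<bullet> (x - Y j)) * of_real (B.symbol \<xi>)))"
    unfolding bessel_pot_def by simp
  also have "(LINT \<xi>|lborel. (\<Sum>j\<in>J. cis (\<xi> \<bullet> (x - Y j)) * of_real (B.symbol \<xi>))) = (\<Sum>j\<in>J. of_real ((2 * pi) ^ DIM('a) * mix M' \<kappa>' \<theta>' w (x - Y j)))"
    by (subst Bochner_Integration.integral_sum) (auto intro!: integrable_cis_mult B.integrable_symbol simp: B.symbol_fourier)
  also have "of_real (1 / (2 * pi) ^ DIM('a)) * \<dots> = complex_of_real (\<Sum>j\<in>J. mix M' \<kappa>' \<theta>' w (x - Y j))"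
    by (simp add: sum_distrib_left)
  finally show ?thesis .
qed

subsection \<open>Schwartz bounds\<close>

text \<open>Hermite recursion; for \<open>n = 0\<close> the truncated index \<open>n - 1\<close> is multiplied by \<open>0\<close>.\<close>

fun gauss_deriv :: "nat \<Rightarrow> real \<Rightarrow> real \<Rightarrow> real" where
  "gauss_deriv 0 v x = gauss v x"
| "gauss_deriv (Suc n) v x = - (x * gauss_deriv n v x + real n * gauss_deriv (n - 1) v x) / v"

declare gauss_deriv.simps(2) [simp del]

lemma gauss_deriv_measurable [measurable]:
  assumes [measurable]: "f \<in> borel_measurable M" "g \<in> borel_measurable M"
  shows "(\<lambda>x. gauss_deriv n (f x) (g x)) \<in> borel_measurable M"
proof (induction n rule: less_induct)
  case (less n)
  show ?case
  proof (cases n)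
    case (Suc m)
    have [measurable]: "(\<lambda>x. gauss_deriv m (f x) (g x)) \<in> borel_measurable M"
      "(\<lambda>x. gauss_deriv (m - 1) (f x) (g x)) \<in> borel_measurable M" using less[of m] less[of "m - 1"] Suc by auto
    show ?thesis unfolding Suc gauss_deriv.simps by measurable
  qed simp
qed

text \<open>Differentiating the recursion for one index gives the recursion for the next: the
  product rule turns \<open>m\<close> copies of the lower term into \<open>m + 1\<close>.\<close>

lemma gauss_deriv_has_derivative:
  "v > 0 \<Longrightarrow> (gauss_deriv n v has_real_derivative gauss_deriv (Suc n) v x) (at x)"
proof (induction n arbitrary: x rule: less_induct)
  case (less n)
  show ?case
  proof (cases n)
    case 0
    have "(gauss v has_real_derivative - (x * gauss v x) / v) (at x)"
      unfolding gauss_def[abs_def] using less.prems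
      by (auto intro!: derivative_eq_intros simp: field_simps power2_eq_square)
    moreover have "gauss_deriv 0 v = gauss v" by (simp add: fun_eq_iff)
    ultimately show ?thesis unfolding 0 by (simp add: gauss_deriv.simps(2))
  next
    case (Suc m)
    have d1: "(gauss_deriv m v has_real_derivative gauss_deriv (Suc m) v x) (at x)"
      using less.IH[of m] less.prems Suc by simp
    have d0: "((\<lambda>x. real m * gauss_deriv (m - 1) v x) has_real_derivative real m * gauss_deriv m v x) (at x)"
      using less.IH[of "m - 1"] less.prems Suc by (cases m) (auto intro: DERIV_cmult)
    have "((\<lambda>x. - (x * gauss_deriv m v x + real m * gauss_deriv (m - 1) v x) / v)
      has_real_derivative - (1 * gauss_deriv m v x + gauss_deriv (Suc m) v x * x + real m * gauss_deriv m v x) / v) (at x)"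
      by (intro DERIV_cdivide DERIV_minus DERIV_add DERIV_mult DERIV_ident d1 d0)
    moreover have "gauss_deriv (Suc m) v = (\<lambda>x. - (x * gauss_deriv m v x + real m * gauss_deriv (m - 1) v x) / v)"
      by (rule ext) (rule gauss_deriv.simps(2))
    moreover have "- (1 * gauss_deriv m v x + gauss_deriv (Suc m) v x * x + real m * gauss_deriv m v x) / v = gauss_deriv (Suc n) v x"
      unfolding Suc gauss_deriv.simps(2)[of "Suc m"] by (simp add: algebra_simps)
    ultimately show ?thesis unfolding Suc by simp
  qed
qed

text \<open>Each step of the recursion costs at most one factor \<open>1 + |x|\<close> and a
  division by \<open>v \<ge> w\<close>. The constant must not depend on \<open>v\<close>, since heat
  times are unbounded.\<close>

lemma gauss_deriv_le_poly:
  assumes w: "w > 0"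
  shows "\<exists>C\<ge>0. \<forall>v\<ge>w. \<forall>x. \<bar>gauss_deriv n v x\<bar> \<le> C * (1 + \<bar>x\<bar>) ^ n * gauss v x"
proof (induction n rule: less_induct)
  case (less n)
  show ?case
  proof (cases n)
    case 0
    then show ?thesis using w by (intro exI[of _ 1]) (auto simp: gauss_nonneg)
  next
    case (Suc m)
    obtain C1 where C1: "C1 \<ge> 0" "\<And>v x. v \<ge> w \<Longrightarrow> \<bar>gauss_deriv m v x\<bar> \<le> C1 * (1 + \<bar>x\<bar>) ^ m * gauss v x"
      using less[of m] Suc by auto
    obtain C0 where C0: "C0 \<ge> 0" "\<And>v x. v \<ge> w \<Longrightarrow> \<bar>gauss_deriv (m - 1) v x\<bar> \<le> C0 * (1 + \<bar>x\<bar>) ^ (m - 1) * gauss v x"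
      using less[of "m - 1"] Suc by (metis less_Suc_eq_le diff_le_self)
    have "\<bar>gauss_deriv n v x\<bar> \<le> (C1 + real m * C0) / w * (1 + \<bar>x\<bar>) ^ n * gauss v x" if v: "v \<ge> w" for v x
    proof -
      define z where "z = 1 + \<bar>x\<bar>"
      have g: "gauss v x \<ge> 0" using v w by (intro gauss_nonneg) simp
      have "\<bar>x * gauss_deriv m v x\<bar> \<le> z * (C1 * z ^ m * gauss v x)"
        unfolding abs_mult using C1(2)[OF v, of x] by (intro mult_mono) (auto simp: z_def)
      moreover have "\<bar>real m * gauss_deriv (m - 1) v x\<bar> \<le> real m * (C0 * z ^ n * gauss v x)"
        unfolding abs_mult
      proof (intro mult_mono)
        have "z ^ (m - 1) \<le> z ^ n" using Suc by (intro power_increasing) (auto simp: z_def)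
        then have "C0 * z ^ (m - 1) * gauss v x \<le> C0 * z ^ n * gauss v x"
          using C0(1) g by (intro mult_right_mono mult_left_mono)
        then show "\<bar>gauss_deriv (m - 1) v x\<bar> \<le> C0 * z ^ n * gauss v x"
          using C0(2)[OF v, of x] by (simp add: z_def)
      qed auto
      ultimately have "\<bar>x * gauss_deriv m v x + real m * gauss_deriv (m - 1) v x\<bar> \<le> z * (C1 * z ^ m * gauss v x) + real m * (C0 * z ^ n * gauss v x)"
        by linarith
      also have "\<dots> = (C1 + real m * C0) * z ^ n * gauss v x"
        unfolding Suc by (simp add: algebra_simps)
      finally have "\<bar>gauss_deriv n v x\<bar> \<le> ((C1 + real m * C0) * z ^ n * gauss v x) / w"
        unfolding Suc gauss_deriv.simps(2) abs_divide abs_minus_cancel using v w by (intro frac_le) auto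
      then show ?thesis by (simp add: z_def)
    qed
    then show ?thesis using C0(1) C1(1) w by (intro exI[of _ "(C1 + real m * C0) / w"]) auto
  qed
qed

text \<open>A single term of the exponential series.\<close>

lemma power_le_fact_exp: "(y::real) \<ge> 0 \<Longrightarrow> y ^ m \<le> fact m * exp y"
proof -
  assume y: "y \<ge> 0"
  have "(\<Sum>n\<in>{m}. y ^ n /\<^sub>R fact n) \<le> exp y"
    unfolding exp_def using y summable_exp_generic[of y] by (intro sum_le_suminf) auto
  then show ?thesis by (simp add: field_simps)
qed

text \<open>With \<open>y = x^2 / (2 * v)\<close> the weight is at most
  \<open>(4 * (1 + v) * (1 + y))^m\<close>, and the exponential absorbs the power of
  \<open>1 + y\<close>. The remaining growth in \<open>v\<close> is later paid for by moments of the
  weight in the heat time.\<close>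

lemma poly_gauss_bound:
  assumes w: "w > 0"
  shows "\<exists>C\<ge>0. \<forall>v\<ge>w. \<forall>x. (1 + \<bar>x\<bar>) ^ m * gauss v x \<le> C * (1 + v) ^ m"
proof -
  have "(1 + \<bar>x\<bar>) ^ m * gauss v x \<le> (4 ^ m * fact m * exp 1 / sqrt w) * (1 + v) ^ m" if v: "v \<ge> w" for v x
  proof -
    define y where "y = x\<^sup>2 / (2 * v)"
    have v0: "v > 0" using v w by simp
    have y0: "y \<ge> 0" unfolding y_def using v0 by simp
    have xy: "x\<^sup>2 = 2 * v * y" using v0 by (simp add: y_def)
    have "0 \<le> (\<bar>x\<bar> - 1)\<^sup>2" by simp
    then have "\<bar>x\<bar> \<le> 1 + x\<^sup>2" by (simp add: power2_diff)
    then have "1 + \<bar>x\<bar> \<le> 2 + 2 * v * y" using xy by simp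
    also have "\<dots> \<le> (4 * (1 + v)) * (1 + y)" using v0 y0 by (simp add: algebra_simps)
    finally have "(1 + \<bar>x\<bar>) ^ m \<le> (4 * (1 + v)) ^ m * (1 + y) ^ m"
      by (subst power_mult_distrib[symmetric]) (intro power_mono, auto)
    also have "\<dots> \<le> (4 * (1 + v)) ^ m * (fact m * exp (1 + y))"
      using power_le_fact_exp[of "1 + y" m] y0 v0 by (intro mult_left_mono) auto
    finally have A: "(1 + \<bar>x\<bar>) ^ m \<le> 4 ^ m * fact m * exp 1 * (1 + v) ^ m * exp y"
      unfolding power_mult_distrib exp_add by (simp only: mult_ac)
    have "sqrt w \<le> sqrt (2 * pi * v)"
    proof (rule real_sqrt_le_mono)
      have "1 * v \<le> (2 * pi) * v" using v0 pi_gt3 by (intro mult_right_mono) auto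
      then show "w \<le> 2 * pi * v" using v by simp
    qed
    then have B: "gauss v x \<le> exp (- y) / sqrt w"
      unfolding gauss_def y_def minus_divide_left using w by (intro frac_le) auto
    have "(1 + \<bar>x\<bar>) ^ m * gauss v x \<le> (4 ^ m * fact m * exp 1 * (1 + v) ^ m * exp y) * (exp (- y) / sqrt w)"
      using A B v0 by (intro mult_mono gauss_nonneg) auto
    also have "\<dots> = (4 ^ m * fact m * exp 1 / sqrt w) * (1 + v) ^ m * (exp y * exp (- y))" by (simp only: times_divide_eq_left times_divide_eq_right mult_ac)
    also have "exp y * exp (- y) = 1" by (simp add: exp_minus)
    finally show ?thesis by simp
  qed
  then show ?thesis using w by (intro exI[of _ "4 ^ m * fact m * exp 1 / sqrt w"]) auto
qed

lemma gauss_deriv_bound: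
  assumes w: "w > 0"
  shows "\<exists>C\<ge>0. \<forall>v\<ge>w. \<forall>x. (1 + \<bar>x\<bar>) ^ m * \<bar>gauss_deriv n v x\<bar> \<le> C * (1 + v) ^ (m + n)"
proof -
  obtain C1 where C1: "C1 \<ge> 0" "\<And>v x. v \<ge> w \<Longrightarrow> \<bar>gauss_deriv n v x\<bar> \<le> C1 * (1 + \<bar>x\<bar>) ^ n * gauss v x"
    using gauss_deriv_le_poly[OF w] by blast
  obtain C2 where C2: "C2 \<ge> 0" "\<And>v x. v \<ge> w \<Longrightarrow> (1 + \<bar>x\<bar>) ^ (m + n) * gauss v x \<le> C2 * (1 + v) ^ (m + n)"
    using poly_gauss_bound[OF w] by blast
  have "(1 + \<bar>x\<bar>) ^ m * \<bar>gauss_deriv n v x\<bar> \<le> (C1 * C2) * (1 + v) ^ (m + n)" if v: "v \<ge> w" for v x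
  proof -
    have "(1 + \<bar>x\<bar>) ^ m * \<bar>gauss_deriv n v x\<bar> \<le> (1 + \<bar>x\<bar>) ^ m * (C1 * (1 + \<bar>x\<bar>) ^ n * gauss v x)"
      using C1(2)[OF v] by (intro mult_left_mono) auto
    also have "\<dots> = C1 * ((1 + \<bar>x\<bar>) ^ (m + n) * gauss v x)" by (simp add: power_add mult_ac)
    also have "\<dots> \<le> C1 * (C2 * (1 + v) ^ (m + n))" using C2(2)[OF v] C1(1) by (intro mult_left_mono)
    finally show ?thesis by (simp add: mult_ac)
  qed
  then show ?thesis using C1(1) C2(1) by (intro exI[of _ "C1 * C2"]) auto
qed

section \<open>Derivatives of product Gaussians and of mixtures\<close>

definition Gauss_deriv :: "'a::euclidean_space list \<Rightarrow> ('a \<Rightarrow> real) \<Rightarrow> 'a \<Rightarrow> real" where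
  "Gauss_deriv bs w x = (\<Prod>b\<in>Basis. gauss_deriv (count_list bs b) (w b) (x \<bullet> b))"

lemma Gauss_deriv_Nil: "Gauss_deriv [] w x = Gauss w x"
  by (simp add: Gauss_deriv_def Gauss_def)

lemma Gauss_deriv_measurable [measurable]:
  fixes g :: "'i \<Rightarrow> 'a::euclidean_space"
  assumes [measurable]: "\<And>b. b \<in> Basis \<Longrightarrow> (\<lambda>i. f i b) \<in> borel_measurable M" "g \<in> borel_measurable M"
  shows "(\<lambda>i. Gauss_deriv bs (f i) (g i)) \<in> borel_measurable M"
  unfolding Gauss_deriv_def by measurable

lemma Gauss_deriv_has_derivative:
  fixes x :: "'a::euclidean_space"
  assumes w: "\<And>b. b \<in> Basis \<Longrightarrow> w b > 0"
  shows "(Gauss_deriv bs w has_derivative (\<lambda>h. \<Sum>b\<in>Basis. (h \<bullet> b) * Gauss_deriv (b # bs) w x)) (at x)"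
proof -
  have "((\<lambda>x. gauss_deriv (count_list bs b) (w b) (x \<bullet> b)) has_derivative
      (\<lambda>h. (h \<bullet> b) * gauss_deriv (Suc (count_list bs b)) (w b) (x \<bullet> b))) (at x)" if "b \<in> Basis" for b
    using has_derivative_compose[OF has_derivative_inner_left[OF has_derivative_ident]
        gauss_deriv_has_derivative[OF w[OF that], of "count_list bs b" "x \<bullet> b", unfolded has_field_derivative_def], of UNIV]
    by (simp add: mult.commute)
  then have "(Gauss_deriv bs w has_derivative (\<lambda>h. \<Sum>b\<in>Basis. ((h \<bullet> b) * gauss_deriv (Suc (count_list bs b)) (w b) (x \<bullet> b)) *
      (\<Prod>c\<in>Basis - {b}. gauss_deriv (count_list bs c) (w c) (x \<bullet> c)))) (at x)"
    unfolding Gauss_deriv_def[abs_def] by (rule has_derivative_prod)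
  also have "(\<lambda>h. \<Sum>b\<in>Basis. ((h \<bullet> b) * gauss_deriv (Suc (count_list bs b)) (w b) (x \<bullet> b)) *
      (\<Prod>c\<in>Basis - {b}. gauss_deriv (count_list bs c) (w c) (x \<bullet> c))) = (\<lambda>h. \<Sum>b\<in>Basis. (h \<bullet> b) * Gauss_deriv (b # bs) w x)"
  proof (intro ext sum.cong refl)
    fix h b :: 'a assume b: "b \<in> Basis"
    have "(\<Prod>c\<in>Basis - {b}. gauss_deriv (count_list bs c) (w c) (x \<bullet> c)) = (\<Prod>c\<in>Basis - {b}. gauss_deriv (count_list (b # bs) c) (w c) (x \<bullet> c))"
      by (intro prod.cong) auto
    then show "((h \<bullet> b) * gauss_deriv (Suc (count_list bs b)) (w b) (x \<bullet> b)) *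
      (\<Prod>c\<in>Basis - {b}. gauss_deriv (count_list bs c) (w c) (x \<bullet> c)) = (h \<bullet> b) * Gauss_deriv (b # bs) w x"
      unfolding Gauss_deriv_def prod.remove[OF finite_Basis b] by (simp del: gauss_deriv.simps)
  qed
  finally show ?thesis .
qed

text \<open>Dominated convergence for the remainder quotients: by the mean value inequality
  increments of \<open>k i\<close> are at most \<open>DIM('a) * B i\<close> times the distance, so
  each quotient is bounded by twice that constant.\<close>

lemma has_derivative_integral_dominated:
  fixes k :: "'i \<Rightarrow> 'a::euclidean_space \<Rightarrow> real"
  assumes k: "\<And>i x. (k i has_derivative (\<lambda>h. \<Sum>b\<in>Basis. (h \<bullet> b) * kd b i x)) (at x)"
    and bound: "\<And>b i x. b \<in> Basis \<Longrightarrow> \<bar>kd b i x\<bar> \<le> B i" and B: "integrable M B"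
    and ki: "\<And>x. integrable M (\<lambda>i. k i x)"
    and meas [measurable]: "\<And>b x. b \<in> Basis \<Longrightarrow> (\<lambda>i. kd b i x) \<in> borel_measurable M"
  shows "((\<lambda>x. LINT i|M. k i x) has_derivative (\<lambda>h. \<Sum>b\<in>Basis. (h \<bullet> b) * (LINT i|M. kd b i x))) (at x)"
  unfolding has_derivative_iff_norm
proof
  show "bounded_linear (\<lambda>h. \<Sum>b\<in>Basis. (h \<bullet> b) * (LINT i|M. kd b i x))"
    by (intro bounded_linear_sum bounded_linear_mult_const bounded_linear_inner_left)
  have Bn: "B i \<ge> 0" for i using bound[of _ i] nonempty_Basis by (meson abs_ge_zero ex_in_conv order_trans)
  have kdi: "integrable M (\<lambda>i. kd b i y)" if "b \<in> Basis" for b y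
  proof (rule Bochner_Integration.integrable_bound[OF B])
    show "AE x in M. norm (kd b x y) \<le> norm (B x)"
      using order_trans[OF bound[OF that] abs_ge_self] by (intro AE_I2) simp
  qed (use that in measurable)
  define D where "D y i h = (\<Sum>b\<in>Basis. (h \<bullet> b) * kd b i y)" for y i and h :: 'a
  have D_le: "\<bar>D y i h\<bar> \<le> DIM('a) * B i * norm h" for y i h
  proof -
    have "\<bar>D y i h\<bar> \<le> (\<Sum>b\<in>Basis. \<bar>h \<bullet> b\<bar> * \<bar>kd b i y\<bar>)"
      unfolding D_def abs_mult[symmetric] by (rule sum_abs)
    also have "\<dots> \<le> (\<Sum>b\<in>(Basis::'a set). norm h * B i)"
      using bound by (intro sum_mono mult_mono Basis_le_norm) auto
    finally show ?thesis by (simp add: mult_ac)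
  qed
  have k_le: "\<bar>k i y - k i x\<bar> \<le> DIM('a) * B i * norm (y - x)" for i y
  proof -
    have "(k i has_derivative D z i) (at z)" for z using k[of i z] unfolding D_def[abs_def] .
    moreover have "onorm (D z i) \<le> DIM('a) * B i" for z
      using D_le[of z i] by (intro onorm_bound) (simp_all add: Bn)
    ultimately show ?thesis
      using differentiable_bound[of UNIV "k i" "\<lambda>x. D x i" "DIM('a) * B i" y x] by simp
  qed
  show "((\<lambda>y. norm ((LINT i|M. k i y) - (LINT i|M. k i x) - (\<Sum>b\<in>Basis. ((y - x) \<bullet> b) * (LINT i|M. kd b i x))) / norm (y - x)) \<longlongrightarrow> 0) (at x)"
    unfolding tendsto_at_iff_sequentially comp_def
  proof (intro allI impI)
    fix X :: "nat \<Rightarrow> 'a" assume X: "\<forall>i. X i \<in> UNIV - {x}" "X \<longlonglongrightarrow> x"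
    define r where "r n i = (k i (X n) - k i x - D x i (X n - x)) / norm (X n - x)" for n i
    have [measurable]: "(\<lambda>i. D x i h) \<in> borel_measurable M" for h unfolding D_def by measurable
    have [measurable]: "(\<lambda>i. k i y) \<in> borel_measurable M" for y using ki by auto
    have "(\<lambda>n. LINT i|M. r n i) \<longlonglongrightarrow> (LINT i|M. 0)"
    proof (rule integral_dominated_convergence)
      show "integrable M (\<lambda>i. 2 * DIM('a) * B i)" using B by auto
      show "AE i in M. (\<lambda>n. r n i) \<longlonglongrightarrow> 0"
      proof (rule AE_I2)
        fix i
        have "((\<lambda>y. norm (k i y - k i x - D x i (y - x)) / norm (y - x)) \<longlongrightarrow> 0) (at x)"
          using k[of i x] unfolding has_derivative_iff_norm D_def by blast
        then have "(\<lambda>n. norm (r n i)) \<longlonglongrightarrow> 0"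
          using X unfolding tendsto_at_iff_sequentially comp_def r_def by simp
        then show "(\<lambda>n. r n i) \<longlonglongrightarrow> 0" by (rule tendsto_norm_zero_cancel)
      qed
      show "AE i in M. norm (r n i) \<le> 2 * DIM('a) * B i" for n
      proof (rule AE_I2)
        fix i
        have "\<bar>k i (X n) - k i x - D x i (X n - x)\<bar> \<le> 2 * DIM('a) * B i * norm (X n - x)"
          using k_le[of i "X n"] D_le[of x i "X n - x"] by linarith
        then show "norm (r n i) \<le> 2 * DIM('a) * B i"
          using X unfolding r_def by (auto simp: divide_le_eq)
      qed
      show "(\<lambda>i. r n i) \<in> borel_measurable M" for n unfolding r_def by measurable
    qed simp
    moreover have "(LINT i|M. r n i) = ((LINT i|M. k i (X n)) - (LINT i|M. k i x) - (\<Sum>b\<in>Basis. ((X n - x) \<bullet> b) * (LINT i|M. kd b i x))) / norm (X n - x)" for n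
      unfolding r_def D_def using ki kdi by (simp add: Bochner_Integration.integral_sum)
    ultimately show "(\<lambda>n. norm ((LINT i|M. k i (X n)) - (LINT i|M. k i x) - (\<Sum>b\<in>Basis. ((X n - x) \<bullet> b) * (LINT i|M. kd b i x))) / norm (X n - x)) \<longlonglongrightarrow> 0"
      using tendsto_norm_zero[of "\<lambda>n. LINT i|M. r n i"] by simp
  qed
qed

text \<open>Iterated partials are identified by exhibiting a family closed under differentiation.
  The head of the list is the derivative taken last, as in \<open>foldr\<close>.\<close>

lemma iter_deriv_family:
  fixes H :: "'a::euclidean_space list \<Rightarrow> 'a \<Rightarrow> 'b::real_normed_vector"
  assumes H: "\<And>bs x. bs \<in> lists Basis \<Longrightarrow> (H bs has_derivative (\<lambda>h. \<Sum>b\<in>Basis. (h \<bullet> b) *\<^sub>R H (b # bs) x)) (at x)"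
  shows "bs \<in> lists Basis \<Longrightarrow> iter_deriv bs (H []) = H bs"
proof (induction bs)
  case Nil
  then show ?case by (simp add: iter_deriv_def)
next
  case (Cons b bs)
  then have b: "b \<in> Basis" "bs \<in> lists Basis" by auto
  have "iter_deriv (b # bs) (H []) x = H (b # bs) x" for x
  proof -
    have "iter_deriv (b # bs) (H []) x = frechet_derivative (H bs) (at x) b"
      using Cons.IH[OF b(2)] by (simp add: iter_deriv_def)
    also have "\<dots> = (\<Sum>c\<in>Basis. (b \<bullet> c) *\<^sub>R H (c # bs) x)"
      using frechet_derivative_at[OF H[OF b(2)], of x] by metis
    also have "\<dots> = (\<Sum>c\<in>Basis. if c = b then H (c # bs) x else 0)"
      using b by (intro sum.cong) (auto simp: inner_Basis)
    finally show ?thesis using b by simp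
  qed
  then show ?case by auto
qed

text \<open>The Schwartz bounds for one Gaussian grow polynomially in its heat time; finite moments
  make them integrable against the weight.\<close>

locale gauss_mix_moments = gauss_mix M \<kappa> \<theta> w
  for M :: "'i measure" and \<kappa> \<theta> :: "'i \<Rightarrow> real" and w :: "'a::euclidean_space \<Rightarrow> real" +
  assumes moments: "\<And>n. integrable M (\<lambda>i. \<kappa> i * (1 + \<theta> i) ^ n)"
begin

definition mix_deriv :: "'a list \<Rightarrow> 'a \<Rightarrow> real" where
  "mix_deriv bs y = (LINT i|M. \<kappa> i * Gauss_deriv bs (heat w (\<theta> i)) y)"

lemma mix_deriv_Nil: "mix_deriv [] = mix M \<kappa> \<theta> w"
  by (simp add: mix_deriv_def mix_def Gauss_deriv_Nil fun_eq_iff)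

lemma Gauss_deriv_weighted_bound:
  fixes \<beta> :: "'a \<Rightarrow> nat"
  shows "\<exists>C\<ge>0. \<exists>N. \<forall>i x. (\<Prod>b\<in>Basis. (1 + \<bar>x \<bullet> b\<bar>) ^ \<beta> b) * \<bar>Gauss_deriv bs (heat w (\<theta> i)) x\<bar> \<le> C * (1 + \<theta> i) ^ N"
proof -
  define n where "n = count_list bs"
  have "\<forall>b\<in>Basis. \<exists>C\<ge>0. \<forall>v\<ge>w b. \<forall>x. (1 + \<bar>x\<bar>) ^ \<beta> b * \<bar>gauss_deriv (n b) v x\<bar> \<le> C * (1 + v) ^ (\<beta> b + n b)"
    using gauss_deriv_bound variance_pos by blast
  then obtain C where C: "\<And>b. b \<in> Basis \<Longrightarrow> C b \<ge> 0"
    "\<And>b v x. b \<in> Basis \<Longrightarrow> v \<ge> w b \<Longrightarrow> (1 + \<bar>x\<bar>) ^ \<beta> b * \<bar>gauss_deriv (n b) v x\<bar> \<le> C b * (1 + v) ^ (\<beta> b + n b)"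
    by metis
  define C' where "C' = (\<Prod>b\<in>Basis. C b * (2 + w b) ^ (\<beta> b + n b))"
  define N where "N = (\<Sum>b\<in>Basis. \<beta> b + n b)"
  have "(\<Prod>b\<in>Basis. (1 + \<bar>x \<bullet> b\<bar>) ^ \<beta> b) * \<bar>Gauss_deriv bs (heat w (\<theta> i)) x\<bar> \<le> C' * (1 + \<theta> i) ^ N" for i x
  proof -
    have "(\<Prod>b\<in>Basis. (1 + \<bar>x \<bullet> b\<bar>) ^ \<beta> b) * \<bar>Gauss_deriv bs (heat w (\<theta> i)) x\<bar>
       = (\<Prod>b\<in>Basis. (1 + \<bar>x \<bullet> b\<bar>) ^ \<beta> b * \<bar>gauss_deriv (n b) (w b + 2 * \<theta> i) (x \<bullet> b)\<bar>)"
      by (simp add: Gauss_deriv_def abs_prod prod.distrib n_def)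
    also have "\<dots> \<le> (\<Prod>b\<in>Basis. (C b * (2 + w b) ^ (\<beta> b + n b)) * (1 + \<theta> i) ^ (\<beta> b + n b))"
    proof (intro prod_mono conjI)
      fix b :: 'a assume b: "b \<in> Basis"
      show "0 \<le> (1 + \<bar>x \<bullet> b\<bar>) ^ \<beta> b * \<bar>gauss_deriv (n b) (w b + 2 * \<theta> i) (x \<bullet> b)\<bar>" by simp
      have "(1 + \<bar>x \<bullet> b\<bar>) ^ \<beta> b * \<bar>gauss_deriv (n b) (w b + 2 * \<theta> i) (x \<bullet> b)\<bar> \<le> C b * (1 + (w b + 2 * \<theta> i)) ^ (\<beta> b + n b)"
        using time_nonneg by (intro C b) simp
      \<comment> \<open>Separates the heat time from the fixed variance, so that a constant times a
        power of \<open>1 + \<theta> i\<close> remains.\<close>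
      also have "\<dots> \<le> C b * ((2 + w b) * (1 + \<theta> i)) ^ (\<beta> b + n b)"
        using C(1)[OF b] time_nonneg[of i] variance_pos[OF b]
        by (intro mult_left_mono power_mono) (auto simp: algebra_simps)
      finally show "(1 + \<bar>x \<bullet> b\<bar>) ^ \<beta> b * \<bar>gauss_deriv (n b) (w b + 2 * \<theta> i) (x \<bullet> b)\<bar> \<le> (C b * (2 + w b) ^ (\<beta> b + n b)) * (1 + \<theta> i) ^ (\<beta> b + n b)"
        by (simp only: power_mult_distrib mult.assoc)
    qed
    also have "\<dots> = C' * (1 + \<theta> i) ^ N"
      by (simp only: prod.distrib C'_def N_def power_sum)
    finally show ?thesis .
  qed
  moreover have "C' \<ge> 0" unfolding C'_def using C(1) variance_pos
    by (intro prod_nonneg ballI mult_nonneg_nonneg zero_le_power) (auto simp: less_imp_le add_nonneg_nonneg)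
  ultimately show ?thesis by blast
qed

lemma integrable_Gauss_deriv: "integrable M (\<lambda>i. \<kappa> i * Gauss_deriv bs (heat w (\<theta> i)) x)"
proof -
  obtain C N where C: "\<And>i x. \<bar>Gauss_deriv bs (heat w (\<theta> i)) x\<bar> \<le> C * (1 + \<theta> i) ^ N"
    using Gauss_deriv_weighted_bound[of "\<lambda>_. 0" bs] by auto
  show ?thesis
  proof (rule Bochner_Integration.integrable_bound)
    show "integrable M (\<lambda>i. C * (\<kappa> i * (1 + \<theta> i) ^ N))" using moments[of N] by simp
    show "AE i in M. norm (\<kappa> i * Gauss_deriv bs (heat w (\<theta> i)) x) \<le> norm (C * (\<kappa> i * (1 + \<theta> i) ^ N))"
    proof (rule AE_I2)
      fix i
      have "\<bar>\<kappa> i\<bar> * \<bar>Gauss_deriv bs (heat w (\<theta> i)) x\<bar> \<le> \<bar>\<kappa> i\<bar> * \<bar>C * (1 + \<theta> i) ^ N\<bar>"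
        using C[of i x] by (intro mult_left_mono) auto
      then show "norm (\<kappa> i * Gauss_deriv bs (heat w (\<theta> i)) x) \<le> norm (C * (\<kappa> i * (1 + \<theta> i) ^ N))"
        by (simp add: abs_mult mult_ac)
    qed
  qed measurable
qed

lemma mix_deriv_has_derivative:
  "(mix_deriv bs has_derivative (\<lambda>h. \<Sum>b\<in>Basis. (h \<bullet> b) * mix_deriv (b # bs) x)) (at x)"
proof -
  have "\<forall>b::'a. \<exists>C\<ge>0. \<exists>N. \<forall>i x. \<bar>Gauss_deriv (b # bs) (heat w (\<theta> i)) x\<bar> \<le> C * (1 + \<theta> i) ^ N"
    using Gauss_deriv_weighted_bound[of "\<lambda>_. 0" "_ # bs"] by auto
  then obtain C N where C: "\<And>b. C b \<ge> 0" "\<And>b i x. \<bar>Gauss_deriv (b # bs) (heat w (\<theta> i)) x\<bar> \<le> C b * (1 + \<theta> i) ^ N b"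
    by metis
  define B where "B i = (\<Sum>b\<in>Basis. C b * \<bar>\<kappa> i * (1 + \<theta> i) ^ N b\<bar>)" for i
  show ?thesis
    unfolding mix_deriv_def
  proof (rule has_derivative_integral_dominated[where B = B])
    fix i x
    have "((\<lambda>x. \<kappa> i * Gauss_deriv bs (heat w (\<theta> i)) x) has_derivative
      (\<lambda>h. \<kappa> i * (\<Sum>b\<in>Basis. (h \<bullet> b) * Gauss_deriv (b # bs) (heat w (\<theta> i)) x))) (at x)"
      by (intro has_derivative_mult_right Gauss_deriv_has_derivative shifted_pos)
    then show "((\<lambda>x. \<kappa> i * Gauss_deriv bs (heat w (\<theta> i)) x) has_derivative
      (\<lambda>h. \<Sum>b\<in>Basis. (h \<bullet> b) * (\<kappa> i * Gauss_deriv (b # bs) (heat w (\<theta> i)) x))) (at x)"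
      by (simp add: sum_distrib_left mult.left_commute)
  next
    fix b x :: 'a and i assume b: "b \<in> Basis"
    have "\<bar>\<kappa> i * Gauss_deriv (b # bs) (heat w (\<theta> i)) x\<bar> \<le> \<bar>\<kappa> i\<bar> * (C b * (1 + \<theta> i) ^ N b)"
      unfolding abs_mult using C(2)[of b i x] by (intro mult_left_mono) auto
    also have "\<dots> = C b * \<bar>\<kappa> i * (1 + \<theta> i) ^ N b\<bar>"
      using time_nonneg[of i] by (simp add: abs_mult mult_ac)
    also have "\<dots> \<le> B i"
      unfolding B_def using b C(1) by (intro member_le_sum) auto
    finally show "\<bar>\<kappa> i * Gauss_deriv (b # bs) (heat w (\<theta> i)) x\<bar> \<le> B i" .
  next
    show "integrable M B" unfolding B_def using moments by auto
  qed (auto intro: integrable_Gauss_deriv)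
qed

lemma mix_deriv_bound:
  fixes \<beta> :: "'a \<Rightarrow> nat"
  shows "\<exists>C. \<forall>x. (\<Prod>b\<in>Basis. (1 + \<bar>x \<bullet> b\<bar>) ^ \<beta> b) * \<bar>mix_deriv bs x\<bar> \<le> C"
proof -
  obtain C N where C: "C \<ge> 0" "\<And>i x. (\<Prod>b\<in>Basis. (1 + \<bar>x \<bullet> b\<bar>) ^ \<beta> b) * \<bar>Gauss_deriv bs (heat w (\<theta> i)) x\<bar> \<le> C * (1 + \<theta> i) ^ N"
    using Gauss_deriv_weighted_bound[of \<beta> bs] by auto
  have "(\<Prod>b\<in>Basis. (1 + \<bar>x \<bullet> b\<bar>) ^ \<beta> b) * \<bar>mix_deriv bs x\<bar> \<le> (LINT i|M. C * \<bar>\<kappa> i * (1 + \<theta> i) ^ N\<bar>)" for x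
  proof -
    define P where "P = (\<Prod>b\<in>Basis. (1 + \<bar>x \<bullet> b\<bar>) ^ \<beta> b)"
    have P: "P \<ge> 0" unfolding P_def by (intro prod_nonneg) auto
    have "P * \<bar>mix_deriv bs x\<bar> \<le> P * (LINT i|M. \<bar>\<kappa> i * Gauss_deriv bs (heat w (\<theta> i)) x\<bar>)"
      unfolding mix_deriv_def using P by (intro mult_left_mono integral_abs_bound)
    also have "\<dots> = (LINT i|M. P * \<bar>\<kappa> i * Gauss_deriv bs (heat w (\<theta> i)) x\<bar>)" by simp
    also have "\<dots> \<le> (LINT i|M. C * \<bar>\<kappa> i * (1 + \<theta> i) ^ N\<bar>)"
    proof (rule integral_mono)
      show "integrable M (\<lambda>i. P * \<bar>\<kappa> i * Gauss_deriv bs (heat w (\<theta> i)) x\<bar>)"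
        using integrable_Gauss_deriv by auto
      show "integrable M (\<lambda>i. C * \<bar>\<kappa> i * (1 + \<theta> i) ^ N\<bar>)" using moments by auto
      fix i
      have "\<bar>\<kappa> i\<bar> * (P * \<bar>Gauss_deriv bs (heat w (\<theta> i)) x\<bar>) \<le> \<bar>\<kappa> i\<bar> * (C * (1 + \<theta> i) ^ N)"
        using C(2)[of x i] unfolding P_def by (intro mult_left_mono) auto
      then show "P * \<bar>\<kappa> i * Gauss_deriv bs (heat w (\<theta> i)) x\<bar> \<le> C * \<bar>\<kappa> i * (1 + \<theta> i) ^ N\<bar>"
        using time_nonneg[of i] by (simp add: abs_mult mult_ac)
    qed
    finally show ?thesis unfolding P_def .
  qed
  then show ?thesis by blast
qed

lemma schwartz_sum_mix:
  "schwartz (packet M \<kappa> \<theta> w J Y)"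
proof -
  define H where "H bs y = complex_of_real (\<Sum>j\<in>J. mix_deriv bs (y - Y j))" for bs y
  have der: "(H bs has_derivative (\<lambda>h. \<Sum>b\<in>Basis. (h \<bullet> b) *\<^sub>R H (b # bs) x)) (at x)" for bs x
  proof -
    have "((\<lambda>y. mix_deriv bs (y - c)) has_derivative (\<lambda>h. \<Sum>b\<in>Basis. (h \<bullet> b) * mix_deriv (b # bs) (x - c))) (at x)" for c
    proof -
      have "((\<lambda>y. y - c) has_derivative (\<lambda>h. h)) (at x)" by (auto intro!: derivative_eq_intros)
      from has_derivative_compose[OF this mix_deriv_has_derivative] show ?thesis by simp
    qed
    then have "(H bs has_derivative (\<lambda>h. complex_of_real (\<Sum>j\<in>J. \<Sum>b\<in>Basis. (h \<bullet> b) * mix_deriv (b # bs) (x - Y j)))) (at x)"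
      unfolding H_def by (intro has_derivative_of_real has_derivative_sum)
    also have "(\<lambda>h. complex_of_real (\<Sum>j\<in>J. \<Sum>b\<in>Basis. (h \<bullet> b) * mix_deriv (b # bs) (x - Y j))) = (\<lambda>h. \<Sum>b\<in>Basis. (h \<bullet> b) *\<^sub>R H (b # bs) x)"
      unfolding H_def by (subst sum.swap) (simp add: scaleR_conv_of_real sum_distrib_left)
    finally show ?thesis .
  qed
  have it: "iter_deriv bs (H []) = H bs" if "bs \<in> lists Basis" for bs
    by (rule iter_deriv_family[OF der that])
  have "bounded (range (\<lambda>x. (\<Prod>b\<in>Basis. (x \<bullet> b) ^ \<beta> b) *\<^sub>R H bs x))" for bs and \<beta> :: "'a \<Rightarrow> nat"
  proof -
    obtain C where C: "\<And>x. (\<Prod>b\<in>Basis. (1 + \<bar>x \<bullet> b\<bar>) ^ \<beta> b) * \<bar>mix_deriv bs x\<bar> \<le> C"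
      using mix_deriv_bound by blast
    have "norm ((\<Prod>b\<in>Basis. (x \<bullet> b) ^ \<beta> b) *\<^sub>R H bs x) \<le> (\<Sum>j\<in>J. (\<Prod>b\<in>Basis. (1 + \<bar>Y j \<bullet> b\<bar>) ^ \<beta> b) * C)" for x
    proof -
      have "norm ((\<Prod>b\<in>Basis. (x \<bullet> b) ^ \<beta> b) *\<^sub>R H bs x) = (\<Prod>b\<in>Basis. \<bar>x \<bullet> b\<bar> ^ \<beta> b) * \<bar>\<Sum>j\<in>J. mix_deriv bs (x - Y j)\<bar>"
        unfolding H_def norm_scaleR norm_of_real by (simp add: abs_prod power_abs)
      also have "\<dots> \<le> (\<Prod>b\<in>Basis. \<bar>x \<bullet> b\<bar> ^ \<beta> b) * (\<Sum>j\<in>J. \<bar>mix_deriv bs (x - Y j)\<bar>)"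
        by (intro mult_left_mono sum_abs prod_nonneg) auto
      also have "\<dots> = (\<Sum>j\<in>J. (\<Prod>b\<in>Basis. \<bar>x \<bullet> b\<bar> ^ \<beta> b) * \<bar>mix_deriv bs (x - Y j)\<bar>)"
        by (rule sum_distrib_left)
      also have "\<dots> \<le> (\<Sum>j\<in>J. (\<Prod>b\<in>Basis. (1 + \<bar>Y j \<bullet> b\<bar>) ^ \<beta> b) * C)"
      proof (rule sum_mono)
        fix j
        \<comment> \<open>The weight at \<open>x\<close> is transferred to the translated argument
          at the cost of a factor depending only on the centre.\<close>
        have "(\<Prod>b\<in>Basis. \<bar>x \<bullet> b\<bar> ^ \<beta> b) \<le> (\<Prod>b\<in>Basis. (1 + \<bar>Y j \<bullet> b\<bar>) ^ \<beta> b * (1 + \<bar>(x - Y j) \<bullet> b\<bar>) ^ \<beta> b)"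
        proof (intro prod_mono conjI)
          fix b :: 'a
          have "\<bar>x \<bullet> b\<bar> \<le> \<bar>Y j \<bullet> b\<bar> + \<bar>(x - Y j) \<bullet> b\<bar>" by (simp add: inner_diff_left)
          also have "\<dots> \<le> (1 + \<bar>Y j \<bullet> b\<bar>) * (1 + \<bar>(x - Y j) \<bullet> b\<bar>)" by (simp add: algebra_simps)
          finally show "\<bar>x \<bullet> b\<bar> ^ \<beta> b \<le> (1 + \<bar>Y j \<bullet> b\<bar>) ^ \<beta> b * (1 + \<bar>(x - Y j) \<bullet> b\<bar>) ^ \<beta> b"
            unfolding power_mult_distrib[symmetric] by (intro power_mono) auto
        qed simp
        then have "(\<Prod>b\<in>Basis. \<bar>x \<bullet> b\<bar> ^ \<beta> b) * \<bar>mix_deriv bs (x - Y j)\<bar> \<le>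
           (\<Prod>b\<in>Basis. (1 + \<bar>Y j \<bullet> b\<bar>) ^ \<beta> b * (1 + \<bar>(x - Y j) \<bullet> b\<bar>) ^ \<beta> b) * \<bar>mix_deriv bs (x - Y j)\<bar>"
          by (intro mult_right_mono) auto
        also have "\<dots> = (\<Prod>b\<in>Basis. (1 + \<bar>Y j \<bullet> b\<bar>) ^ \<beta> b) * ((\<Prod>b\<in>Basis. (1 + \<bar>(x - Y j) \<bullet> b\<bar>) ^ \<beta> b) * \<bar>mix_deriv bs (x - Y j)\<bar>)"
          by (simp only: prod.distrib mult.assoc)
        also have "\<dots> \<le> (\<Prod>b\<in>Basis. (1 + \<bar>Y j \<bullet> b\<bar>) ^ \<beta> b) * C"
          by (intro mult_left_mono C prod_nonneg) auto
        finally show "(\<Prod>b\<in>Basis. \<bar>x \<bullet> b\<bar> ^ \<beta> b) * \<bar>mix_deriv bs (x - Y j)\<bar> \<le> (\<Prod>b\<in>Basis. (1 + \<bar>Y j \<bullet> b\<bar>) ^ \<beta> b) * C" .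
      qed
      finally show ?thesis .
    qed
    then show ?thesis unfolding bounded_iff by blast
  qed
  then have "schwartz (H [])"
    unfolding schwartz_def smooth_def using der by (auto simp: it differentiable_def intro!: exI)
  then show ?thesis unfolding H_def mix_deriv_Nil .
qed

end

subsection \<open>Bessel potentials as superpositions of heat flows\<close>

text \<open>With Laplace transform \<open>q powr (- a)\<close>, this weight in the heat time
  represents a negative power; the extra damping \<open>exp (- t)\<close> replaces \<open>q\<close>
  by \<open>1 + q\<close>, as in a Bessel potential.\<close>

definition gamma_kernel :: "real \<Rightarrow> real \<Rightarrow> real" where
  "gamma_kernel a t = (if t > 0 then t powr (a - 1) / Gamma a else 0)"

lemma gamma_kernel_measurable [measurable]: "gamma_kernel a \<in> borel_measurable borel"
  unfolding gamma_kernel_def[abs_def] by measurable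

lemma gamma_kernel_nonneg: "a > 0 \<Longrightarrow> gamma_kernel a t \<ge> 0"
  by (simp add: gamma_kernel_def Gamma_real_pos less_imp_le)

lemma has_bochner_integral_lborel_nonneg:
  fixes f :: "real \<Rightarrow> real"
  assumes "(f has_integral I) \<Omega>" "\<And>x. x \<in> \<Omega> \<Longrightarrow> f x \<ge> 0" "I \<ge> 0"
    and "(\<lambda>x. indicator \<Omega> x * f x) \<in> borel_measurable borel"
  shows "has_bochner_integral lborel (\<lambda>x. indicator \<Omega> x * f x) I"
  using assms nn_integral_has_integral_lebesgue[OF assms(2,1)]
  by (intro has_bochner_integral_nn_integral) (auto simp: indicator_def)

text \<open>Euler's integral for \<open>Gamma\<close> after rescaling time by
  \<open>q\<close>.\<close>

lemma gamma_kernel_laplace: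
  assumes a: "a > 0" and q: "q > 0"
  shows "has_bochner_integral lborel (\<lambda>t. gamma_kernel a t * exp (- (q * t))) (q powr (- a))"
proof -
  have G: "Gamma a > 0" using a by (rule Gamma_real_pos)
  have "has_bochner_integral lborel (\<lambda>t. indicator {0..} t * (t powr (a - 1) / exp t)) (Gamma a)"
    using G by (intro has_bochner_integral_lborel_nonneg Gamma_integral_real[OF a]) auto
  then have "has_bochner_integral lborel (\<lambda>t. 1 / Gamma a * (indicator {0..} t * (t powr (a - 1) / exp t))) (1 / Gamma a * Gamma a)"
    by (intro has_bochner_integral_mult_right) auto
  also have "(\<lambda>t. 1 / Gamma a * (indicator {0..} t * (t powr (a - 1) / exp t))) = (\<lambda>t. gamma_kernel a t * exp (- t))"
    by (auto simp: gamma_kernel_def fun_eq_iff exp_minus field_simps indicator_def)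
  finally have "has_bochner_integral lborel (\<lambda>t. gamma_kernel a t * exp (- t)) 1" using G by simp
  then have "has_bochner_integral lborel (\<lambda>t. gamma_kernel a (0 + q * t) * exp (- (0 + q * t))) (1 /\<^sub>R \<bar>q\<bar>)"
    using q by (subst (asm) lborel_has_bochner_integral_real_affine_iff[of q _ _ 0]) auto
  then have "has_bochner_integral lborel (\<lambda>t. q powr (1 - a) * (gamma_kernel a (0 + q * t) * exp (- (0 + q * t)))) (q powr (1 - a) * (1 /\<^sub>R \<bar>q\<bar>))"
    by (intro has_bochner_integral_mult_right) auto
  also have "(\<lambda>t. q powr (1 - a) * (gamma_kernel a (0 + q * t) * exp (- (0 + q * t)))) = (\<lambda>t. gamma_kernel a t * exp (- (q * t)))"
  proof (rule ext)
    fix t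
    have "q powr (1 - a) * (q * t) powr (a - 1) = t powr (a - 1)" if "t > 0"
      using q that by (simp add: powr_mult powr_add[symmetric] mult.assoc[symmetric])
    then show "q powr (1 - a) * (gamma_kernel a (0 + q * t) * exp (- (0 + q * t))) = gamma_kernel a t * exp (- (q * t))"
      using q by (auto simp: gamma_kernel_def zero_less_mult_iff)
  qed
  also have "q powr (1 - a) * (1 /\<^sub>R \<bar>q\<bar>) = q powr (- a)"
    using q by (simp add: powr_diff powr_minus field_simps)
  finally show ?thesis .
qed

text \<open>The weight of short heat times. It is applied with \<open>T = 1 / N^2\<close> to bound
  potentials from below and with \<open>T = \<tau>\<close> to bound a difference of kernels.\<close>

lemma gamma_kernel_initial:
  assumes a: "a > 0" and T: "T \<ge> 0"
  shows "has_bochner_integral lborel (\<lambda>t. indicator {0..T} t * gamma_kernel a t) (T powr a / (a * Gamma a))"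
proof -
  have G: "Gamma a > 0" using a by (rule Gamma_real_pos)
  have "has_bochner_integral lborel (\<lambda>t. indicator {0..T} t * t powr (a - 1)) (T powr (a - 1 + 1) / (a - 1 + 1))"
    using a T by (intro has_bochner_integral_lborel_nonneg has_integral_powr_from_0) auto
  then have "has_bochner_integral lborel (\<lambda>t. 1 / Gamma a * (indicator {0..T} t * t powr (a - 1))) (1 / Gamma a * (T powr (a - 1 + 1) / (a - 1 + 1)))"
    by (intro has_bochner_integral_mult_right) auto
  also have "(\<lambda>t. 1 / Gamma a * (indicator {0..T} t * t powr (a - 1))) = (\<lambda>t. indicator {0..T} t * gamma_kernel a t)"
    by (auto simp: gamma_kernel_def fun_eq_iff indicator_def)
  finally show ?thesis by (simp add: mult.commute)
qed

lemma sigma_finite_lborel_real: "sigma_finite_measure (lborel :: real measure)" ..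

text \<open>Taking \<open>max 0 t\<close> as time meets the nonnegativity condition on the whole
  line, while the kernel vanishes for \<open>t \<le> 0\<close>. Half of the decay of
  \<open>exp (- t)\<close> absorbs every power of \<open>1 + t\<close>.\<close>

lemma gauss_mix_moments_gamma:
  fixes w :: "'a::euclidean_space \<Rightarrow> real"
  assumes a: "a > 0" and w: "\<And>b. b \<in> Basis \<Longrightarrow> w b > 0"
  shows "gauss_mix_moments lborel (\<lambda>t. gamma_kernel a t * exp (- t)) (\<lambda>t. max 0 t) w"
proof (intro gauss_mix_moments.intro gauss_mix.intro gauss_mix_axioms.intro gauss_mix_moments_axioms.intro sigma_finite_lborel_real)
  show "integrable lborel (\<lambda>t. gamma_kernel a t * exp (- t))"
    using gamma_kernel_laplace[OF a, of 1] by (auto simp: has_bochner_integral_iff)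
  fix n
  show "integrable lborel (\<lambda>t. gamma_kernel a t * exp (- t) * (1 + max 0 t) ^ n)"
  proof (rule Bochner_Integration.integrable_bound)
    have "integrable lborel (\<lambda>t. gamma_kernel a t * exp (- (1/2 * t)))"
      using gamma_kernel_laplace[OF a, of "1/2"] by (auto simp: has_bochner_integral_iff)
    then show "integrable lborel (\<lambda>t. (2 ^ n * fact n * exp (1/2)) * (gamma_kernel a t * exp (- (1/2 * t))))"
      by auto
    show "AE t in lborel. norm (gamma_kernel a t * exp (- t) * (1 + max 0 t) ^ n) \<le> norm ((2 ^ n * fact n * exp (1/2)) * (gamma_kernel a t * exp (- (1/2 * t))))"
    proof (rule AE_I2)
      fix t :: real
      show "norm (gamma_kernel a t * exp (- t) * (1 + max 0 t) ^ n) \<le> norm ((2 ^ n * fact n * exp (1/2)) * (gamma_kernel a t * exp (- (1/2 * t))))"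
      proof (cases "t > 0")
        case True
        have "(1 + t) ^ n = 2 ^ n * ((1 + t) / 2) ^ n" by (simp add: power_divide)
        also have "\<dots> \<le> 2 ^ n * (fact n * exp ((1 + t) / 2))"
          using True by (intro mult_left_mono power_le_fact_exp) auto
        finally have "exp (- t) * (1 + t) ^ n \<le> exp (- t) * (2 ^ n * (fact n * exp ((1 + t) / 2)))"
          by (intro mult_left_mono) auto
        also have "\<dots> = (2 ^ n * fact n) * (exp (- t) * exp ((1 + t) / 2))" by simp
        also have "exp (- t) * exp ((1 + t) / 2) = exp (1/2) * exp (- (1/2 * t))"
          unfolding exp_add[symmetric] by (simp add: field_simps)
        finally have "gamma_kernel a t * (exp (- t) * (1 + t) ^ n) \<le> gamma_kernel a t * (2 ^ n * fact n * (exp (1/2) * exp (- (1/2 * t))))"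
          using gamma_kernel_nonneg[OF a] by (intro mult_left_mono)
        then show ?thesis using True gamma_kernel_nonneg[OF a, of t] by (simp add: abs_mult mult_ac)
      qed (simp add: gamma_kernel_def)
    qed
  qed measurable
qed (use w in auto)

lemma gamma_symbol:
  assumes a: "a > 0" and q: "q \<ge> 0"
  shows "(LINT t|lborel. gamma_kernel a t * exp (- t) * exp (- (max 0 t * q))) = (1 + q) powr (- a)"
proof -
  have "(\<lambda>t. gamma_kernel a t * exp (- t) * exp (- (max 0 t * q))) = (\<lambda>t. gamma_kernel a t * exp (- ((1 + q) * t)))"
    by (auto simp: fun_eq_iff gamma_kernel_def exp_add[symmetric] algebra_simps max_def)
  then show ?thesis using gamma_kernel_laplace[OF a, of "1 + q"] q by (simp add: has_bochner_integral_iff)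
qed

text \<open>The Gaussian without heat flow, as a mixture over one index.\<close>

lemma gauss_mix_moments_unit:
  fixes w :: "'a::euclidean_space \<Rightarrow> real"
  assumes w: "\<And>b. b \<in> Basis \<Longrightarrow> w b > 0"
  shows "gauss_mix_moments (count_space (UNIV :: unit set)) (\<lambda>_. 1) (\<lambda>_. 0) w"
  by (intro gauss_mix_moments.intro gauss_mix.intro gauss_mix_axioms.intro gauss_mix_moments_axioms.intro
    sigma_finite_measure_count_space_finite) (use w in \<open>auto intro: integrable_count_space\<close>)

lemma mix_unit: "mix (count_space (UNIV :: unit set)) (\<lambda>_. 1) (\<lambda>_. 0) w y = Gauss w y"
  by (simp add: mix_def lebesgue_integral_count_space_finite UNIV_unit)

text \<open>The Gaussian minus its damped heat flow at time \<open>\<tau>\<close>, as a signed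
  mixture over two indices; its multiplier is \<open>1 - exp (- \<tau> * (1 + q))\<close>.\<close>

lemma gauss_mix_moments_bool:
  fixes w :: "'a::euclidean_space \<Rightarrow> real"
  assumes w: "\<And>b. b \<in> Basis \<Longrightarrow> w b > 0" and \<tau>: "\<tau> \<ge> 0"
  shows "gauss_mix_moments (count_space (UNIV :: bool set)) (\<lambda>b. if b then - exp (- \<tau>) else 1) (\<lambda>b. if b then \<tau> else 0) w"
  by (intro gauss_mix_moments.intro gauss_mix.intro gauss_mix_axioms.intro gauss_mix_moments_axioms.intro
    sigma_finite_measure_count_space_finite) (use w \<tau> in \<open>auto intro: integrable_count_space\<close>)

lemma mix_bool:
  "mix (count_space (UNIV :: bool set)) (\<lambda>b. if b then - exp (- \<tau>) else 1) (\<lambda>b. if b then \<tau> else 0) w y =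
    Gauss w y - exp (- \<tau>) * Gauss (heat w \<tau>) y"
  by (simp add: mix_def lebesgue_integral_count_space_finite UNIV_bool)

text \<open>
  Weight that represents the multiplier \<open>(1 - \<Delta>)\<close> to the power \<open>-b\<close> times \<open>1 - exp (- \<tau> (1 - \<Delta>))\<close>
  as a superposition of heat flows.
\<close>

abbreviation gamma_diff :: "real \<Rightarrow> real \<Rightarrow> real \<Rightarrow> real" where
  "gamma_diff b \<tau> t \<equiv> exp (- t) * (gamma_kernel b t - gamma_kernel b (t - \<tau>))"

text \<open>Delaying the kernel by \<open>\<tau>\<close> multiplies the transform at
  \<open>1 + q\<close> by \<open>exp (- \<tau> * (1 + q))\<close>. For \<open>t \<le> 0\<close> both
  kernels vanish, so the time can be truncated to \<open>max 0 t\<close>.\<close>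

lemma gamma_difference_laplace:
  assumes b: "b > 0" and \<tau>: "\<tau> > 0" and q: "q \<ge> 0"
  shows "has_bochner_integral lborel (\<lambda>t. gamma_diff b \<tau> t * exp (- (max 0 t * q)))
    ((1 + q) powr (- b) * (1 - exp (- (\<tau> * (1 + q)))))"
proof -
  have L: "has_bochner_integral lborel (\<lambda>t. gamma_kernel b t * exp (- ((1 + q) * t))) ((1 + q) powr (- b))"
    using b q by (intro gamma_kernel_laplace) auto
  have "has_bochner_integral lborel (\<lambda>t. gamma_kernel b (- \<tau> + 1 * t) * exp (- ((1 + q) * (- \<tau> + 1 * t)))) ((1 + q) powr (- b) /\<^sub>R \<bar>1\<bar>)"
    using L by (subst lborel_has_bochner_integral_real_affine_iff[of 1 _ _ "- \<tau>", symmetric]) auto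
  then have "has_bochner_integral lborel (\<lambda>t. exp (- (\<tau> * (1 + q))) * (gamma_kernel b (- \<tau> + 1 * t) * exp (- ((1 + q) * (- \<tau> + 1 * t)))))
     (exp (- (\<tau> * (1 + q))) * ((1 + q) powr (- b) /\<^sub>R \<bar>1\<bar>))"
    by (intro has_bochner_integral_mult_right) auto
  from has_bochner_integral_diff[OF L this]
  have "has_bochner_integral lborel (\<lambda>t. gamma_kernel b t * exp (- ((1 + q) * t)) - exp (- (\<tau> * (1 + q))) * (gamma_kernel b (- \<tau> + 1 * t) * exp (- ((1 + q) * (- \<tau> + 1 * t)))))
     ((1 + q) powr (- b) - exp (- (\<tau> * (1 + q))) * ((1 + q) powr (- b) /\<^sub>R \<bar>1\<bar>))" .
  also have "(\<lambda>t. gamma_kernel b t * exp (- ((1 + q) * t)) - exp (- (\<tau> * (1 + q))) * (gamma_kernel b (- \<tau> + 1 * t) * exp (- ((1 + q) * (- \<tau> + 1 * t)))))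
    = (\<lambda>t. gamma_diff b \<tau> t * exp (- (max 0 t * q)))"
  proof (rule ext)
    fix t
    have e: "exp (- (\<tau> * (1 + q))) * exp (- ((1 + q) * (t - \<tau>))) = exp (- ((1 + q) * t))"
      unfolding exp_add[symmetric] by (simp add: algebra_simps)
    have "gamma_kernel b t * exp (- ((1 + q) * t)) - exp (- (\<tau> * (1 + q))) * (gamma_kernel b (- \<tau> + 1 * t) * exp (- ((1 + q) * (- \<tau> + 1 * t))))
       = (gamma_kernel b t - gamma_kernel b (t - \<tau>)) * exp (- ((1 + q) * t))"
      using e by (simp add: mult.left_commute[of "exp (- (\<tau> * (1 + q)))"] left_diff_distrib)
    also have "\<dots> = gamma_diff b \<tau> t * exp (- (max 0 t * q))"
    proof (cases "t > 0")
      case True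
      have "exp (- ((1 + q) * t)) = exp (- t) * exp (- (t * q))"
        unfolding exp_add[symmetric] by (simp add: algebra_simps)
      then show ?thesis using True by simp
    qed (use \<tau> in \<open>simp add: gamma_kernel_def\<close>)
    finally show "gamma_kernel b t * exp (- ((1 + q) * t)) - exp (- (\<tau> * (1 + q))) * (gamma_kernel b (- \<tau> + 1 * t) * exp (- ((1 + q) * (- \<tau> + 1 * t))))
       = gamma_diff b \<tau> t * exp (- (max 0 t * q))" .
  qed
  finally show ?thesis by (simp add: algebra_simps)
qed

lemma gauss_mix_gamma_difference:
  fixes w :: "'a::euclidean_space \<Rightarrow> real"
  assumes b: "b > 0" and \<tau>: "\<tau> > 0" and w: "\<And>b. b \<in> Basis \<Longrightarrow> w b > 0"
  shows "gauss_mix lborel (\<lambda>t. gamma_diff b \<tau> t) (\<lambda>t. max 0 t) w"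
  by (intro gauss_mix.intro gauss_mix_axioms.intro sigma_finite_lborel_real)
    (use w gamma_difference_laplace[OF b \<tau>, of 0] in \<open>auto simp: has_bochner_integral_iff\<close>)

text \<open>This is the gain from the cancellation. Its saturation at the first power of
  \<open>\<tau>\<close> is the origin of the truncation of \<open>\<sigma>\<close> at -2, because it
  is applied with \<open>b = - \<sigma> / 2\<close> and \<open>\<tau>\<close> of order
  \<open>1 / N^2\<close>.\<close>

lemma gamma_difference_L1:
  assumes b: "b > 0"
  shows "\<exists>C>0. \<forall>\<tau>. 0 < \<tau> \<longrightarrow> \<tau> \<le> 1 \<longrightarrow>
    (LINT t|lborel. \<bar>gamma_diff b \<tau> t\<bar>) \<le> C * \<tau> powr (min b 1)"
proof -
  have one_minus: "1 - exp (- \<tau>) \<le> \<tau>" for \<tau> :: real using exp_ge_add_one_self[of "- \<tau>"] by simp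
  show ?thesis
  proof (cases "b \<ge> 1")
    case True
    \<comment> \<open>The kernel is increasing, so the weight is nonnegative.\<close>
    have "(LINT t|lborel. \<bar>gamma_diff b \<tau> t\<bar>) \<le> \<tau>" if \<tau>: "0 < \<tau>" for \<tau>
    proof -
      have "gamma_kernel b (t - \<tau>) \<le> gamma_kernel b t" for t
        using True \<tau> Gamma_real_pos[OF b] by (auto simp: gamma_kernel_def intro!: divide_right_mono powr_mono2)
      then have "(LINT t|lborel. \<bar>gamma_diff b \<tau> t\<bar>) = (LINT t|lborel. gamma_diff b \<tau> t)"
        by (intro Bochner_Integration.integral_cong) (auto simp: abs_mult)
      also have "\<dots> = 1 - exp (- \<tau>)"
        using gamma_difference_laplace[OF b \<tau>, of 0] by (simp add: has_bochner_integral_iff)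
      finally show ?thesis using one_minus[of \<tau>] by simp
    qed
    then show ?thesis using True by (intro exI[of _ 1]) (auto simp: min_def)
  next
    case False
    \<comment> \<open>The weight is nonpositive beyond \<open>\<tau>\<close>, and its integral is positive.\<close>
    have G: "Gamma b > 0" using b by (rule Gamma_real_pos)
    have "(LINT t|lborel. \<bar>gamma_diff b \<tau> t\<bar>) \<le> 2 / (b * Gamma b) * \<tau> powr b" if \<tau>: "0 < \<tau>" for \<tau>
    proof -
      have I1: "has_bochner_integral lborel (\<lambda>t. gamma_diff b \<tau> t) (1 - exp (- \<tau>))"
        using gamma_difference_laplace[OF b \<tau>, of 0] by simp
      \<comment> \<open>The majorant of the weight \<open>g\<close>: up to \<open>\<tau>\<close>,
        \<open>g\<close> is nonnegative and at most the kernel, and \<open>|g| = 2 * g - g\<close>;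
        beyond \<open>\<tau>\<close>, \<open>|g| = - g\<close>.\<close>
      have I2: "has_bochner_integral lborel (\<lambda>t. 2 * (indicator {0..\<tau>} t * gamma_kernel b t) - gamma_diff b \<tau> t)
         (2 * (\<tau> powr b / (b * Gamma b)) - (1 - exp (- \<tau>)))"
        using \<tau> by (intro has_bochner_integral_diff has_bochner_integral_mult_right gamma_kernel_initial[OF b] I1) auto
      have "(LINT t|lborel. \<bar>gamma_diff b \<tau> t\<bar>)
        \<le> (LINT t|lborel. 2 * (indicator {0..\<tau>} t * gamma_kernel b t) - gamma_diff b \<tau> t)"
      proof (rule integral_mono)
        show "integrable lborel (\<lambda>t. \<bar>gamma_diff b \<tau> t\<bar>)"
          using I1 by (auto simp: has_bochner_integral_iff)
        show "integrable lborel (\<lambda>t. 2 * (indicator {0..\<tau>} t * gamma_kernel b t) - gamma_diff b \<tau> t)"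
          using I2 by (simp add: has_bochner_integral_iff)
        fix t :: real
        show "\<bar>gamma_diff b \<tau> t\<bar> \<le> 2 * (indicator {0..\<tau>} t * gamma_kernel b t) - gamma_diff b \<tau> t"
        proof (cases "t \<le> \<tau>")
          case True
          have "exp (- t) * gamma_kernel b t \<le> 1 * gamma_kernel b t"
          proof (cases "t > 0")
            case True
            then show ?thesis using gamma_kernel_nonneg[OF b, of t] by (intro mult_right_mono) auto
          qed (simp add: gamma_kernel_def)
          then show ?thesis using True gamma_kernel_nonneg[OF b, of t]
            by (auto simp: gamma_kernel_def[of b "t - \<tau>"] gamma_kernel_def[of b t] indicator_def)
        next
          case F: False
          have "t powr (b - 1) \<le> (t - \<tau>) powr (b - 1)"
            using F False \<tau> by (intro powr_mono2') auto
          then have "gamma_kernel b t \<le> gamma_kernel b (t - \<tau>)"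
            using F \<tau> G by (auto simp: gamma_kernel_def intro!: divide_right_mono)
          then show ?thesis using F by (auto simp: abs_mult algebra_simps)
        qed
      qed
      also have "\<dots> = 2 * (\<tau> powr b / (b * Gamma b)) - (1 - exp (- \<tau>))"
        using I2 by (simp add: has_bochner_integral_iff)
      also have "\<dots> \<le> 2 * (\<tau> powr b / (b * Gamma b))" using \<tau> by simp
      finally show ?thesis by simp
    qed
    then show ?thesis using False b G by (intro exI[of _ "2 / (b * Gamma b)"]) (auto simp: min_def)
  qed
qed

subsection \<open>Test functions\<close>

lemma sum_gauss_separated:
  assumes h: "h > 0" "h\<^sup>2 \<le> v" and J: "finite J"
    and sep: "\<And>i j. i \<in> J \<Longrightarrow> j \<in> J \<Longrightarrow> i \<noteq> j \<Longrightarrow> h \<le> \<bar>z i - z j\<bar>"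
  shows "(\<Sum>j\<in>J. gauss v (y - z j)) \<le> 3 / h"
proof -
  \<comment> \<open>Each summand is at most the average of a wider Gaussian over an interval of length \<open>h\<close>, and these
    intervals are disjoint.\<close>
  have v: "v > 0" using h by (meson less_le_trans zero_less_power)
  define A where "A j = {y - z j - h / 2 <..< y - z j + h / 2}" for j
  \<comment> \<open>The price of widening the variance from \<open>v\<close> to
    \<open>2 * v\<close>: a shift by at most \<open>h / 2\<close> costs \<open>exp (1/8)\<close> and
    the normalization costs \<open>sqrt 2\<close>.\<close>
  define K where "K = exp (1/8) * sqrt (2::real)"
  have K: "0 \<le> K" "K \<le> 3"
  proof -
    have "exp (1/8::real) \<le> 1 + 1/8 + (1/8)\<^sup>2" by (rule exp_bound) auto
    then have "exp (1/8::real) \<le> 2" by (simp add: power2_eq_square)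
    moreover have "sqrt 2 \<le> 3/2" by (rule real_le_lsqrt) (auto simp: power2_eq_square)
    ultimately have "exp (1/8) * sqrt 2 \<le> 2 * (3/2::real)" by (intro mult_mono) auto
    then show "K \<le> 3" by (simp add: K_def)
  qed (simp add: K_def)
  have pw: "gauss v (y - z j) \<le> K * gauss (2 * v) s" if "s \<in> A j" for s j
  proof -
    define x where "x = y - z j"
    have "\<bar>s - x\<bar> \<le> h / 2" using that by (auto simp: A_def x_def abs_if)
    then have "(s - x)\<^sup>2 \<le> (h / 2)\<^sup>2" by (rule power2_le_iff_abs_le[THEN iffD2, rotated]) (use h in simp)
    then have "(s - x)\<^sup>2 \<le> v / 4" using h(2) by (simp add: power_divide)
    moreover have "s\<^sup>2 \<le> 2 * x\<^sup>2 + 2 * (s - x)\<^sup>2"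
      using zero_le_power2[of "s - 2 * x"] by (simp add: power2_eq_square algebra_simps)
    ultimately have "s\<^sup>2 \<le> 2 * x\<^sup>2 + v / 2" by linarith
    then have "- (x\<^sup>2) / (2 * v) \<le> 1/8 + - (s\<^sup>2) / (2 * (2 * v))" using v by (simp add: field_simps)
    then have "exp (- (x\<^sup>2) / (2 * v)) \<le> exp (1/8) * exp (- (s\<^sup>2) / (2 * (2 * v)))"
      unfolding exp_add[symmetric] by simp
    then have "gauss v x \<le> (exp (1/8) * exp (- (s\<^sup>2) / (2 * (2 * v)))) / sqrt (2 * pi * v)"
      unfolding gauss_def using v by (intro divide_right_mono) auto
    also have "\<dots> = K * gauss (2 * v) s"
    proof -
      have "sqrt (2 * pi * (2 * v)) = sqrt 2 * sqrt (2 * pi * v)"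
        unfolding real_sqrt_mult[symmetric] by (simp add: mult_ac)
      then show ?thesis by (simp add: gauss_def K_def)
    qed
    finally show ?thesis by (simp add: x_def)
  qed
  have gi: "integrable lborel (\<lambda>s. K * gauss (2 * v) s)" using v by (auto intro: integrable_gauss)
  have Ai: "integrable lborel (\<lambda>s. indicator (A j) s * (K * gauss (2 * v) s))" for j
    using integrable_mult_indicator[OF _ gi, of "A j"] by (simp add: A_def)
  have "h * gauss v (y - z j) \<le> (LINT s|lborel. indicator (A j) s * (K * gauss (2 * v) s))" for j
  proof -
    have "h * gauss v (y - z j) = (LINT s|lborel. indicator (A j) s * gauss v (y - z j))"
      using h by (simp add: A_def)
    also have "\<dots> \<le> (LINT s|lborel. indicator (A j) s * (K * gauss (2 * v) s))"
    proof (rule integral_mono[OF _ Ai])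
      show "integrable lborel (\<lambda>s. indicator (A j) s * gauss v (y - z j))"
        using h by (auto simp: A_def)
    qed (auto simp: indicator_def pw)
    finally show ?thesis .
  qed
  then have "(\<Sum>j\<in>J. h * gauss v (y - z j)) \<le> (\<Sum>j\<in>J. LINT s|lborel. indicator (A j) s * (K * gauss (2 * v) s))"
    by (rule sum_mono)
  also have "\<dots> = (LINT s|lborel. (\<Sum>j\<in>J. indicator (A j) s * (K * gauss (2 * v) s)))"
    by (rule Bochner_Integration.integral_sum[symmetric]) (rule Ai)
  also have "\<dots> \<le> (LINT s|lborel. K * gauss (2 * v) s)"
  proof (rule integral_mono[OF _ gi])
    show "integrable lborel (\<lambda>s. \<Sum>j\<in>J. indicator (A j) s * (K * gauss (2 * v) s))"
      by (rule Bochner_Integration.integrable_sum) (rule Ai)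
    fix s
    have "disjoint_family_on A J"
    proof (unfold disjoint_family_on_def, intro ballI impI)
      fix i j assume ij: "i \<in> J" "j \<in> J" "i \<noteq> j"
      show "A i \<inter> A j = {}" using sep[OF ij] by (auto simp: A_def)
    qed
    then have "(\<Sum>j\<in>J. indicator (A j) s :: real) = indicator (\<Union>j\<in>J. A j) s"
      using J by (intro indicator_UN_disjoint[symmetric]) auto
    also have "\<dots> \<le> 1" by (auto simp: indicator_def)
    finally show "(\<Sum>j\<in>J. indicator (A j) s * (K * gauss (2 * v) s)) \<le> K * gauss (2 * v) s"
      using K(1) gauss_nonneg[of "2 * v" s] v unfolding sum_distrib_right[symmetric]
      by (intro mult_left_le_one_le) (auto intro!: sum_nonneg)
  qed
  also have "\<dots> \<le> 3" using v K by (simp add: integral_gauss)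
  finally show ?thesis using h by (simp add: sum_distrib_left[symmetric] field_simps)
qed

definition aniso :: "'a set \<Rightarrow> real \<Rightarrow> 'a \<Rightarrow> real" where
  "aniso S N b = (if b \<in> S then 1 / N\<^sup>2 else 1)"

lemma aniso_pos: "N > 0 \<Longrightarrow> aniso S N b > 0"
  by (simp add: aniso_def)

text \<open>The direction \<open>b1\<close> carries the separation sum and gives
  \<open>3 / h\<close>; every other direction in \<open>S\<close> is bounded by its peak
  \<open>1 / \<nu>\<close>, and those outside \<open>S\<close> by 1. Keeping \<open>\<nu>\<close>
  apart from \<open>h\<close> allows for widths much larger than the spacing, as after a long heat
  flow.\<close>

lemma sum_Gauss_le:
  fixes Y :: "'j \<Rightarrow> 'a::euclidean_space"
  assumes S: "S \<subseteq> Basis" "b1 \<in> S" and N: "N > 0" and s: "s \<ge> 0"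
    and \<nu>: "\<nu> > 0" "\<nu>\<^sup>2 \<le> 1 / N\<^sup>2 + 2 * s" and h: "h > 0" "h\<^sup>2 \<le> 1 / N\<^sup>2 + 2 * s" and J: "finite J"
    and sep: "\<And>i j. i \<in> J \<Longrightarrow> j \<in> J \<Longrightarrow> i \<noteq> j \<Longrightarrow> h \<le> \<bar>(Y i - Y j) \<bullet> b1\<bar>"
  shows "(\<Sum>j\<in>J. Gauss (heat (aniso S N) s) (y - Y j)) \<le> (1 / \<nu>) ^ (card S - 1) * (3 / h)"
proof -
  define w where "w b = aniso S N b + 2 * s" for b
  have w: "w b > 0" for b using aniso_pos[OF N, of S b] s by (simp add: w_def)
  have b1: "b1 \<in> Basis" using S by auto
  have "Gauss w x \<le> (1 / \<nu>) ^ (card S - 1) * gauss (1 / N\<^sup>2 + 2 * s) (x \<bullet> b1)" for x :: 'a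
  proof -
    have "(\<Prod>b\<in>Basis - {b1}. gauss (w b) (x \<bullet> b)) \<le> (\<Prod>b\<in>Basis - {b1}. if b \<in> S then 1 / \<nu> else 1)"
    proof (intro prod_mono conjI gauss_nonneg w)
      fix b :: 'a
      have g: "gauss (w b) (x \<bullet> b) \<le> 1 / sqrt (w b)" using w by (rule gauss_le)
      show "gauss (w b) (x \<bullet> b) \<le> (if b \<in> S then 1 / \<nu> else 1)"
      proof (cases "b \<in> S")
        case True
        have "\<nu> \<le> sqrt (w b)" using \<nu> True by (intro real_le_rsqrt) (simp add: w_def aniso_def)
        then have "1 / sqrt (w b) \<le> 1 / \<nu>" using \<nu>(1) by (intro frac_le) auto
        then show ?thesis using g True by simp
      next
        case False
        have "1 \<le> sqrt (w b)" using s False by (intro real_le_rsqrt) (simp add: w_def aniso_def)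
        then have "1 / sqrt (w b) \<le> 1" by simp
        then show ?thesis using g False by simp
      qed
    qed
    also have "\<dots> = (1 / \<nu>) ^ card (S - {b1})"
    proof -
      have "(Basis - {b1}) \<inter> {b. b \<in> S} = S - {b1}" using S by auto
      then show ?thesis by (simp add: prod.If_cases)
    qed
    also have "card (S - {b1}) = card S - 1" using S by simp
    finally have "gauss (w b1) (x \<bullet> b1) * (\<Prod>b\<in>Basis - {b1}. gauss (w b) (x \<bullet> b)) \<le> gauss (w b1) (x \<bullet> b1) * (1 / \<nu>) ^ (card S - 1)"
      using gauss_nonneg[OF w] by (intro mult_left_mono)
    moreover have "w b1 = 1 / N\<^sup>2 + 2 * s" using S by (simp add: w_def aniso_def)
    ultimately show ?thesis unfolding Gauss_def prod.remove[OF finite_Basis b1] by (simp add: mult.commute)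
  qed
  then have "(\<Sum>j\<in>J. Gauss w (y - Y j)) \<le> (\<Sum>j\<in>J. (1 / \<nu>) ^ (card S - 1) * gauss (1 / N\<^sup>2 + 2 * s) ((y - Y j) \<bullet> b1))"
    by (intro sum_mono)
  also have "\<dots> = (1 / \<nu>) ^ (card S - 1) * (\<Sum>j\<in>J. gauss (1 / N\<^sup>2 + 2 * s) (y \<bullet> b1 - Y j \<bullet> b1))"
    by (simp add: sum_distrib_left inner_diff_left)
  also have "\<dots> \<le> (1 / \<nu>) ^ (card S - 1) * (3 / h)"
    using sep \<nu> by (intro mult_left_mono sum_gauss_separated h J) (auto simp: inner_diff_left)
  finally show ?thesis unfolding w_def .
qed

text \<open>Heat times up to \<open>1 / N^2\<close> at most triple each variance, which explains
  \<open>6 * pi\<close>. So on a box adapted to the Gaussian its value stays comparable to the peak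
  \<open>N ^ card S\<close>.\<close>

lemma Gauss_lower:
  fixes x :: "'a::euclidean_space"
  assumes S: "S \<subseteq> Basis" and N: "N \<ge> 1" and s: "0 \<le> s" "s \<le> 1 / N\<^sup>2" and R: "R \<ge> 0"
    and x: "\<And>b. b \<in> S \<Longrightarrow> \<bar>x \<bullet> b\<bar> \<le> R / N" "\<And>b. b \<in> Basis - S \<Longrightarrow> \<bar>x \<bullet> b\<bar> \<le> R"
  shows "(exp (- (R\<^sup>2) / 2) / sqrt (6 * pi)) ^ DIM('a) * N ^ card S \<le> Gauss (heat (aniso S N) s) x"
proof -
  define \<kappa> where "\<kappa> = exp (- (R\<^sup>2) / 2) / sqrt (6 * pi)"
  have L: "N\<^sup>2 > 0" using N by simp
  have key: "\<kappa> * c \<le> gauss v y" if c: "c \<ge> 1" and v: "1 / c\<^sup>2 \<le> v" "v \<le> 3 / c\<^sup>2" and y: "\<bar>y\<bar> \<le> R / c" for c v y :: real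
  proof -
    have v0: "v > 0" using v(1) c by (meson less_le_trans zero_less_divide_1_iff zero_less_power zero_less_one)
    have "y\<^sup>2 \<le> (R / c)\<^sup>2" using y by (metis abs_ge_zero power2_abs power_mono)
    also have "\<dots> = R\<^sup>2 * (1 / c\<^sup>2)" by (simp add: power_divide)
    also have "\<dots> \<le> R\<^sup>2 * v" using v(1) by (intro mult_left_mono) auto
    finally have "- (R\<^sup>2) / 2 \<le> - (y\<^sup>2) / (2 * v)" using v0 by (simp add: field_simps)
    then have 1: "exp (- (R\<^sup>2) / 2) \<le> exp (- (y\<^sup>2) / (2 * v))" by simp
    have "2 * pi * v \<le> 2 * pi * (3 / c\<^sup>2)" using v(2) by (intro mult_left_mono) auto
    then have "sqrt (2 * pi * v) \<le> sqrt (6 * pi / c\<^sup>2)" by simp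
    also have "\<dots> = sqrt (6 * pi) / c" using c by (simp add: real_sqrt_divide)
    finally have "exp (- (R\<^sup>2) / 2) / (sqrt (6 * pi) / c) \<le> gauss v y"
      unfolding gauss_def using 1 v0 by (intro frac_le) auto
    then show ?thesis by (simp add: \<kappa>_def)
  qed
  have "\<kappa> ^ DIM('a) * N ^ card S = (\<Prod>b\<in>Basis. \<kappa> * (if b \<in> S then N else 1))"
  proof -
    have "Basis \<inter> {b. b \<in> S} = S" using S by auto
    then show ?thesis by (simp add: prod.distrib prod.If_cases)
  qed
  also have "\<dots> \<le> Gauss (heat (aniso S N) s) x"
    unfolding Gauss_def
  proof (intro prod_mono conjI)
    fix b :: 'a assume b: "b \<in> Basis"
    show "0 \<le> \<kappa> * (if b \<in> S then N else 1)" using N by (auto simp: \<kappa>_def)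
    show "\<kappa> * (if b \<in> S then N else 1) \<le> gauss (aniso S N b + 2 * s) (x \<bullet> b)"
    proof (rule key)
      have three: "3 / N\<^sup>2 = 3 * (1 / N\<^sup>2)" by simp
      have "s \<le> 1" using order_trans[OF s(2), of 1] N by (simp add: one_le_power)
      then show "aniso S N b + 2 * s \<le> 3 / (if b \<in> S then N else 1)\<^sup>2"
        using s(2) three by (auto simp: aniso_def)
    qed (use N s x b in \<open>auto simp: aniso_def\<close>)
  qed
  finally show ?thesis by (simp add: \<kappa>_def)
qed

section \<open>Lebesgue and Sobolev norms of packets\<close>

lemma ennpowr_le:
  assumes "x \<le> ennreal c" "c \<ge> 0" "a \<ge> 0"
  shows "ennpowr x a \<le> ennreal (c powr a)"
proof -
  have "x \<noteq> \<infinity>" using assms(1) by (metis ennreal_less_top infinity_ennreal_def not_less)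
  moreover have "enn2real x \<le> c" using assms(1,2) by (metis enn2real_ennreal enn2real_mono ennreal_less_top)
  ultimately show ?thesis using assms(2,3) by (auto simp: ennpowr_def intro!: ennreal_leI powr_mono2)
qed

text \<open>Interpolation between the supremum and the integral of a majorant, from
  \<open>A^p \<le> S^(p-1) * A\<close>.\<close>

lemma Lp_norm_interpolate:
  assumes [measurable]: "A \<in> borel_measurable M" and p: "p > 1" and S: "S \<ge> 0" and T: "T \<ge> 0"
    and F: "\<And>y. norm (F y) \<le> A y" and AS: "\<And>y. A y \<le> S" and AT: "(\<integral>\<^sup>+ y. ennreal (A y) \<partial>M) \<le> ennreal T"
  shows "Lp_norm p M F \<le> ennreal ((S powr (p - 1) * T) powr (1 / p))"
  unfolding Lp_norm_def
proof (rule ennpowr_le)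
  have "(\<integral>\<^sup>+ y. ennreal (norm (F y) powr p) \<partial>M) \<le> (\<integral>\<^sup>+ y. ennreal (S powr (p - 1)) * ennreal (A y) \<partial>M)"
  proof (rule nn_integral_mono)
    fix y
    have A0: "A y \<ge> 0" using F[of y] norm_ge_zero order_trans by blast
    have "norm (F y) powr p \<le> A y powr p" using F[of y] p by (intro powr_mono2) auto
    also have "\<dots> = A y powr (p - 1) * A y" using A0 by (cases "A y = 0") (simp_all add: powr_diff)
    also have "\<dots> \<le> S powr (p - 1) * A y" using AS[of y] A0 p by (intro mult_right_mono powr_mono2) auto
    finally show "ennreal (norm (F y) powr p) \<le> ennreal (S powr (p - 1)) * ennreal (A y)"
      using A0 by (simp add: ennreal_mult[symmetric] ennreal_leI)
  qed
  also have "\<dots> = ennreal (S powr (p - 1)) * (\<integral>\<^sup>+ y. ennreal (A y) \<partial>M)" by (rule nn_integral_cmult) simp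
  also have "\<dots> \<le> ennreal (S powr (p - 1)) * ennreal T" by (intro mult_left_mono AT) simp
  also have "\<dots> = ennreal (S powr (p - 1) * T)" using T by (simp add: ennreal_mult)
  finally show "(\<integral>\<^sup>+ y. ennreal (norm (F y) powr p) \<partial>M) \<le> ennreal (S powr (p - 1) * T)" .
qed (use p T in auto)

lemma (in gauss_mix) integrable_kernel: "integrable M (\<lambda>i. \<kappa> i * Gauss (heat w (\<theta> i)) y)"
proof (rule Bochner_Integration.integrable_bound)
  define C where "C = (\<Prod>b\<in>Basis. 1 / sqrt (w b))"
  show "integrable M (\<lambda>i. C * \<kappa> i)" using integrable_weight by auto
  show "AE i in M. norm (\<kappa> i * Gauss (heat w (\<theta> i)) y) \<le> norm (C * \<kappa> i)"
  proof (rule AE_I2)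
    fix i
    have "Gauss (heat w (\<theta> i)) y \<le> C"
      unfolding Gauss_def C_def
    proof (intro prod_mono conjI gauss_nonneg shifted_pos)
      fix b :: 'a assume b: "b \<in> Basis"
      have "gauss (w b + 2 * \<theta> i) (y \<bullet> b) \<le> 1 / sqrt (w b + 2 * \<theta> i)" by (rule gauss_le[OF shifted_pos[OF b]])
      also have "\<dots> \<le> 1 / sqrt (w b)" using variance_pos[OF b] time_nonneg[of i] by (intro frac_le) auto
      finally show "gauss (w b + 2 * \<theta> i) (y \<bullet> b) \<le> 1 / sqrt (w b)" .
    qed
    then show "norm (\<kappa> i * Gauss (heat w (\<theta> i)) y) \<le> norm (C * \<kappa> i)"
      using Gauss_nonneg[of "\<lambda>b. w b + 2 * \<theta> i" y] shifted_pos by (auto simp: abs_mult mult.commute[of C] intro!: mult_left_mono)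
  qed
qed measurable

lemma nn_integral_lborel_translation:
  fixes f :: "'a::euclidean_space \<Rightarrow> ennreal"
  assumes [measurable]: "f \<in> borel_measurable borel"
  shows "(\<integral>\<^sup>+ x. f (x - c) \<partial>lborel) = (\<integral>\<^sup>+ x. f x \<partial>lborel)"
proof -
  have "distr lborel lborel ((+) c) = (lborel :: 'a measure)"
    using lborel_distr_plus[of c] by (simp cong: distr_cong)
  then show ?thesis using nn_integral_distr[of "(+) c" lborel lborel "\<lambda>x. f (x - c)"] by simp
qed

text \<open>The potential is again a packet. Separation bounds its majorant pointwise by
  \<open>Q * (N^(k-1) * (3 / h))\<close> with \<open>k = card S\<close>, and the unit mass of each
  Gaussian bounds the integral by \<open>card J * Q\<close>; interpolation combines the two.\<close>

lemma Sobolev_norm_sum_mix: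
  fixes Y :: "nat \<Rightarrow> 'a::euclidean_space"
  assumes S: "S \<subseteq> Basis" "b1 \<in> S" and N: "N > 0" and p: "p > 1"
    and A: "gauss_mix M \<kappa> \<theta> (aniso S N)" and B: "gauss_mix M' \<kappa>' \<theta>' (aniso S N)"
    and symb: "\<And>q. q \<ge> 0 \<Longrightarrow> (1 + q) powr (\<sigma> / 2) * (LINT i|M. \<kappa> i * exp (- (\<theta> i * q))) = (LINT i|M'. \<kappa>' i * exp (- (\<theta>' i * q)))"
    and Q: "(LINT i|M'. \<bar>\<kappa>' i\<bar>) \<le> Q"
    and h: "h > 0" "h \<le> 1 / N" and J: "finite J"
    and sep: "\<And>i j. i \<in> J \<Longrightarrow> j \<in> J \<Longrightarrow> i \<noteq> j \<Longrightarrow> h \<le> \<bar>(Y i - Y j) \<bullet> b1\<bar>"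
  shows "Sobolev_norm p \<sigma> (packet M \<kappa> \<theta> (aniso S N) J Y)
    \<le> ennreal (((Q * (N ^ (card S - 1) * (3 / h))) powr (p - 1) * (real (card J) * Q)) powr (1 / p))"
proof -
  interpret B: gauss_mix M' \<kappa>' \<theta>' "aniso S N" by fact
  have "0 \<le> (LINT i|M'. \<bar>\<kappa>' i\<bar>)" by (intro integral_nonneg_AE) auto
  then have Q0: "Q \<ge> 0" using Q by linarith
  define m where "m y = mix M' (\<lambda>i. \<bar>\<kappa>' i\<bar>) \<theta>' (aniso S N) y" for y
  interpret Babs: gauss_mix M' "\<lambda>i. \<bar>\<kappa>' i\<bar>" \<theta>' "aniso S N"
    by standard (use B.integrable_weight B.time_nonneg B.variance_pos in auto)
  have [measurable]: "m \<in> borel_measurable borel" using Babs.integrable_mix unfolding m_def[abs_def] by auto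
  have m0: "m y \<ge> 0" for y unfolding m_def using B.abs_mix_le[of y] by linarith
  have "Lp_norm p lborel (bessel_pot \<sigma> (packet M \<kappa> \<theta> (aniso S N) J Y))
     \<le> ennreal (((Q * (N ^ (card S - 1) * (3 / h))) powr (p - 1) * (real (card J) * Q)) powr (1 / p))"
  proof (rule Lp_norm_interpolate[where A = "\<lambda>y. \<Sum>j\<in>J. m (y - Y j)"])
    show "(\<lambda>y. \<Sum>j\<in>J. m (y - Y j)) \<in> borel_measurable lborel" by measurable
    show "0 \<le> Q * (N ^ (card S - 1) * (3 / h))" using Q0 N h by auto
    show "0 \<le> real (card J) * Q" using Q0 by auto
    fix y
    have "norm (bessel_pot \<sigma> (packet M \<kappa> \<theta> (aniso S N) J Y) y) = \<bar>\<Sum>j\<in>J. mix M' \<kappa>' \<theta>' (aniso S N) (y - Y j)\<bar>"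
      by (subst bessel_pot_sum_mix[OF A B J symb]) (simp_all only: norm_of_real)
    also have "\<dots> \<le> (\<Sum>j\<in>J. m (y - Y j))"
      unfolding m_def by (rule order_trans[OF sum_abs]) (intro sum_mono B.abs_mix_le)
    finally show "norm (bessel_pot \<sigma> (packet M \<kappa> \<theta> (aniso S N) J Y) y) \<le> (\<Sum>j\<in>J. m (y - Y j))" .
    have "(\<Sum>j\<in>J. m (y - Y j)) = (LINT i|M'. (\<Sum>j\<in>J. \<bar>\<kappa>' i\<bar> * Gauss (heat (aniso S N) (\<theta>' i)) (y - Y j)))"
      unfolding m_def mix_def by (rule Bochner_Integration.integral_sum[symmetric]) (rule Babs.integrable_kernel)
    also have "\<dots> \<le> (LINT i|M'. \<bar>\<kappa>' i\<bar> * (N ^ (card S - 1) * (3 / h)))"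
    proof (rule integral_mono)
      show "integrable M' (\<lambda>i. \<Sum>j\<in>J. \<bar>\<kappa>' i\<bar> * Gauss (heat (aniso S N) (\<theta>' i)) (y - Y j))"
        by (rule Bochner_Integration.integrable_sum) (rule Babs.integrable_kernel)
      show "integrable M' (\<lambda>i. \<bar>\<kappa>' i\<bar> * (N ^ (card S - 1) * (3 / h)))"
        using Babs.integrable_weight by auto
      fix i
      have "h\<^sup>2 \<le> (1 / N)\<^sup>2" using h by (intro power_mono) auto
      then have "(\<Sum>j\<in>J. Gauss (heat (aniso S N) (\<theta>' i)) (y - Y j)) \<le> (1 / (1 / N)) ^ (card S - 1) * (3 / h)"
        using N h B.time_nonneg[of i] by (intro sum_Gauss_le[OF S N] J sep) (auto simp: power_divide)
      then show "(\<Sum>j\<in>J. \<bar>\<kappa>' i\<bar> * Gauss (heat (aniso S N) (\<theta>' i)) (y - Y j)) \<le> \<bar>\<kappa>' i\<bar> * (N ^ (card S - 1) * (3 / h))"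
        unfolding sum_distrib_left[symmetric] by (intro mult_left_mono) auto
    qed
    also have "\<dots> = (LINT i|M'. \<bar>\<kappa>' i\<bar>) * (N ^ (card S - 1) * (3 / h))" by simp
    also have "\<dots> \<le> Q * (N ^ (card S - 1) * (3 / h))" using N h by (intro mult_right_mono Q) auto
    finally show "(\<Sum>j\<in>J. m (y - Y j)) \<le> Q * (N ^ (card S - 1) * (3 / h))" .
  next
    have "(\<integral>\<^sup>+ y. ennreal (\<Sum>j\<in>J. m (y - Y j)) \<partial>lborel) = (\<integral>\<^sup>+ y. (\<Sum>j\<in>J. ennreal (m (y - Y j))) \<partial>lborel)"
      using m0 by simp
    also have "\<dots> = (\<Sum>j\<in>J. (\<integral>\<^sup>+ y. ennreal (m (y - Y j)) \<partial>lborel))" by (rule nn_integral_sum) measurable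
    also have "\<dots> = (\<Sum>j\<in>J. (\<integral>\<^sup>+ y. ennreal (m y) \<partial>lborel))"
      by (intro sum.cong refl nn_integral_lborel_translation) measurable
    also have "\<dots> \<le> (\<Sum>j\<in>J. ennreal Q)"
      unfolding m_def using order_trans[OF B.nn_integral_mix_le ennreal_leI[OF Q]] by (intro sum_mono)
    also have "\<dots> = ennreal (real (card J) * Q)"
      using Q0 by (simp add: ennreal_mult ennreal_of_nat_eq_real_of_nat)
    finally show "(\<integral>\<^sup>+ y. ennreal (\<Sum>j\<in>J. m (y - Y j)) \<partial>lborel) \<le> ennreal (real (card J) * Q)" .
  qed (rule p)
  then show ?thesis unfolding Sobolev_norm_def .
qed

text \<open>Collects the factors independent of \<open>N\<close>. Capping \<open>\<delta>\<close> at
  1 keeps the spacing at most the width \<open>1 / N\<close> of the Gaussians.\<close>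

definition sobolev_const :: "real \<Rightarrow> real \<Rightarrow> real \<Rightarrow> real" where
  "sobolev_const p \<delta> K = (3 / min \<delta> 1) powr ((p - 1) / p) * K powr (1 / p)"

text \<open>With spacing of order \<open>1 / N\<close> and at most \<open>K * N\<close> centres, a
  supremum of order \<open>N^k\<close> and an integral of order \<open>N\<close> combine to the
  exponent \<open>k * (p - 1) / p + 1 / p = k - (k - 1) / p\<close>.\<close>

lemma Sobolev_norm_sum_mix_power:
  fixes Y :: "nat \<Rightarrow> 'a::euclidean_space"
  assumes S: "S \<subseteq> Basis" "b1 \<in> S" and p: "p > 1" and \<delta>: "\<delta> > 0" and K: "K > 0" and N: "N > 0"
    and A: "gauss_mix M \<kappa> \<theta> (aniso S N)" "gauss_mix M' \<kappa>' \<theta>' (aniso S N)"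
    and symb: "\<And>q. q \<ge> 0 \<Longrightarrow> (1 + q) powr (\<sigma> / 2) * (LINT i|M. \<kappa> i * exp (- (\<theta> i * q))) = (LINT i|M'. \<kappa>' i * exp (- (\<theta>' i * q)))"
    and Q: "(LINT i|M'. \<bar>\<kappa>' i\<bar>) \<le> Q" and J: "finite J" "real (card J) \<le> K * N"
    and sep: "\<And>i j. i \<in> J \<Longrightarrow> j \<in> J \<Longrightarrow> i \<noteq> j \<Longrightarrow> \<delta> / N \<le> \<bar>(Y i - Y j) \<bullet> b1\<bar>"
  shows "Sobolev_norm p \<sigma> (packet M \<kappa> \<theta> (aniso S N) J Y)
    \<le> ennreal (sobolev_const p \<delta> K * Q * N powr (real (card S) - (real (card S) - 1) / p))"
proof -
  define m where "m = min \<delta> 1"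
  have m: "m > 0" "m \<le> 1" "m \<le> \<delta>" using \<delta> by (auto simp: m_def)
  have "0 \<le> (LINT i|M'. \<bar>\<kappa>' i\<bar>)" by (intro integral_nonneg_AE) auto
  then have Q0: "Q \<ge> 0" using Q by linarith
  have k: "card S \<ge> 1" using S by (metis One_nat_def Suc_leI card_gt_0_iff empty_iff finite_Basis finite_subset)
  have md: "m / N \<le> \<delta> / N" "m / N \<le> 1 / N" using m N by (auto intro!: divide_right_mono)
  have B: "Sobolev_norm p \<sigma> (packet M \<kappa> \<theta> (aniso S N) J Y)
    \<le> ennreal (((Q * (N ^ (card S - 1) * (3 / (m / N)))) powr (p - 1) * (real (card J) * Q)) powr (1 / p))"
    by (rule Sobolev_norm_sum_mix[OF S N p A symb Q _ md(2) J(1) order_trans[OF md(1) sep]]) (use m N in auto)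
  have e: "N ^ (card S - 1) * (3 / (m / N)) = 3 / m * N powr card S"
  proof -
    have "N powr card S = N ^ (card S - 1) * N"
      using N k by (simp add: powr_realpow power_eq_if)
    then show ?thesis using N by simp
  qed
  have "((Q * (N ^ (card S - 1) * (3 / (m / N)))) powr (p - 1) * (real (card J) * Q)) powr (1 / p)
     \<le> ((Q * (3 / m * N powr card S)) powr (p - 1) * (K * N * Q)) powr (1 / p)"
    unfolding e using J Q0 p by (intro powr_mono2 mult_left_mono mult_right_mono) auto
  also have "\<dots> = sobolev_const p \<delta> K * Q * N powr (real (card S) - (real (card S) - 1) / p)"
  proof (cases "Q = 0")
    case False
    then have Qp: "Q > 0" using Q0 by simp
    have "((Q * (r * N powr card S)) powr (p - 1) * (K * N * Q)) powr (1 / p)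
       = (Q powr (p - 1) * Q) powr (1 / p) * (r powr (p - 1)) powr (1 / p) * K powr (1 / p) * (((N powr card S) powr (p - 1)) powr (1/p) * N powr (1/p))" if "r > 0" for r
      using Qp that K N by (simp add: powr_mult mult_ac)
    then have "((Q * (3 / m * N powr card S)) powr (p - 1) * (K * N * Q)) powr (1 / p)
       = (Q powr (p - 1) * Q) powr (1 / p) * ((3 / m) powr (p - 1)) powr (1 / p) * K powr (1 / p) * (((N powr card S) powr (p - 1)) powr (1/p) * N powr (1/p))"
      using m by (meson divide_pos_pos zero_less_numeral)
    also have "(Q powr (p - 1) * Q) powr (1 / p) = Q"
      using Qp p by (simp add: powr_mult powr_powr powr_add[symmetric] diff_divide_distrib)
    also have "((N powr card S) powr (p - 1)) powr (1/p) * N powr (1/p) = N powr (real (card S) - (real (card S) - 1) / p)"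
      using p by (simp add: powr_powr powr_add[symmetric] field_simps)
    finally show ?thesis by (simp add: sobolev_const_def m_def[symmetric] powr_powr mult_ac)
  qed (use p in simp)
  finally show ?thesis
    using order_trans[OF B ennreal_leI] by blast
qed

lemma integral_count_space_unit: "(LINT i|count_space (UNIV :: unit set). f i) = (f () :: real)"
  by (simp only: lebesgue_integral_count_space_finite[OF finite_class.finite] UNIV_unit) simp

text \<open>The region around \<open>c\<close> on which a Gaussian with variances
  \<open>aniso S N\<close> is comparable to its peak, with constants depending on
  \<open>R\<close>.\<close>

definition tube :: "'a::euclidean_space set \<Rightarrow> real \<Rightarrow> real \<Rightarrow> 'a \<Rightarrow> 'a set" where
  "tube S R N c = {y. (\<forall>b\<in>S. \<bar>(y - c) \<bullet> b\<bar> \<le> R / N) \<and> (\<forall>b\<in>Basis - S. \<bar>(y - c) \<bullet> b\<bar> \<le> R)}"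

text \<open>Heat times in \<open>[0, 1 / N^2]\<close> suffice: their weight is of order
  \<open>N^(-2 * a)\<close>, the damping is at least \<open>exp (- 1)\<close>, and the Gaussian
  still has size \<open>N^k\<close> on the tube.\<close>

lemma mix_gamma_lower:
  fixes x :: "'a::euclidean_space"
  assumes S: "S \<subseteq> Basis" and N: "N \<ge> 1" and R: "R \<ge> 0" and x: "x \<in> tube S R N 0" and a: "a > 0"
  shows "exp (- 1) / (a * Gamma a) * (exp (- (R\<^sup>2) / 2) / sqrt (6 * pi)) ^ DIM('a) * N powr (real (card S) - 2 * a)
     \<le> mix lborel (\<lambda>t. gamma_kernel a t * exp (- t)) (\<lambda>t. max 0 t) (aniso S N) x"
proof -
  define G where "G = (exp (- (R\<^sup>2) / 2) / sqrt (6 * pi)) ^ DIM('a) * N ^ card S"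
  have G0: "G \<ge> 0" unfolding G_def using N by auto
  have L: "1 / N\<^sup>2 \<le> 1" "1 / N\<^sup>2 \<ge> 0" using N by (auto simp: one_le_power)
  interpret gauss_mix_moments lborel "\<lambda>t. gamma_kernel a t * exp (- t)" "\<lambda>t. max 0 t" "aniso S N :: 'a \<Rightarrow> real"
    using N by (intro gauss_mix_moments_gamma a aniso_pos) auto
  have I: "has_bochner_integral lborel (\<lambda>t. exp (- 1) * G * (indicator {0..1 / N\<^sup>2} t * gamma_kernel a t)) (exp (- 1) * G * ((1 / N\<^sup>2) powr a / (a * Gamma a)))"
    using L by (intro has_bochner_integral_mult_right gamma_kernel_initial a)
  have "exp (- 1) * G * ((1 / N\<^sup>2) powr a / (a * Gamma a)) = (LINT t|lborel. exp (- 1) * G * (indicator {0..1 / N\<^sup>2} t * gamma_kernel a t))"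
    using I by (simp add: has_bochner_integral_iff)
  also have "\<dots> \<le> mix lborel (\<lambda>t. gamma_kernel a t * exp (- t)) (\<lambda>t. max 0 t) (aniso S N) x"
    unfolding mix_def
  proof (rule integral_mono[OF _ integrable_kernel])
    show "integrable lborel (\<lambda>t. exp (- 1) * G * (indicator {0..1 / N\<^sup>2} t * gamma_kernel a t))"
      using I by (simp add: has_bochner_integral_iff)
    fix t :: real
    have g: "gamma_kernel a t \<ge> 0" using a by (rule gamma_kernel_nonneg)
    have Gn: "Gauss (heat (aniso S N) (max 0 t)) x \<ge> 0" by (intro Gauss_nonneg shifted_pos)
    show "exp (- 1) * G * (indicator {0..1 / N\<^sup>2} t * gamma_kernel a t) \<le> gamma_kernel a t * exp (- t) * Gauss (heat (aniso S N) (max 0 t)) x"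
    proof (cases "t \<in> {0..1 / N\<^sup>2}")
      case True
      have "G \<le> Gauss (heat (aniso S N) (max 0 t)) x"
        unfolding G_def using x True by (intro Gauss_lower[OF S N _ _ R]) (auto simp: tube_def)
      moreover have "exp (- 1) \<le> exp (- t)" using True L by simp
      ultimately have "exp (- 1) * G \<le> exp (- t) * Gauss (heat (aniso S N) (max 0 t)) x"
        using G0 by (intro mult_mono) auto
      then have "(exp (- 1) * G) * gamma_kernel a t \<le> (exp (- t) * Gauss (heat (aniso S N) (max 0 t)) x) * gamma_kernel a t"
        using g by (intro mult_right_mono)
      then show ?thesis using True by (simp add: mult_ac)
    qed (use g Gn in simp)
  qed
  also have "exp (- 1) * G * ((1 / N\<^sup>2) powr a / (a * Gamma a)) =
    exp (- 1) / (a * Gamma a) * (exp (- (R\<^sup>2) / 2) / sqrt (6 * pi)) ^ DIM('a) * N powr (real (card S) - 2 * a)"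
  proof -
    have "(1 / N\<^sup>2) powr a = N powr (- (2 * a))"
    proof -
      have "1 / N\<^sup>2 = N powr (- 2)" using N by (simp add: powr_minus divide_inverse)
      then show ?thesis by (simp add: powr_powr)
    qed
    then have "N ^ card S * (1 / N\<^sup>2) powr a = N powr (real (card S) - 2 * a)"
    proof -
      have "N ^ card S = N powr card S" using N by (simp add: powr_realpow)
      then show ?thesis using \<open>(1 / N\<^sup>2) powr a = _\<close> by (simp add: powr_add[symmetric])
    qed
    then show ?thesis unfolding G_def by (simp add: mult_ac)
  qed
  finally show ?thesis .
qed

text \<open>The requirements on a test function: height on the tubes, a negative part small relative
  to it, and the Sobolev norm. For \<open>\<sigma> \<ge> 0\<close> the order lowers the height and
  leaves the norm alone; for \<open>\<sigma> < 0\<close> it is the other way round, with the gain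
  limited to two powers of \<open>N\<close>.\<close>

definition tube_bump ::
  "real \<Rightarrow> real \<Rightarrow> 'a::euclidean_space set \<Rightarrow> real \<Rightarrow> real \<Rightarrow> ('j \<Rightarrow> 'a) \<Rightarrow> 'j set \<Rightarrow> real \<Rightarrow> real \<Rightarrow> real \<Rightarrow> ('a \<Rightarrow> real) \<Rightarrow> bool" where
  "tube_bump p \<sigma> S R N Y J \<eta> c C f \<longleftrightarrow> schwartz (\<lambda>y. of_real (f y)) \<and>
    (\<forall>j\<in>J. \<forall>y\<in>tube S R N (Y j). f y \<ge> c * N powr (real (card S) - max \<sigma> 0)) \<and>
    (\<forall>y. f y \<ge> - (\<eta> * (c * N powr (real (card S) - max \<sigma> 0)))) \<and>
    Sobolev_norm p \<sigma> (\<lambda>y. of_real (f y)) \<le> ennreal (C * N powr (real (card S) - (real (card S) - 1) / p + min 0 (max \<sigma> (- 2))))"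

lemma tube_translate: "y \<in> tube S R N c \<Longrightarrow> y - c \<in> tube S R N 0"
  by (simp add: tube_def)

text \<open>For \<open>\<sigma> \<ge> 0\<close> the multiplier undoes the smoothing completely, so
  the norm is that of the plain Gaussian packet, the one-index mixture of total weight 1.\<close>

lemma tube_bump_nonneg:
  fixes Y :: "nat \<Rightarrow> 'a::euclidean_space"
  assumes S: "S \<subseteq> Basis" "b1 \<in> S" and p: "p > 1" and \<delta>: "\<delta> > 0" and K: "K > 0" and N: "N > 0"
    and \<sigma>: "\<sigma> \<ge> 0" and \<eta>: "\<eta> > 0" and c: "c > 0"
    and A: "gauss_mix_moments M \<kappa> \<theta> (aniso S N)"
    and symb: "\<And>q. q \<ge> 0 \<Longrightarrow> (1 + q) powr (\<sigma> / 2) * (LINT i|M. \<kappa> i * exp (- (\<theta> i * q))) = 1"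
    and nonneg: "\<And>y. mix M \<kappa> \<theta> (aniso S N) y \<ge> 0"
    and low: "\<And>y. y \<in> tube S R N 0 \<Longrightarrow> c * N powr (real (card S) - max \<sigma> 0) \<le> mix M \<kappa> \<theta> (aniso S N) y"
    and J: "finite J" "real (card J) \<le> K * N"
    and sep: "\<And>i j. i \<in> J \<Longrightarrow> j \<in> J \<Longrightarrow> i \<noteq> j \<Longrightarrow> \<delta> / N \<le> \<bar>(Y i - Y j) \<bullet> b1\<bar>"
  shows "tube_bump p \<sigma> S R N Y J \<eta> c (sobolev_const p \<delta> K) (\<lambda>y. \<Sum>j\<in>J. mix M \<kappa> \<theta> (aniso S N) (y - Y j))"
    (is "tube_bump _ _ _ _ _ _ _ _ _ _ (\<lambda>y. \<Sum>j\<in>J. ?m (y - Y j))")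
  unfolding tube_bump_def
proof (intro conjI ballI allI)
  interpret A: gauss_mix_moments M \<kappa> \<theta> "aniso S N" by fact
  interpret B: gauss_mix_moments "count_space (UNIV :: unit set)" "\<lambda>_. 1" "\<lambda>_. 0" "aniso S N :: 'a \<Rightarrow> real"
    using N by (intro gauss_mix_moments_unit aniso_pos) auto
  show "schwartz (\<lambda>y. complex_of_real (\<Sum>j\<in>J. ?m (y - Y j)))" by (rule A.schwartz_sum_mix)
  show "c * N powr (real (card S) - max \<sigma> 0) \<le> (\<Sum>j\<in>J. ?m (y - Y j))" if "j \<in> J" "y \<in> tube S R N (Y j)" for j y
    using member_le_sum[OF that(1), of "\<lambda>j. ?m (y - Y j)"] nonneg J(1) low[OF tube_translate[OF that(2)]] by auto
  have "0 \<le> (\<Sum>j\<in>J. ?m (y - Y j))" for y by (intro sum_nonneg nonneg)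
  moreover have "0 \<le> \<eta> * (c * N powr (real (card S) - max \<sigma> 0))" using \<eta> c by auto
  ultimately show "- (\<eta> * (c * N powr (real (card S) - max \<sigma> 0))) \<le> (\<Sum>j\<in>J. ?m (y - Y j))" for y
    by (meson neg_le_0_iff_le order_trans)
  have "Sobolev_norm p \<sigma> (\<lambda>y. of_real (\<Sum>j\<in>J. ?m (y - Y j))) \<le> ennreal (sobolev_const p \<delta> K * 1 * N powr (real (card S) - (real (card S) - 1) / p))"
  proof (rule Sobolev_norm_sum_mix_power[OF S p \<delta> K N A.gauss_mix_axioms B.gauss_mix_axioms _ _ J sep])
    show "(1 + q) powr (\<sigma> / 2) * (LINT i|M. \<kappa> i * exp (- (\<theta> i * q))) = (LINT i|count_space (UNIV :: unit set). 1 * exp (- (0 * q)))" if "q \<ge> 0" for q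
      unfolding integral_count_space_unit using symb[OF that] by simp
    show "(LINT i|count_space (UNIV :: unit set). \<bar>1::real\<bar>) \<le> 1"
      unfolding integral_count_space_unit by simp
  qed
  then show "Sobolev_norm p \<sigma> (\<lambda>y. of_real (\<Sum>j\<in>J. ?m (y - Y j))) \<le> ennreal (sobolev_const p \<delta> K * N powr (real (card S) - (real (card S) - 1) / p + min 0 (max \<sigma> (- 2))))"
    using \<sigma> by simp
qed

lemma test_functions:
  fixes S :: "'a::euclidean_space set"
  assumes S: "S \<subseteq> Basis" "b1 \<in> S" "2 \<le> card S" and p: "p > 1" and \<delta>: "\<delta> > 0" and K: "K > 0" and R: "R \<ge> 0" and \<eta>: "\<eta> > 0"
  obtains c C N0 where "c > 0" "C > 0" "N0 \<ge> 1"
    "\<And>N J (Y :: nat \<Rightarrow> 'a). N0 \<le> N \<Longrightarrow> finite J \<Longrightarrow> real (card J) \<le> K * N \<Longrightarrow>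
    (\<And>i j. i \<in> J \<Longrightarrow> j \<in> J \<Longrightarrow> i \<noteq> j \<Longrightarrow> \<delta> / N \<le> \<bar>(Y i - Y j) \<bullet> b1\<bar>) \<Longrightarrow> \<exists>f. tube_bump p \<sigma> S R N Y J \<eta> c C f"
proof -
  define g where "g = (exp (- (R\<^sup>2) / 2) / sqrt (6 * pi)) ^ DIM('a)"
  have g: "g > 0" unfolding g_def by simp
  have Gn: "Gauss (aniso S N) y \<ge> 0" if "N > 0" for N and y :: 'a
    using that by (intro Gauss_nonneg aniso_pos)
  have Glow: "Gauss (aniso S N) x \<ge> g * N powr card S" if "N \<ge> 1" "x \<in> tube S R N 0" for N x
    using Gauss_lower[OF S(1) that(1) _ _ R, of 0 x] that unfolding g_def tube_def by (simp add: powr_realpow)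
  have C: "sobolev_const p \<delta> K > 0" unfolding sobolev_const_def using \<delta> K by simp
  consider "\<sigma> > 0" | "\<sigma> = 0" | "\<sigma> < 0" by linarith
  then show thesis
  proof cases
    case 1
    \<comment> \<open>The packet is smoothed by the power \<open>- \<sigma> / 2\<close> of the
      Bessel operator, so that its height is of order \<open>N^(k - 2 * a)\<close>.\<close>
    define a where "a = \<sigma> / 2"
    have a: "a > 0" using 1 by (simp add: a_def)
    define c where "c = exp (- 1) / (a * Gamma a) * g"
    have c: "c > 0" unfolding c_def using a g Gamma_real_pos[OF a] by simp
    show thesis
    proof (rule that[OF c C order_refl], rule exI, rule tube_bump_nonneg[OF S(1,2) p \<delta> K _ _ \<eta> c])
      fix N :: real
      assume N: "1 \<le> N"
      then show N0: "N > 0" by simp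
      let ?m = "mix lborel (\<lambda>t. gamma_kernel a t * exp (- t)) (\<lambda>t. max 0 t) (aniso S N) :: 'a \<Rightarrow> real"
      show A: "gauss_mix_moments lborel (\<lambda>t. gamma_kernel a t * exp (- t)) (\<lambda>t. max 0 t) (aniso S N :: 'a \<Rightarrow> real)"
        using N0 by (intro gauss_mix_moments_gamma a aniso_pos) auto
      interpret A: gauss_mix_moments lborel "\<lambda>t. gamma_kernel a t * exp (- t)" "\<lambda>t. max 0 t" "aniso S N :: 'a \<Rightarrow> real" by fact
      show "?m y \<ge> 0" for y
        unfolding mix_def by (intro integral_nonneg_AE AE_I2 mult_nonneg_nonneg gamma_kernel_nonneg a Gauss_nonneg A.shifted_pos) auto
      show "?m y \<ge> c * N powr (real (card S) - max \<sigma> 0)" if "y \<in> tube S R N 0" for y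
        using mix_gamma_lower[OF S(1) N R that a] 1 by (simp add: c_def g_def a_def)
      show "(1 + q) powr (\<sigma> / 2) * (LINT t|lborel. gamma_kernel a t * exp (- t) * exp (- (max 0 t * q))) = 1" if "q \<ge> 0" for q
        unfolding gamma_symbol[OF a that] a_def[symmetric] using that by (simp add: powr_minus)
    qed (use 1 in auto)
  next
    case 2
    show thesis
    proof (rule that[OF g C order_refl], rule exI, rule tube_bump_nonneg[OF S(1,2) p \<delta> K _ _ \<eta> g])
      fix N :: real
      assume N: "1 \<le> N"
      then show N0: "N > 0" by simp
      show "gauss_mix_moments (count_space (UNIV :: unit set)) (\<lambda>_. 1) (\<lambda>_. 0) (aniso S N :: 'a \<Rightarrow> real)"
        using N0 by (intro gauss_mix_moments_unit aniso_pos) auto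
      show "mix (count_space (UNIV :: unit set)) (\<lambda>_. 1) (\<lambda>_. 0) (aniso S N) y \<ge> 0" for y :: 'a
        unfolding mix_unit by (rule Gn[OF N0])
      show "g * N powr (real (card S) - max \<sigma> 0) \<le> mix (count_space (UNIV :: unit set)) (\<lambda>_. 1) (\<lambda>_. 0) (aniso S N) y" if "y \<in> tube S R N 0" for y
        unfolding mix_unit using Glow[OF N that] 2 by simp
      show "(1 + q) powr (\<sigma> / 2) * (LINT i|count_space (UNIV :: unit set). 1 * exp (- (0 * q))) = 1" if "q \<ge> 0" for q
        unfolding integral_count_space_unit using 2 that by simp
    qed (use 2 in auto)
  next
    case 3
    \<comment> \<open>Applying the multiplier of negative order \<open>\<sigma>\<close> to the
      two-index mixture produces the weight \<open>gamma_diff b \<tau>\<close>.\<close>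
    define b where "b = - \<sigma> / 2"
    have b: "b > 0" using 3 by (simp add: b_def)
    obtain C1 where C1: "C1 > 0" "\<And>\<tau>. 0 < \<tau> \<Longrightarrow> \<tau> \<le> 1 \<Longrightarrow>
        (LINT t|lborel. \<bar>gamma_diff b \<tau> t\<bar>) \<le> C1 * \<tau> powr (min b 1)"
      using gamma_difference_L1[OF b] by blast
    define m where "m = min \<delta> 1"
    have m: "m > 0" "m \<le> 1" "m \<le> \<delta>" using \<delta> by (auto simp: m_def)
    \<comment> \<open>Half of the peak is kept; the other half is sacrificed to the blurred
      part.\<close>
    define c where "c = g / 2"
    have c: "c > 0" using g by (simp add: c_def)
    \<comment> \<open>The blurred packet is at most \<open>3 / m / B\<close> times
      \<open>N^k\<close>; this choice makes it at most a fraction \<open>min \<eta> 1\<close> of the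
      retained height.\<close>
    define B where "B = max 1 (3 / m / (c * min \<eta> 1))"
    have B: "B \<ge> 1" "3 / m / B \<le> c * min \<eta> 1"
    proof -
      have "3 / m / (c * min \<eta> 1) \<le> B" by (simp add: B_def)
      moreover have q: "c * min \<eta> 1 > 0" using c \<eta> by auto
      ultimately have "3 / m \<le> c * min \<eta> 1 * B" by (simp only: pos_divide_le_eq[OF q] mult.commute)
      moreover show "B \<ge> 1" by (simp add: B_def)
      ultimately show "3 / m / B \<le> c * min \<eta> 1" by (subst pos_divide_le_eq) auto
    qed
    define D where "D = sobolev_const p \<delta> K * C1 * B powr (2 * min b 1)"
    have D: "D > 0" using C C1(1) B(1) by (simp add: D_def)
    show thesis
    proof (rule that[OF c D B(1)])
      fix N J and Y :: "nat \<Rightarrow> 'a"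
      assume NB: "B \<le> N" and J: "finite J" "real (card J) \<le> K * N"
        and sep: "\<And>i j. i \<in> J \<Longrightarrow> j \<in> J \<Longrightarrow> i \<noteq> j \<Longrightarrow> \<delta> / N \<le> \<bar>(Y i - Y j) \<bullet> b1\<bar>"
      have N: "N \<ge> 1" "N > 0" using NB B(1) by auto
      \<comment> \<open>At this time every variance in a direction of \<open>S\<close> has grown to
        at least \<open>(B / N)^2\<close>, which lowers the bound for its peak from \<open>N\<close>
        to \<open>N / B\<close>.\<close>
      define \<tau> where "\<tau> = (B / N)\<^sup>2"
      have \<tau>: "\<tau> > 0" "\<tau> \<le> 1" using N NB B(1) by (auto simp: \<tau>_def power_le_one)
      interpret A: gauss_mix_moments "count_space (UNIV :: bool set)" "\<lambda>b. if b then - exp (- \<tau>) else 1" "\<lambda>b. if b then \<tau> else 0" "aniso S N :: 'a \<Rightarrow> real"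
        using N \<tau> by (intro gauss_mix_moments_bool aniso_pos) auto
      interpret B: gauss_mix lborel "\<lambda>t. gamma_diff b \<tau> t" "\<lambda>t. max 0 t" "aniso S N :: 'a \<Rightarrow> real"
        using N \<tau> by (intro gauss_mix_gamma_difference b aniso_pos) auto
      let ?m = "mix (count_space (UNIV :: bool set)) (\<lambda>b. if b then - exp (- \<tau>) else 1) (\<lambda>b. if b then \<tau> else 0) (aniso S N) :: 'a \<Rightarrow> real"
      have sum_m: "(\<Sum>j\<in>J. ?m (y - Y j)) = (\<Sum>j\<in>J. Gauss (aniso S N) (y - Y j)) - exp (- \<tau>) * (\<Sum>j\<in>J. Gauss (heat (aniso S N) \<tau>) (y - Y j))" for y
        by (simp add: mix_bool sum_subtractf sum_distrib_left)
      have md: "m / N \<le> \<delta> / N" "m / N \<le> 1 / N" using m N by (auto intro!: divide_right_mono)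
      have blur: "exp (- \<tau>) * (\<Sum>j\<in>J. Gauss (heat (aniso S N) \<tau>) (y - Y j)) \<le> (c * min \<eta> 1) * N powr card S" for y
      proof -
        have "(m / N)\<^sup>2 \<le> (1 / N)\<^sup>2" using m md N by (intro power_mono) auto
        then have h2: "(m / N)\<^sup>2 \<le> 1 / N\<^sup>2 + 2 * \<tau>" using \<tau> by (simp add: power_divide)
        have \<nu>2: "(B / N)\<^sup>2 \<le> 1 / N\<^sup>2 + 2 * \<tau>" using \<tau> by (simp add: \<tau>_def[symmetric])
        have "(\<Sum>j\<in>J. Gauss (heat (aniso S N) \<tau>) (y - Y j)) \<le> (1 / (B / N)) ^ (card S - 1) * (3 / (m / N))"
          by (rule sum_Gauss_le[OF S(1,2) N(2) _ _ \<nu>2 _ h2 J(1) order_trans[OF md(1)]]) (use \<tau> B(1) N m sep in auto)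
        also have "\<dots> = (3 / m) * (1 / B) ^ (card S - 1) * (N ^ (card S - 1) * N)"
          by (simp add: power_divide mult_ac)
        also have "N ^ (card S - 1) * N = N powr card S"
          using N S(3) by (simp add: powr_realpow power_eq_if)
        \<comment> \<open>Here it matters that \<open>S\<close> has at least two directions: besides
          the one used for separation, one remains that yields a factor
          \<open>1 / B\<close>.\<close>
        also have "(3 / m) * (1 / B) ^ (card S - 1) * N powr card S \<le> (3 / m) * (1 / B) ^ 1 * N powr card S"
          using B(1) m S(3) by (intro mult_right_mono mult_left_mono power_decreasing) auto
        also have "\<dots> = (3 / m / B) * N powr card S" by simp
        also have "\<dots> \<le> (c * min \<eta> 1) * N powr card S" by (intro mult_right_mono B(2)) auto
        finally have s: "(\<Sum>j\<in>J. Gauss (heat (aniso S N) \<tau>) (y - Y j)) \<le> (c * min \<eta> 1) * N powr card S" .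
        have "0 \<le> (\<Sum>j\<in>J. Gauss (heat (aniso S N) \<tau>) (y - Y j))"
          using A.shifted_pos[of _ True] by (intro sum_nonneg Gauss_nonneg) auto
        then have "exp (- \<tau>) * (\<Sum>j\<in>J. Gauss (heat (aniso S N) \<tau>) (y - Y j)) \<le> 1 * (\<Sum>j\<in>J. Gauss (heat (aniso S N) \<tau>) (y - Y j))"
          using \<tau> by (intro mult_right_mono) auto
        then show ?thesis using s by linarith
      qed
      have e3: "real (card S) - max \<sigma> 0 = real (card S)" using 3 by simp
      have "tube_bump p \<sigma> S R N Y J \<eta> c D (\<lambda>y. \<Sum>j\<in>J. ?m (y - Y j))"
        unfolding tube_bump_def
      proof (intro conjI ballI allI)
        show "schwartz (\<lambda>y. complex_of_real (\<Sum>j\<in>J. ?m (y - Y j)))" by (rule A.schwartz_sum_mix)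
        show "c * N powr (real (card S) - max \<sigma> 0) \<le> (\<Sum>j\<in>J. ?m (y - Y j))" if "j \<in> J" "y \<in> tube S R N (Y j)" for j y
        proof -
          have "g * N powr card S \<le> (\<Sum>j\<in>J. Gauss (aniso S N) (y - Y j))"
            using member_le_sum[OF that(1), of "\<lambda>j. Gauss (aniso S N) (y - Y j)"] Gn[OF N(2)] J(1) Glow[OF N(1) tube_translate[OF that(2)]] by auto
          moreover have "(c * min \<eta> 1) * N powr card S \<le> (c * 1) * N powr card S"
            using c by (intro mult_right_mono mult_left_mono) auto
          moreover have "g * N powr card S = c * N powr card S + c * N powr card S" by (simp add: c_def)
          ultimately show ?thesis unfolding sum_m e3 using blur[of y] by linarith
        qed
        show "- (\<eta> * (c * N powr (real (card S) - max \<sigma> 0))) \<le> (\<Sum>j\<in>J. ?m (y - Y j))" for y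
        proof -
          have "0 \<le> (\<Sum>j\<in>J. Gauss (aniso S N) (y - Y j))" by (intro sum_nonneg Gn N)
          moreover have "(c * min \<eta> 1) * N powr card S \<le> (c * \<eta>) * N powr card S"
            using c by (intro mult_right_mono mult_left_mono) auto
          moreover have "(c * \<eta>) * N powr card S = \<eta> * (c * N powr card S)" by simp
          ultimately show ?thesis unfolding sum_m e3 using blur[of y] by linarith
        qed
        have "Sobolev_norm p \<sigma> (\<lambda>y. of_real (\<Sum>j\<in>J. ?m (y - Y j))) \<le> ennreal (sobolev_const p \<delta> K * (C1 * \<tau> powr (min b 1)) * N powr (real (card S) - (real (card S) - 1) / p))"
        proof (rule Sobolev_norm_sum_mix_power[OF S(1,2) p \<delta> K N(2) A.gauss_mix_axioms B.gauss_mix_axioms _ C1(2)[OF \<tau>] J sep])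
          show "(1 + q) powr (\<sigma> / 2) * (LINT i|count_space (UNIV :: bool set). (if i then - exp (- \<tau>) else 1) * exp (- ((if i then \<tau> else 0) * q))) =
            (LINT t|lborel. gamma_diff b \<tau> t * exp (- (max 0 t * q)))" if q: "q \<ge> 0" for q
          proof -
            have "(LINT i|count_space (UNIV :: bool set). (if i then - exp (- \<tau>) else 1) * exp (- ((if i then \<tau> else 0) * q))) = 1 - exp (- \<tau>) * exp (- (\<tau> * q))"
              by (simp add: lebesgue_integral_count_space_finite UNIV_bool)
            also have "\<dots> = 1 - exp (- (\<tau> * (1 + q)))" unfolding exp_add[symmetric] by (simp add: algebra_simps)
            finally show ?thesis using gamma_difference_laplace[OF b \<tau>(1) q] by (simp add: has_bochner_integral_iff b_def)
          qed
        qed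
        also have "sobolev_const p \<delta> K * (C1 * \<tau> powr (min b 1)) * N powr (real (card S) - (real (card S) - 1) / p) = D * N powr (real (card S) - (real (card S) - 1) / p + min 0 (max \<sigma> (- 2)))"
        proof -
          have "\<tau> powr (min b 1) = B powr (2 * min b 1) * N powr (- (2 * min b 1))"
          proof -
            have "\<tau> powr (min b 1) = (B / N) powr (2 * min b 1)"
              using B(1) N unfolding \<tau>_def by (simp add: powr_numeral[symmetric] powr_powr del: powr_numeral)
            then show ?thesis using B(1) N by (simp add: powr_divide powr_minus_divide)
          qed
          moreover have "- (2 * min b 1) = min 0 (max \<sigma> (- 2))" using 3 by (simp add: b_def min_def max_def)
          ultimately show ?thesis by (simp add: D_def powr_add mult_ac)
        qed
        finally show "Sobolev_norm p \<sigma> (\<lambda>y. of_real (\<Sum>j\<in>J. ?m (y - Y j))) \<le> ennreal (D * N powr (real (card S) - (real (card S) - 1) / p + min 0 (max \<sigma> (- 2))))" .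
      qed
      then show "\<exists>f. tube_bump p \<sigma> S R N Y J \<eta> c D f" by blast
    qed
  qed
qed

lemma powr_comparison:
  fixes e1 e2 c C N0 :: real
  assumes c: "c > 0" and le: "\<And>N. N \<ge> N0 \<Longrightarrow> c * N powr e1 \<le> C * N powr e2"
  shows "e1 \<le> e2"
proof (rule ccontr)
  assume "\<not> e1 \<le> e2"
  then have e: "e1 - e2 > 0" by simp
  \<comment> \<open>Large enough that \<open>x powr (e1 - e2)\<close> exceeds
    \<open>C / c\<close>.\<close>
  define x where "x = max (max N0 1) ((\<bar>C\<bar> / c + 1) powr (1 / (e1 - e2)))"
  have "C / c < \<bar>C\<bar> / c + 1" using divide_right_mono[OF abs_ge_self less_imp_le[OF c], of C] by linarith
  also have "\<dots> = ((\<bar>C\<bar> / c + 1) powr (1 / (e1 - e2))) powr (e1 - e2)"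
    using e c by (simp add: powr_powr add_nonneg_pos)
  also have "\<dots> \<le> x powr (e1 - e2)" using e by (intro powr_mono2) (auto simp: x_def)
  finally have x: "max N0 1 \<le> x" "C / c < x powr (e1 - e2)" by (auto simp: x_def)
  have "x powr e2 * C < x powr e2 * (c * x powr (e1 - e2))"
    using x c by (intro mult_strict_left_mono) (auto simp: pos_divide_less_eq mult.commute)
  also have "\<dots> = c * x powr e1" using x by (simp add: powr_add[symmetric] mult.left_commute)
  also have "\<dots> \<le> C * x powr e2" using x by (intro le) auto
  finally show False by simp
qed

subsection \<open>Measures on curved thin boxes\<close>

definition thin_box :: "'a::euclidean_space set \<Rightarrow> real \<Rightarrow> 'a set" where
  "thin_box T N = {p. \<forall>b\<in>Basis. 0 \<le> p \<bullet> b \<and> p \<bullet> b \<le> (if b \<in> T then 1 / N else 1)}"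

lemma thin_box_cbox: "thin_box T N = cbox 0 (\<Sum>b\<in>Basis. (if b \<in> T then 1 / N else 1) *\<^sub>R b)"
  by (simp add: thin_box_def mem_box set_eq_iff)

lemma thin_box_mono: "N \<ge> 1 \<Longrightarrow> thin_box T N \<subseteq> thin_box T 1"
proof
  fix p :: 'a assume N: "N \<ge> 1" and p: "p \<in> thin_box T N"
  have "1 / N \<le> 1" using N by simp
  then show "p \<in> thin_box T 1" using p unfolding thin_box_def by (auto split: if_splits intro: order_trans)
qed

lemma emeasure_thin_box:
  assumes T: "T \<subseteq> Basis" and N: "N > 0"
  shows "emeasure lborel (thin_box T N :: 'a::euclidean_space set) = ennreal (N powr (- real (card T)))"
proof -
  have "Basis \<inter> {b. b \<in> T} = T" using T by auto
  then have "(\<Prod>b\<in>Basis. if b \<in> T then 1 / N else 1) = N powr (- real (card T))"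
    using N by (simp add: prod.If_cases powr_minus powr_realpow power_divide field_simps)
  then show ?thesis unfolding thin_box_cbox using N
    by (subst emeasure_lborel_cbox) (auto intro!: prod.cong arg_cong[where f = ennreal])
qed

text \<open>The push-forward turns a flat box into a neighbourhood of a possibly curved set. With
  \<open>\<beta>\<close> as in \<open>curved_box_ball_le\<close>, the power of \<open>N\<close>
  compensates the small volume without breaking the ball condition.\<close>

definition curved_box_measure :: "real \<Rightarrow> 'a::euclidean_space set \<Rightarrow> ('a \<Rightarrow> 'a) \<Rightarrow> real \<Rightarrow> 'a measure" where
  "curved_box_measure \<beta> T \<Phi> N = scale_measure (ennreal (N powr (real DIM('a) - \<beta>))) (distr (density lborel (indicator (thin_box T N))) borel \<Phi>)"

lemma sets_curved_box_measure: "sets (curved_box_measure \<beta> T \<Phi> N) = sets borel"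
  by (simp add: curved_box_measure_def)

lemma emeasure_curved_box_measure:
  assumes [measurable]: "\<Phi> \<in> borel_measurable borel" "A \<in> sets borel"
  shows "emeasure (curved_box_measure \<beta> T \<Phi> N) A = ennreal (N powr (real DIM('a) - \<beta>)) * emeasure lborel (thin_box T N \<inter> \<Phi> -` A :: 'a::euclidean_space set)"
proof -
  have [measurable]: "thin_box T N \<in> sets (borel :: 'a measure)" by (simp add: thin_box_cbox)
  have [measurable]: "\<Phi> -` A \<in> sets borel" using measurable_sets[OF assms] by simp
  have "emeasure (distr (density lborel (indicator (thin_box T N))) borel \<Phi>) A = emeasure (density lborel (indicator (thin_box T N))) (\<Phi> -` A)"
    by (subst emeasure_distr) auto
  also have "\<dots> = (\<integral>\<^sup>+ x. indicator (thin_box T N) x * indicator (\<Phi> -` A) x \<partial>lborel)"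
    by (subst emeasure_density) auto
  also have "\<dots> = (\<integral>\<^sup>+ x. indicator (thin_box T N \<inter> \<Phi> -` A) x \<partial>lborel)"
    by (intro nn_integral_cong) (auto simp: indicator_def)
  also have "\<dots> = emeasure lborel (thin_box T N \<inter> \<Phi> -` A)"
    by (subst nn_integral_indicator) auto
  finally show ?thesis by (simp add: curved_box_measure_def)
qed

lemma nn_integral_curved_box_ge:
  fixes \<Phi> :: "'a::euclidean_space \<Rightarrow> 'a"
  assumes \<Phi>: "continuous_on UNIV \<Phi>" and T: "T \<subseteq> Basis" and N: "N > 0"
    and g: "\<And>q. q \<in> thin_box T N \<Longrightarrow> v \<le> g (\<Phi> q)"
  shows "v * ennreal (N powr (real DIM('a) - real (card T) - \<beta>)) \<le> (\<integral>\<^sup>+ x. g x \<partial>curved_box_measure \<beta> T \<Phi> N)"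
proof -
  have [measurable]: "\<Phi> \<in> borel_measurable borel" using \<Phi> by (rule borel_measurable_continuous_onI)
  \<comment> \<open>The image of the box is compact, hence Borel; its indicator times
    \<open>v\<close> is a measurable minorant of the integrand.\<close>
  define E where "E = \<Phi> ` thin_box T N"
  have "compact E" unfolding E_def thin_box_cbox
    by (intro compact_continuous_image continuous_on_subset[OF \<Phi>]) auto
  then have E [measurable]: "E \<in> sets borel" by (rule borel_compact)
  have "thin_box T N \<inter> \<Phi> -` E = thin_box T N" by (auto simp: E_def)
  then have "emeasure (curved_box_measure \<beta> T \<Phi> N) E = ennreal (N powr (real DIM('a) - \<beta>)) * ennreal (N powr (- real (card T)))"
    by (simp add: emeasure_curved_box_measure emeasure_thin_box[OF T N])
  also have "\<dots> = ennreal (N powr (real DIM('a) - real (card T) - \<beta>))"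
    using N by (simp add: ennreal_mult[symmetric] powr_add[symmetric] algebra_simps)
  finally have "v * ennreal (N powr (real DIM('a) - real (card T) - \<beta>)) = (\<integral>\<^sup>+ x. v * indicator E x \<partial>curved_box_measure \<beta> T \<Phi> N)"
    using E sets_curved_box_measure[of \<beta> T \<Phi> N] by (subst nn_integral_cmult_indicator) auto
  also have "\<dots> \<le> (\<integral>\<^sup>+ x. g x \<partial>curved_box_measure \<beta> T \<Phi> N)"
    using g by (intro nn_integral_mono) (auto simp: indicator_def E_def)
  finally show ?thesis .
qed

text \<open>By \<open>expand\<close> the preimage of a ball of radius \<open>\<rho>\<close> lies in
  a cube of side \<open>4 * L * \<rho>\<close>, intersected with the box. For
  \<open>\<rho> \<le> 1/N\<close> the cube counts in all directions, for
  \<open>1/N < \<rho> \<le> 1\<close> only in the long ones, and for \<open>\<rho> > 1\<close> the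
  total mass is at most 1. The inequalities \<open>\<alpha> \<le> \<beta>\<close>,
  \<open>n - card T \<le> \<beta>\<close> and \<open>\<beta> \<le> n\<close> settle these
  cases.\<close>

lemma curved_box_ball_le:
  fixes \<Phi> :: "'a::euclidean_space \<Rightarrow> 'a"
  assumes \<Phi>: "continuous_on UNIV \<Phi>" and T: "T \<subseteq> Basis" and N: "N \<ge> 1" and L: "L \<ge> 1"
    and expand: "\<And>p q b. p \<in> thin_box T 1 \<Longrightarrow> q \<in> thin_box T 1 \<Longrightarrow> b \<in> Basis \<Longrightarrow> \<bar>(p - q) \<bullet> b\<bar> \<le> L * norm (\<Phi> p - \<Phi> q)"
    and \<alpha>: "0 < \<alpha>" "\<alpha> \<le> real DIM('a)" and \<beta>: "\<beta> = max \<alpha> (real DIM('a) - real (card T))" and \<rho>: "\<rho> > 0"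
  shows "emeasure (curved_box_measure \<beta> T \<Phi> N) (ball z \<rho>) \<le> ennreal ((4 * L) ^ DIM('a) * \<rho> powr \<alpha>)"
proof -
  have [measurable]: "\<Phi> \<in> borel_measurable borel" using \<Phi> by (rule borel_measurable_continuous_onI)
  define A where "A = thin_box T N \<inter> \<Phi> -` ball z \<rho>"
  define side where "side b = (if b \<in> T then 1 / N else 1)" for b
  define n where "n = DIM('a)"
  define r where "r = real n - real (card T)"
  have side: "0 < side b" "side b \<le> 1" for b using N by (auto simp: side_def)
  have cT: "card T \<le> n" unfolding n_def by (rule card_mono[OF finite_Basis T])
  have r0: "r \<ge> 0" using cT by (simp add: r_def)
  define P where "P = (\<Prod>b\<in>(Basis::'a set). min (4 * L * \<rho>) (side b))"
  have A: "emeasure lborel A \<le> ennreal P"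
  proof (cases "A = {}")
    case False
    then obtain p0 where p0: "p0 \<in> A" by auto
    define l where "l = (\<Sum>b\<in>Basis. max 0 (p0 \<bullet> b - 2 * L * \<rho>) *\<^sub>R b)"
    define u where "u = (\<Sum>b\<in>Basis. min (side b) (p0 \<bullet> b + 2 * L * \<rho>) *\<^sub>R b)"
    have [simp]: "l \<bullet> b = max 0 (p0 \<bullet> b - 2 * L * \<rho>)" "u \<bullet> b = min (side b) (p0 \<bullet> b + 2 * L * \<rho>)" if "b \<in> Basis" for b
      using that by (simp_all add: l_def u_def)
    have "A \<subseteq> cbox l u"
    proof
      fix q assume q: "q \<in> A"
      have "norm (\<Phi> q - \<Phi> p0) \<le> 2 * \<rho>"
        using q p0 dist_triangle2[of "\<Phi> q" "\<Phi> p0" z] by (simp add: A_def dist_norm norm_minus_commute)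
      then have "L * norm (\<Phi> q - \<Phi> p0) \<le> L * (2 * \<rho>)" using L by (intro mult_left_mono) auto
      then have "\<bar>(q - p0) \<bullet> b\<bar> \<le> 2 * L * \<rho>" if "b \<in> Basis" for b
      proof -
        have "q \<in> thin_box T 1" "p0 \<in> thin_box T 1" using q p0 thin_box_mono[OF N, of T] by (auto simp: A_def)
        from expand[OF this that] \<open>L * norm (\<Phi> q - \<Phi> p0) \<le> L * (2 * \<rho>)\<close> show ?thesis by simp
      qed
      then have "\<bar>q \<bullet> b - p0 \<bullet> b\<bar> \<le> 2 * L * \<rho>" if "b \<in> Basis" for b using that by (simp add: inner_diff_left)
      then show "q \<in> cbox l u" using q by (fastforce simp: mem_box A_def thin_box_def side_def[symmetric] abs_le_iff)
    qed
    then have "emeasure lborel A \<le> emeasure lborel (cbox l u)" by (intro emeasure_mono) auto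
    also have "\<dots> = ennreal (\<Prod>b\<in>Basis. (u - l) \<bullet> b)"
    proof (rule emeasure_lborel_cbox)
      show "l \<bullet> b \<le> u \<bullet> b" if "b \<in> Basis" for b
      proof -
        have "0 \<le> p0 \<bullet> b" "p0 \<bullet> b \<le> side b" using that p0 by (auto simp: A_def thin_box_def side_def)
        moreover have "2 * L * \<rho> \<ge> 0" using L \<rho> by simp
        ultimately show ?thesis using that side[of b] by simp
      qed
    qed
    also have "\<dots> \<le> ennreal P"
      unfolding P_def
    proof (intro ennreal_leI prod_mono conjI)
      fix b :: 'a assume b: "b \<in> Basis"
      have m: "2 * L * \<rho> \<ge> 0" using L \<rho> by simp
      show "0 \<le> (u - l) \<bullet> b" using b p0 m side[of b] by (auto simp: inner_diff_left A_def thin_box_def side_def[symmetric])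
      show "(u - l) \<bullet> b \<le> min (4 * L * \<rho>) (side b)" using b m by (auto simp: inner_diff_left min_def max_def)
    qed
    finally show ?thesis .
  qed simp
  have P0: "P \<ge> 0" unfolding P_def using L \<rho> side by (intro prod_nonneg) (auto simp: less_imp_le)
  have main: "N powr (real n - \<beta>) * P \<le> (4 * L) ^ n * \<rho> powr \<alpha>"
  proof -
    have L4: "4 * L \<ge> 1" using L by simp
    have L4n: "(4 * L) ^ n \<ge> 1" using L4 by (rule one_le_power)
    have \<beta>': "\<beta> \<le> n" "\<alpha> \<le> \<beta>" "r \<le> \<beta>" using \<alpha> \<beta> cT by (auto simp: n_def r_def)
    have BT: "Basis \<inter> T = T" "Basis \<inter> - T = Basis - T" using T by auto
    have cBT: "card (Basis - T) = n - card T" unfolding n_def using T by (simp add: card_Diff_subset finite_subset)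
    have NT: "N powr (real n - \<beta>) * (1 / N) ^ card T = N powr (r - \<beta>)"
      using N by (simp add: r_def powr_diff powr_add powr_realpow power_divide field_simps)
    consider "\<rho> \<le> 1 / N" | "1 / N < \<rho>" "\<rho> \<le> 1" | "\<rho> > 1" by linarith
    then show ?thesis
    proof cases
      case 1
      have \<rho>1: "\<rho> \<le> 1" using 1 N by (meson divide_le_eq_1 less_le_trans order_trans zero_less_one)
      have "P \<le> (\<Prod>b\<in>(Basis::'a set). 4 * L * \<rho>)"
        unfolding P_def using L \<rho> side by (intro prod_mono) (auto simp: less_imp_le)
      also have "\<dots> = (4 * L) ^ n * \<rho> powr n" using \<rho> by (simp add: n_def power_mult_distrib powr_realpow)
      finally have P_le: "P \<le> (4 * L) ^ n * \<rho> powr n" .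
      have "N powr (real n - \<beta>) \<le> (1 / \<rho>) powr (real n - \<beta>)"
        using 1 N \<rho> \<beta>' by (intro powr_mono2) (auto simp: field_simps)
      also have "\<dots> = \<rho> powr (\<beta> - real n)" using \<rho> by (simp add: powr_divide powr_diff)
      finally have "N powr (real n - \<beta>) * P \<le> \<rho> powr (\<beta> - real n) * ((4 * L) ^ n * \<rho> powr n)"
        using P_le P0 by (intro mult_mono) auto
      also have "\<dots> = (4 * L) ^ n * \<rho> powr \<beta>" using \<rho> by (simp add: powr_diff)
      also have "\<dots> \<le> (4 * L) ^ n * \<rho> powr \<alpha>" using \<rho> \<rho>1 \<beta>' L4n by (intro mult_left_mono powr_mono') auto
      finally show ?thesis .
    next
      case 2
      have "P \<le> (\<Prod>b\<in>(Basis::'a set). if b \<in> T then 1 / N else 4 * L * \<rho>)"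
        unfolding P_def using L \<rho> side by (intro prod_mono) (auto simp: side_def less_imp_le)
      also have "\<dots> = (1 / N) ^ card T * (4 * L * \<rho>) ^ (n - card T)" by (simp add: prod.If_cases BT cBT)
      also have "(4 * L * \<rho>) ^ (n - card T) = (4 * L) ^ (n - card T) * \<rho> powr r"
        using \<rho> cT by (simp add: power_mult_distrib r_def powr_realpow[symmetric] of_nat_diff)
      also have "(1 / N) ^ card T * ((4 * L) ^ (n - card T) * \<rho> powr r) \<le> (1 / N) ^ card T * ((4 * L) ^ n * \<rho> powr r)"
        using L4 N by (intro mult_left_mono mult_right_mono power_increasing) auto
      finally have "N powr (real n - \<beta>) * P \<le> N powr (real n - \<beta>) * ((1 / N) ^ card T * ((4 * L) ^ n * \<rho> powr r))"
        by (intro mult_left_mono) auto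
      also have "\<dots> = (4 * L) ^ n * (N powr (r - \<beta>) * \<rho> powr r)"
        unfolding NT[symmetric] by (simp only: mult_ac)
      finally have P_le: "N powr (real n - \<beta>) * P \<le> (4 * L) ^ n * (N powr (r - \<beta>) * \<rho> powr r)" .
      have "N powr (r - \<beta>) \<le> \<rho> powr (\<beta> - r)"
      proof -
        have "N powr (r - \<beta>) = (1 / N) powr (\<beta> - r)" using N by (simp add: powr_divide powr_diff)
        also have "\<dots> \<le> \<rho> powr (\<beta> - r)" using 2 N \<beta>' by (intro powr_mono2) auto
        finally show ?thesis .
      qed
      then have "N powr (r - \<beta>) * \<rho> powr r \<le> \<rho> powr (\<beta> - r) * \<rho> powr r" by (intro mult_right_mono) auto
      also have "\<rho> powr (\<beta> - r) * \<rho> powr r = \<rho> powr \<beta>" by (simp add: powr_add[symmetric])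
      also have "\<rho> powr \<beta> \<le> \<rho> powr \<alpha>" using \<rho> 2 \<beta>' by (intro powr_mono') auto
      finally have "(4 * L) ^ n * (N powr (r - \<beta>) * \<rho> powr r) \<le> (4 * L) ^ n * \<rho> powr \<alpha>"
        using L4n by (intro mult_left_mono) auto
      then show ?thesis using P_le by linarith
    next
      case 3
      have "P \<le> (\<Prod>b\<in>(Basis::'a set). if b \<in> T then 1 / N else 1)"
        unfolding P_def using L \<rho> side by (intro prod_mono) (auto simp: side_def less_imp_le)
      also have "\<dots> = (1 / N) ^ card T" by (simp add: prod.If_cases BT)
      finally have "N powr (real n - \<beta>) * P \<le> N powr (real n - \<beta>) * (1 / N) ^ card T"
        by (intro mult_left_mono) auto
      also have "\<dots> = N powr (r - \<beta>)" by (rule NT)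
      also have "\<dots> \<le> N powr 0" using N \<beta>' by (intro powr_mono) auto
      also have "\<dots> \<le> 1 * \<rho> powr \<alpha>" using 3 N \<alpha> by (simp add: ge_one_powr_ge_zero)
      also have "\<dots> \<le> (4 * L) ^ n * \<rho> powr \<alpha>" using L4n by (intro mult_right_mono) auto
      finally show ?thesis .
    qed
  qed
  have "emeasure (curved_box_measure \<beta> T \<Phi> N) (ball z \<rho>) = ennreal (N powr (real n - \<beta>)) * emeasure lborel A"
    by (subst emeasure_curved_box_measure) (auto simp: A_def n_def)
  also have "\<dots> \<le> ennreal (N powr (real n - \<beta>)) * ennreal P"
    by (intro mult_left_mono A) auto
  also have "\<dots> = ennreal (N powr (real n - \<beta>) * P)"
    using P0 by (intro ennreal_mult[symmetric]) auto
  also have "\<dots> \<le> ennreal ((4 * L) ^ DIM('a) * \<rho> powr \<alpha>)" using main unfolding n_def by (rule ennreal_leI)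
  finally show ?thesis .
qed

lemma
  fixes \<mu> :: "'a::euclidean_space measure"
  assumes "sets \<mu> = sets borel" and le: "\<And>z \<rho>. \<rho> > 0 \<Longrightarrow> emeasure \<mu> (ball z \<rho>) \<le> ennreal (C * \<rho> powr \<alpha>)" and C: "C \<ge> 0"
  shows frostmanI: "\<mu> \<in> frostman \<alpha>" and frostman_const_le: "frostman_const \<alpha> \<mu> \<le> ennreal C"
proof -
  show "\<mu> \<in> frostman \<alpha>" unfolding frostman_def using assms by blast
  show "frostman_const \<alpha> \<mu> \<le> ennreal C"
    unfolding frostman_const_def
  proof (intro SUP_least)
    fix z :: 'a and \<rho> :: real assume \<rho>: "\<rho> \<in> {0<..}"
    have "ennreal (\<rho> powr (- \<alpha>)) * emeasure \<mu> (ball z \<rho>) \<le> ennreal (\<rho> powr (- \<alpha>)) * ennreal (C * \<rho> powr \<alpha>)"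
      using \<rho> by (intro mult_left_mono le) auto
    also have "\<dots> = ennreal C" using \<rho> C by (simp add: ennreal_mult[symmetric] powr_minus field_simps)
    finally show "ennreal (\<rho> powr (- \<alpha>)) * emeasure \<mu> (ball z \<rho>) \<le> ennreal C" .
  qed
qed

lemma ennpowr_ge:
  assumes "ennreal c \<le> x" "c \<ge> 0" "a \<ge> 0"
  shows "ennreal (c powr a) \<le> ennpowr x a"
proof (cases "x = \<infinity>")
  case False
  then have "c \<le> enn2real x" using assms(1,2) by (metis enn2real_ennreal enn2real_mono infinity_ennreal_def top.not_eq_extremum)
  then show ?thesis using False assms by (auto simp: ennpowr_def intro!: ennreal_leI powr_mono2)
qed (simp add: ennpowr_def)

subsection \<open>The necessary condition\<close>

text \<open>On \<open>{s0..s1}\<close> the function is at least \<open>a\<close> along the curve,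
  and elsewhere at least \<open>- b\<close>. Subtracting \<open>b\<close> times the whole integral
  of \<open>\<psi>\<close> covers both, and the average is real, so its norm dominates it.\<close>

lemma averaging_lower:
  fixes F :: "real ^ 'd::finite \<Rightarrow> real" and \<omega> :: "'d \<Rightarrow> 'm::finite"
  assumes F: "continuous_on UNIV F" and \<gamma>: "continuous_on {0..1} \<gamma>" and \<psi>: "continuous_on {0..1} \<psi>"
    and \<psi>0: "\<And>s. \<psi> s \<ge> 0" and s: "0 \<le> s0" "s0 \<le> s1" "s1 \<le> 1" and \<psi>1: "\<And>s. s \<in> {s0..s1} \<Longrightarrow> \<psi> s = 1"
    and \<chi>: "\<And>j. \<chi>0 (t $ j) = 1" and b: "b \<ge> 0"
    and Fa: "\<And>s. s \<in> {s0..s1} \<Longrightarrow> a \<le> F (x + scaled_curve \<omega> \<gamma> t s)" and Fb: "\<And>y. - b \<le> F y"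
  shows "a * (s1 - s0) - b * (LINT s:{0..1}|lborel. \<psi> s) \<le> norm (averaging \<chi>0 \<psi> \<omega> \<gamma> (\<lambda>y. of_real (F y)) (x, t))"
proof -
  define G where "G s = F (x + scaled_curve \<omega> \<gamma> t s)" for s
  have G: "continuous_on {0..1} G"
    unfolding G_def scaled_curve_def
    by (rule continuous_on_compose2[OF F]) (auto intro!: continuous_intros continuous_on_vec_lambda \<gamma>)
  have I1: "set_integrable lborel {0..1} (\<lambda>s. G s * \<psi> s)" and I2: "set_integrable lborel {0..1} \<psi>"
    by (intro borel_integrable_atLeastAtMost' continuous_on_mult G \<psi>)+
  have J: "integrable lborel (\<lambda>s. a * indicator {s0..s1} s - b * (indicator {0..1} s *\<^sub>R \<psi> s))"
    using I2 s unfolding set_integrable_def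
    by (intro Bochner_Integration.integrable_diff integrable_mult_right integrable_real_indicator) auto
  have "a * (s1 - s0) - b * (LINT s:{0..1}|lborel. \<psi> s) = (LINT s|lborel. a * indicator {s0..s1} s - b * (indicator {0..1} s *\<^sub>R \<psi> s))"
    using I2 s by (subst Bochner_Integration.integral_diff) (auto simp: set_integrable_def set_lebesgue_integral_def)
  also have "\<dots> \<le> (LINT s|lborel. indicator {0..1} s *\<^sub>R (G s * \<psi> s))"
  proof (rule integral_mono[OF J])
    show "integrable lborel (\<lambda>s. indicator {0..1} s *\<^sub>R (G s * \<psi> s))" using I1 by (simp add: set_integrable_def)
    fix r
    show "a * indicator {s0..s1} r - b * (indicator {0..1} r *\<^sub>R \<psi> r) \<le> indicator {0..1} r *\<^sub>R (G r * \<psi> r)"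
    proof (cases "r \<in> {s0..s1}")
      case True
      then show ?thesis using Fa[OF True] \<psi>1[OF True] s b by (auto simp: G_def)
    next
      case False
      have "- b * \<psi> r \<le> G r * \<psi> r" unfolding G_def by (intro mult_right_mono Fb \<psi>0)
      then show ?thesis using False by (auto simp: indicator_def)
    qed
  qed
  also have "\<dots> = (LINT s:{0..1}|lborel. G s * \<psi> s)" by (simp add: set_lebesgue_integral_def)
  also have "\<dots> \<le> norm (averaging \<chi>0 \<psi> \<omega> \<gamma> (\<lambda>y. of_real (F y)) (x, t))"
  proof -
    have "averaging \<chi>0 \<psi> \<omega> \<gamma> (\<lambda>y. of_real (F y)) (x, t) = (CLINT s:{0..1}|lborel. of_real (G s * \<psi> s))"
      by (simp add: averaging_def \<chi> G_def)
    also have "\<dots> = of_real (LINT s:{0..1}|lborel. G s * \<psi> s)" by (rule set_integral_complex_of_real)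
    finally show ?thesis by (simp only: norm_of_real abs_ge_self)
  qed
  finally show ?thesis .
qed

text \<open>Parametrizes dilations in \<open>[1, 2]\<close> so that coordinate \<open>j0\<close> measures the distance to the graph of \<open>h\<close>.\<close>

definition shear :: "'m \<Rightarrow> (real ^ 'm \<Rightarrow> real) \<Rightarrow> real \<Rightarrow> real ^ 'm \<Rightarrow> real ^ 'm::finite" where
  "shear j0 h e \<tau> = (\<chi> j. if j = j0 then h \<tau> + \<tau> $ j else 1 + e * \<tau> $ j)"

text \<open>The directions of length \<open>1 / N\<close>: the spatial coordinates in
  \<open>S\<close> and the one parameter transversal to the graph in \<open>shear\<close>.\<close>

definition thin_directions :: "'d set \<Rightarrow> 'm \<Rightarrow> ((real ^ 'd::finite) \<times> (real ^ 'm::finite)) set" where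
  "thin_directions S j0 = insert (0, axis j0 1) ((\<lambda>i. (axis i 1, 0)) ` S)"

lemma thin_directions_Basis: "thin_directions S j0 \<subseteq> Basis"
  by (auto simp: thin_directions_def Basis_prod_def Basis_vec_def)

lemma card_thin_directions:
  fixes S :: "'d::finite set" and j0 :: "'m::finite"
  shows "card (thin_directions S j0) = card S + 1"
proof -
  have "inj_on (\<lambda>i. (axis i (1::real), 0 :: real ^ 'm)) S" by (auto simp: inj_on_def axis_eq_axis)
  moreover have "(0, axis j0 1) \<notin> (\<lambda>i. (axis i (1::real), 0 :: real ^ 'm)) ` S" by auto
  ultimately show ?thesis unfolding thin_directions_def by (simp add: card_image)
qed

lemma ball_Basis_vec_prod:
  "(\<forall>b\<in>(Basis :: ((real ^ 'd::finite) \<times> (real ^ 'm::finite)) set). P b) \<longleftrightarrow> (\<forall>i. P (axis i 1, 0)) \<and> (\<forall>j. P (0, axis j 1))"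
  by (simp add: Basis_prod_def Basis_vec_def ball_Un)

lemma thin_box_vec:
  "(x, \<tau>) \<in> thin_box (thin_directions S j0) N \<longleftrightarrow>
    (\<forall>i. 0 \<le> x $ i \<and> x $ i \<le> (if i \<in> S then 1 / N else 1)) \<and> (\<forall>j. 0 \<le> \<tau> $ j \<and> \<tau> $ j \<le> (if j = j0 then 1 / N else 1))"
proof -
  have d: "(axis i 1, 0) \<in> thin_directions S j0 \<longleftrightarrow> i \<in> S" for i
    by (auto simp: thin_directions_def axis_eq_axis)
  have m: "(0, axis j 1) \<in> thin_directions S j0 \<longleftrightarrow> j = j0" for j
    by (auto simp: thin_directions_def axis_eq_axis)
  show ?thesis
    unfolding thin_box_def mem_Collect_eq ball_Basis_vec_prod by (simp add: inner_axis d m)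
qed

lemma norm_prod_components_ge:
  fixes x :: "real ^ 'd::finite" and t :: "real ^ 'm::finite"
  shows "\<bar>x $ i\<bar> \<le> norm (x, t)" "\<bar>t $ j\<bar> \<le> norm (x, t)"
  using component_le_norm_cart[of x i] component_le_norm_cart[of t j] norm_fst_le[of x t] norm_snd_le[of t x] by linarith+

text \<open>The common core of both parts. Parameters in a \<open>1 / N\<close> neighbourhood of the
  graph of \<open>h\<close> dilate the curve into an \<open>O(1 / N)\<close> neighbourhood of the
  fixed curve \<open>\<Gamma>\<close> (\<open>near\<close>). The coordinate \<open>i1\<close> of
  \<open>\<Gamma>\<close> is expanding, which separates the centres; the Lipschitz bounds make a
  discrete set of centres sufficient. The sum in \<open>h_lip\<close> omits \<open>js\<close>, so on
  the unit cube \<open>h\<close> does not depend on that coordinate and the shear can be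
  inverted.\<close>

lemma necessary_condition:
  fixes \<omega> :: "'d::finite \<Rightarrow> 'm::finite" and \<gamma> :: "real \<Rightarrow> real ^ 'd" and S :: "'d set" and h :: "real ^ 'm \<Rightarrow> real"
    and \<Gamma> :: "'d \<Rightarrow> real \<Rightarrow> real" and e \<alpha> p \<sigma> :: real
  assumes \<gamma>: "continuous_on {0..1} \<gamma>" and \<psi>: "continuous_on {0..1} \<psi>"
    and \<psi>0: "\<And>s. \<psi> s \<ge> 0" and s: "0 \<le> s0" "s0 < s1" "s1 \<le> 1" and \<psi>1: "\<And>s. s \<in> {s0..s1} \<Longrightarrow> \<psi> s = 1"
    and \<chi>: "\<And>t. t \<in> {1..2} \<Longrightarrow> \<chi>0 t = 1"
    and S: "i1 \<in> S" "2 \<le> card S"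
    and h: "continuous_on UNIV h" "\<And>\<tau>. (\<And>j. \<tau> $ j \<in> {0..1}) \<Longrightarrow> h \<tau> \<in> {1..3/2}"
    and h_lip: "\<And>\<tau> \<tau>'. (\<And>j. \<tau> $ j \<in> {0..1}) \<Longrightarrow> (\<And>j. \<tau>' $ j \<in> {0..1}) \<Longrightarrow> \<bar>h \<tau> - h \<tau>'\<bar> \<le> Lh * (\<Sum>j\<in>UNIV - {js}. \<bar>\<tau> $ j - \<tau>' $ j\<bar>)"
    and Lh: "Lh \<ge> 0" and e: "0 < e" "e \<le> 1"
    and \<Gamma>: "A \<le> A'" "\<delta> > 0" "LG \<ge> 0"
      "\<And>i z z'. i \<in> S \<Longrightarrow> z \<in> {A..A'} \<Longrightarrow> z' \<in> {A..A'} \<Longrightarrow> \<bar>\<Gamma> i z - \<Gamma> i z'\<bar> \<le> LG * \<bar>z - z'\<bar>"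
      "\<And>z z'. z \<in> {A..A'} \<Longrightarrow> z' \<in> {A..A'} \<Longrightarrow> \<delta> * \<bar>z - z'\<bar> \<le> \<bar>\<Gamma> i1 z - \<Gamma> i1 z'\<bar>"
    and Cn: "Cn \<ge> 0"
    and near: "\<And>N \<tau> s. N \<ge> 2 \<Longrightarrow> (\<And>j. 0 \<le> \<tau> $ j \<and> \<tau> $ j \<le> (if j = js then 1 / N else 1)) \<Longrightarrow> s \<in> {s0..s1} \<Longrightarrow>
      \<exists>z\<in>{A..A'}. \<forall>i\<in>S. \<bar>shear js h e \<tau> $ \<omega> i * \<gamma> s $ i - \<Gamma> i z\<bar> \<le> Cn / N"
    and n: "n = real CARD('d) + real CARD('m)" and \<alpha>: "0 < \<alpha>" "\<alpha> \<le> n" and p: "1 < p"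
    and C: "C \<ge> 0" and estimate: "\<And>\<mu> f. \<mu> \<in> frostman \<alpha> \<Longrightarrow> schwartz f \<Longrightarrow>
         Lp_norm p (\<mu> :: ((real ^ 'd) \<times> (real ^ 'm)) measure) (averaging \<chi>0 \<psi> \<omega> \<gamma> f)
           \<le> ennreal C * ennpowr (frostman_const \<alpha> \<mu>) (1 / p) * Sobolev_norm p \<sigma> f"
  shows "\<sigma> \<ge> (real (card S) - 1 + (n - real (card S) - 1) - max \<alpha> (n - real (card S) - 1)) / p"
proof -
  define r where "r = n - real (card S) - 1"
  define \<beta> where "\<beta> = max \<alpha> r"
  define k where "k = real (card S)"
  define V where "V = thin_directions S js"
  define \<Phi> where "\<Phi> q = (fst q, shear js h e (snd q))" for q :: "(real ^ 'd) \<times> (real ^ 'm)"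
  have dim: "real DIM((real ^ 'd) \<times> (real ^ 'm)) = n" by (simp add: n)
  have V: "V \<subseteq> Basis" "real (card V) = k + 1" unfolding V_def k_def by (simp_all add: thin_directions_Basis card_thin_directions)
  have \<beta>_dim: "\<beta> = max \<alpha> (real DIM((real ^ 'd) \<times> (real ^ 'm)) - real (card V))" unfolding \<beta>_def r_def dim V(2) k_def by simp
  have \<Phi>: "continuous_on UNIV \<Phi>"
    unfolding \<Phi>_def shear_def
  proof (intro continuous_on_Pair continuous_on_fst continuous_on_id continuous_on_vec_lambda)
    show "continuous_on UNIV (\<lambda>q :: (real ^ 'd) \<times> (real ^ 'm). if j = js then h (snd q) + snd q $ j else 1 + e * snd q $ j)" for j
      by (cases "j = js") (auto intro!: continuous_intros continuous_on_compose2[OF h(1)])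
  qed
  \<comment> \<open>Bound for the inverse of the shear: a coordinate other than \<open>js\<close>
    costs \<open>1 / e\<close>, and subtracting \<open>h\<close> costs its Lipschitz constant over
    those coordinates.\<close>
  define L where "L = 1 + 1 / e + Lh * real CARD('m) / e"
  have L: "L \<ge> 1" unfolding L_def using e Lh by simp
  have expand: "\<bar>(q - q') \<bullet> b\<bar> \<le> L * norm (\<Phi> q - \<Phi> q')"
    if q: "q \<in> thin_box V 1" "q' \<in> thin_box V 1" and b: "b \<in> Basis" for q q' b
  proof -
    obtain x \<tau> x' \<tau>' where xt: "q = (x, \<tau>)" "q' = (x', \<tau>')" by (cases q, cases q') auto
    have box: "\<tau> $ j \<in> {0..1}" "\<tau>' $ j \<in> {0..1}" for j
      using q unfolding xt V_def thin_box_vec by (auto split: if_splits)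
    define D where "D = norm (\<Phi> q - \<Phi> q')"
    have D: "D \<ge> 0" by (simp add: D_def)
    have x: "\<bar>(x - x') $ i\<bar> \<le> D" for i
      unfolding D_def \<Phi>_def xt using norm_prod_components_ge(1)[of "x - x'" i] by simp
    have t: "\<bar>shear js h e \<tau> $ j - shear js h e \<tau>' $ j\<bar> \<le> D" for j
      unfolding D_def \<Phi>_def xt using norm_prod_components_ge(2)[of "shear js h e \<tau> - shear js h e \<tau>'" j "x - x'"] by simp
    have t1: "\<bar>\<tau> $ j - \<tau>' $ j\<bar> \<le> D / e" if "j \<noteq> js" for j
    proof -
      have "e * \<bar>\<tau> $ j - \<tau>' $ j\<bar> = \<bar>shear js h e \<tau> $ j - shear js h e \<tau>' $ j\<bar>"
        using that e by (simp add: shear_def abs_mult right_diff_distrib[symmetric])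
      then show ?thesis using t[of j] e by (simp add: field_simps)
    qed
    have "\<bar>h \<tau> - h \<tau>'\<bar> \<le> Lh * (\<Sum>j\<in>UNIV - {js}. \<bar>\<tau> $ j - \<tau>' $ j\<bar>)" by (intro h_lip box)
    also have "\<dots> \<le> Lh * (\<Sum>j\<in>UNIV - {js}. D / e)" using t1 Lh by (intro mult_left_mono sum_mono) auto
    also have "\<dots> \<le> Lh * (real CARD('m) * (D / e))"
    proof -
      have "card (UNIV - {js}) \<le> CARD('m)" by (rule card_mono) auto
      then show ?thesis using Lh D e by (auto intro!: mult_left_mono divide_right_mono mult_right_mono)
    qed
    finally have hd: "\<bar>h \<tau> - h \<tau>'\<bar> \<le> Lh * real CARD('m) / e * D" by simp
    have t0: "\<bar>\<tau> $ js - \<tau>' $ js\<bar> \<le> D + Lh * real CARD('m) / e * D"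
      using t[of js] hd by (simp add: shear_def)
    have LD: "L * D = D + D / e + Lh * real CARD('m) / e * D" by (simp add: L_def algebra_simps)
    have nn: "D / e \<ge> 0" "Lh * real CARD('m) / e * D \<ge> 0" using D e Lh by auto
    have "\<bar>\<tau> $ j - \<tau>' $ j\<bar> \<le> L * D" for j using t0 t1[of j] nn D LD by (cases "j = js") auto
    moreover have "\<bar>(x - x') $ i\<bar> \<le> L * D" for i using x[of i] nn LD by linarith
    ultimately have "\<forall>b\<in>Basis. \<bar>(q - q') \<bullet> b\<bar> \<le> L * D"
      unfolding ball_Basis_vec_prod xt by (simp add: inner_axis)
    then show ?thesis using b unfolding D_def by blast
  qed
  define \<mu> where "\<mu> N = curved_box_measure \<beta> V \<Phi> N" for N
  define M where "M = (4 * L) ^ DIM((real ^ 'd) \<times> (real ^ 'm))"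
  have M: "M \<ge> 0" unfolding M_def using L by simp
  have \<mu>: "\<mu> N \<in> frostman \<alpha>" "frostman_const \<alpha> (\<mu> N) \<le> ennreal M" if "N \<ge> 1" for N
  proof -
    have "emeasure (\<mu> N) (ball z \<rho>) \<le> ennreal (M * \<rho> powr \<alpha>)" if "\<rho> > 0" for z \<rho>
      unfolding \<mu>_def M_def
      using \<alpha> dim by (intro curved_box_ball_le[OF \<Phi> V(1) \<open>N \<ge> 1\<close> L expand _ _ \<beta>_dim that]) auto
    moreover have "sets (\<mu> N) = sets borel" unfolding \<mu>_def by (rule sets_curved_box_measure)
    ultimately show "\<mu> N \<in> frostman \<alpha>" "frostman_const \<alpha> (\<mu> N) \<le> ennreal M"
      using frostmanI frostman_const_le M by blast+
  qed
  obtain G where G: "\<And>s i. s \<in> {0..1} \<Longrightarrow> \<bar>\<gamma> s $ i\<bar> \<le> G"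
  proof -
    have "compact (\<gamma> ` {0..1})" by (intro compact_continuous_image \<gamma>) auto
    then have "bounded (\<gamma> ` {0..1})" by (rule compact_imp_bounded)
    then obtain G where "\<forall>x\<in>{0..1}. norm (\<gamma> x) \<le> G" unfolding bounded_iff by blast
    then show ?thesis using that[of G] component_le_norm_cart order_trans by blast
  qed
  have G0: "G \<ge> 0" using G[of 0] by (meson abs_ge_zero atLeastAtMost_iff order_refl order_trans zero_le_one)
  \<comment> \<open>Collects the errors in units of the tube size: the box in \<open>x\<close>, the
    distance to \<open>\<Gamma>\<close>, the discretization of \<open>\<Gamma>\<close>, and outside
    \<open>S\<close> the size of the curve dilated by at most 2.\<close>
  define R where "R = 1 + Cn + LG + 2 * G"
  have R: "R \<ge> 0" using Cn \<Gamma>(3) G0 by (simp add: R_def)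
  define I where "I = (LINT s:{0..1}|lborel. \<psi> s)"
  have I: "I \<ge> 0" unfolding I_def set_lebesgue_integral_def using \<psi>0 by (intro integral_nonneg_AE AE_I2) auto
  \<comment> \<open>Small enough that the negative part of the test function destroys at most half
    of the average.\<close>
  define \<eta> where "\<eta> = (s1 - s0) / (2 * (1 + I))"
  have \<eta>: "\<eta> > 0" "\<eta> * I \<le> (s1 - s0) / 2"
  proof -
    show "\<eta> > 0" using s I by (simp add: \<eta>_def)
    have "\<eta> * I \<le> \<eta> * (1 + I)" using \<open>\<eta> > 0\<close> by simp
    also have "\<dots> = (s1 - s0) / 2" using I by (simp add: \<eta>_def field_simps)
    finally show "\<eta> * I \<le> (s1 - s0) / 2" .
  qed
  define K where "K = A' - A + 1"
  have K: "K > 0" using \<Gamma>(1) by (simp add: K_def)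
  define S' where "S' = (\<lambda>i. axis i (1::real)) ` S"
  have S': "S' \<subseteq> Basis" "axis i1 1 \<in> S'" "2 \<le> card S'" "real (card S') = k"
    using S by (auto simp: S'_def Basis_vec_def card_image inj_on_def axis_eq_axis k_def)
  obtain c D N0 where c: "c > 0" and D: "D > 0" and N0: "N0 \<ge> 1"
    and test: "\<And>N J (Y :: nat \<Rightarrow> real ^ 'd). N \<ge> N0 \<Longrightarrow> finite J \<Longrightarrow> real (card J) \<le> K * N \<Longrightarrow>
      (\<And>i j. i \<in> J \<Longrightarrow> j \<in> J \<Longrightarrow> i \<noteq> j \<Longrightarrow> \<delta> / N \<le> \<bar>(Y i - Y j) \<bullet> axis i1 1\<bar>) \<Longrightarrow>
      \<exists>f. tube_bump p \<sigma> S' R N Y J \<eta> c D f"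
    by (rule test_functions[OF S'(1-3) p \<Gamma>(2) K R \<eta>(1), of \<sigma>]) blast
  define c' where "c' = c * (s1 - s0) / 2"
  have c': "c' > 0" unfolding c'_def using c s by simp
  have main: "c' * N powr (k - max \<sigma> 0 + (r - \<beta>) / p) \<le> (C * M powr (1 / p) * D) * N powr (k - (k - 1) / p + min 0 (max \<sigma> (- 2)))"
    if N2: "N \<ge> max N0 2" for N
  proof -
    have N: "N \<ge> 1" "N \<ge> 2" "N \<ge> N0" "N > 0" using N2 by auto
    \<comment> \<open>A grid of mesh \<open>1 / N\<close> in the parameter interval of
      \<open>\<Gamma>\<close>; it has at most \<open>K * N\<close> points.\<close>
    define J where "J = {0..nat \<lfloor>(A' - A) * N\<rfloor>}"
    define z where "z j = A + real j / N" for j :: nat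
    define Y where "Y j = (\<chi> i. if i \<in> S then \<Gamma> i (z j) else 0)" for j
    have AL: "(A' - A) * N \<ge> 0" using \<Gamma>(1) N by simp
    have zJ: "z j \<in> {A..A'}" if "j \<in> J" for j
    proof -
      have "real j \<le> (A' - A) * N" using that AL unfolding J_def by (simp add: le_nat_floor) linarith
      then show ?thesis using N by (simp add: z_def field_simps)
    qed
    have J: "finite J" "real (card J) \<le> K * N"
    proof -
      have "real (card J) \<le> (A' - A) * N + 1" using AL by (simp add: J_def)
      also have "\<dots> \<le> K * N" using N by (simp add: K_def algebra_simps)
      finally show "real (card J) \<le> K * N" .
    qed (simp add: J_def)
    have sep: "\<delta> / N \<le> \<bar>(Y i - Y j) \<bullet> axis i1 1\<bar>" if ij: "i \<in> J" "j \<in> J" "i \<noteq> j" for i j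
    proof -
      have "1 \<le> \<bar>real i - real j\<bar>" using ij(3) by linarith
      then have "1 / N \<le> \<bar>z i - z j\<bar>" using N by (simp add: z_def diff_divide_distrib[symmetric] divide_right_mono)
      then have "\<delta> * (1 / N) \<le> \<delta> * \<bar>z i - z j\<bar>" using \<Gamma>(2) by (intro mult_left_mono) auto
      also have "\<dots> \<le> \<bar>\<Gamma> i1 (z i) - \<Gamma> i1 (z j)\<bar>" by (intro \<Gamma>(5) zJ ij)
      finally show ?thesis using S by (simp add: inner_axis Y_def)
    qed
    obtain f where f: "schwartz (\<lambda>y. of_real (f y))"
       "\<And>j y. j \<in> J \<Longrightarrow> y \<in> tube S' R N (Y j) \<Longrightarrow> f y \<ge> c * N powr (k - max \<sigma> 0)"
       "\<And>y. f y \<ge> - (\<eta> * (c * N powr (k - max \<sigma> 0)))"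
       "Sobolev_norm p \<sigma> (\<lambda>y. of_real (f y)) \<le> ennreal (D * N powr (k - (k - 1) / p + min 0 (max \<sigma> (- 2))))"
    proof -
      have "\<exists>f. tube_bump p \<sigma> S' R N Y J \<eta> c D f" by (rule test[of N J Y, OF N(3) J]) (rule sep)
      then show ?thesis using that unfolding tube_bump_def S'(4) by (elim exE conjE) blast
    qed
    have f_cont: "continuous_on UNIV f"
    proof -
      have "(\<lambda>y. complex_of_real (f y)) differentiable (at y)" for y
        using f(1) unfolding schwartz_def smooth_def iter_deriv_def by (auto dest!: bspec[of _ _ "[]"])
      then have "continuous_on UNIV (\<lambda>y. complex_of_real (f y))"
        by (intro differentiable_imp_continuous_on) (simp add: differentiable_on_def)
      then show ?thesis using continuous_on_Re by fastforce
    qed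
    define v where "v = c' * N powr (k - max \<sigma> 0)"
    have v: "v > 0" using c' N by (simp add: v_def)
    have low: "v \<le> norm (averaging \<chi>0 \<psi> \<omega> \<gamma> (\<lambda>y. of_real (f y)) (\<Phi> q))" if q: "q \<in> thin_box V N" for q
    proof -
      obtain x \<tau> where xt: "q = (x, \<tau>)" by (cases q)
      define t where "t = shear js h e \<tau>"
      have xb: "0 \<le> x $ i" "x $ i \<le> (if i \<in> S then 1 / N else 1)" for i using q unfolding xt V_def thin_box_vec by auto
      have tb: "0 \<le> \<tau> $ j \<and> \<tau> $ j \<le> (if j = js then 1 / N else 1)" for j using q unfolding xt V_def thin_box_vec by auto
      \<comment> \<open>\<open>N \<ge> 2\<close> leaves room for the thin parameter:
        \<open>h \<tau> \<le> 3/2\<close> and \<open>1 / N \<le> 1/2\<close> keep the dilation at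
        most 2, where the cutoff is still 1.\<close>
      have L2: "1 / N \<le> 1 / 2" using N by (intro frac_le) auto
      have tb1: "\<tau> $ j \<in> {0..1}" for j using tb[of j] L2 by (auto split: if_splits)
      have t12: "t $ j \<in> {1..2}" for j
      proof (cases "j = js")
        case True
        then show ?thesis using tb[of j] L2 h(2)[of \<tau>, OF tb1] by (auto simp: t_def shear_def)
      next
        case False
        have "e * \<tau> $ j \<le> 1 * 1" using e tb1[of j] by (intro mult_mono) auto
        then show ?thesis using False e tb1[of j] by (auto simp: t_def shear_def)
      qed
      define a where "a = c * N powr (k - max \<sigma> 0)"
      have a: "a \<ge> 0" using c by (simp add: a_def)
      have "a * (s1 - s0) - (\<eta> * a) * (LINT s:{0..1}|lborel. \<psi> s) \<le> norm (averaging \<chi>0 \<psi> \<omega> \<gamma> (\<lambda>y. of_real (f y)) (x, t))"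
      proof (rule averaging_lower[OF f_cont \<gamma> \<psi> \<psi>0 s(1) less_imp_le[OF s(2)] s(3) \<psi>1])
        show "\<chi>0 (t $ j) = 1" for j by (intro \<chi> t12)
        show "0 \<le> \<eta> * a" using \<eta> a by simp
        show "- (\<eta> * a) \<le> f y" for y using f(3)[of y] by (simp add: a_def)
        fix s' assume s': "s' \<in> {s0..s1}"
        obtain w where w: "w \<in> {A..A'}" "\<And>i. i \<in> S \<Longrightarrow> \<bar>t $ \<omega> i * \<gamma> s' $ i - \<Gamma> i w\<bar> \<le> Cn / N"
          using near[OF N(2) tb s'] unfolding t_def by blast
        \<comment> \<open>The last grid point not exceeding \<open>w\<close>.\<close>
        define j where "j = nat \<lfloor>(w - A) * N\<rfloor>"
        have wA: "(w - A) * N \<ge> 0" using w(1) N by simp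
        have "(w - A) * N \<le> (A' - A) * N" using w(1) N by (intro mult_right_mono) auto
        then have j: "j \<in> J" unfolding j_def J_def by (auto intro!: nat_mono floor_mono)
        have "real j \<le> (w - A) * N" "(w - A) * N \<le> real j + 1" unfolding j_def using wA by linarith+
        then have "\<bar>(w - A) * N - real j\<bar> / N \<le> 1 / N" using N by (intro divide_right_mono) auto
        moreover have "w - z j = ((w - A) * N - real j) / N" using N by (simp add: z_def field_simps)
        ultimately have "\<bar>w - z j\<bar> \<le> 1 / N" using N by simp
        have "x + scaled_curve \<omega> \<gamma> t s' \<in> tube S' R N (Y j)"
          unfolding tube_def mem_Collect_eq
        proof (intro conjI ballI)
          fix b assume "b \<in> S'"
          then obtain i where i: "b = axis i 1" "i \<in> S" by (auto simp: S'_def)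
          have "\<bar>\<Gamma> i w - \<Gamma> i (z j)\<bar> \<le> LG * \<bar>w - z j\<bar>" by (intro \<Gamma>(4) i w zJ j)
          also have "\<dots> \<le> LG * (1 / N)" by (intro mult_left_mono \<Gamma>(3)) fact
          finally have g: "\<bar>\<Gamma> i w - \<Gamma> i (z j)\<bar> \<le> LG / N" by simp
          have "\<bar>x $ i + t $ \<omega> i * \<gamma> s' $ i - \<Gamma> i (z j)\<bar> \<le> 1 / N + Cn / N + LG / N"
            using g w(2)[OF i(2)] xb[of i] i(2) by (auto simp: abs_le_iff)
          also have "\<dots> \<le> R / N" unfolding add_divide_distrib[symmetric] R_def using N G0 by (intro divide_right_mono) auto
          finally show "\<bar>(x + scaled_curve \<omega> \<gamma> t s' - Y j) \<bullet> b\<bar> \<le> R / N"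
            using i by (simp add: inner_axis scaled_curve_def Y_def)
        next
          fix b :: "real ^ 'd" assume b: "b \<in> Basis - S'"
          then obtain i where i: "b = axis i 1" "i \<notin> S" by (auto simp: S'_def Basis_vec_def)
          have "\<bar>t $ \<omega> i * \<gamma> s' $ i\<bar> \<le> 2 * G"
            unfolding abs_mult using t12[of "\<omega> i"] G[of s' i] s' s by (intro mult_mono) auto
          then have "\<bar>x $ i + t $ \<omega> i * \<gamma> s' $ i\<bar> \<le> R"
            using xb[of i] i(2) Cn \<Gamma>(3) unfolding R_def by (auto simp: abs_le_iff)
          then show "\<bar>(x + scaled_curve \<omega> \<gamma> t s' - Y j) \<bullet> b\<bar> \<le> R"
            using i by (simp add: inner_axis scaled_curve_def Y_def)
        qed
        then show "a \<le> f (x + scaled_curve \<omega> \<gamma> t s')" using f(2)[OF j] by (simp add: a_def)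
      qed
      moreover have "(\<eta> * a) * I \<le> a * ((s1 - s0) / 2)" using mult_left_mono[OF \<eta>(2) a] by (simp add: mult_ac)
      moreover have "v = a * (s1 - s0) - a * ((s1 - s0) / 2)" by (simp add: v_def c'_def a_def field_simps)
      ultimately show ?thesis unfolding xt \<Phi>_def t_def[symmetric] fst_conv snd_conv I_def by linarith
    qed
    \<comment> \<open>The curved box has mass \<open>N\<close> to the power
      \<open>r - \<beta>\<close>, and the average is at least \<open>v\<close> on it.\<close>
    have "ennreal (v powr p) * ennreal (N powr (r - \<beta>)) \<le> (\<integral>\<^sup>+ q. ennreal (norm (averaging \<chi>0 \<psi> \<omega> \<gamma> (\<lambda>y. of_real (f y)) q) powr p) \<partial>\<mu> N)"
    proof -
      have e: "r - \<beta> = real DIM((real ^ 'd) \<times> (real ^ 'm)) - real (card V) - \<beta>" unfolding dim V(2) r_def k_def by simp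
      show ?thesis unfolding e \<mu>_def
        using low v p by (intro nn_integral_curved_box_ge[OF \<Phi> V(1) N(4)] ennreal_leI powr_mono2) auto
    qed
    then have int: "ennreal (v powr p * N powr (r - \<beta>)) \<le> (\<integral>\<^sup>+ q. ennreal (norm (averaging \<chi>0 \<psi> \<omega> \<gamma> (\<lambda>y. of_real (f y)) q) powr p) \<partial>\<mu> N)"
      by (simp add: ennreal_mult)
    have "ennreal ((v powr p * N powr (r - \<beta>)) powr (1 / p)) \<le> Lp_norm p (\<mu> N) (averaging \<chi>0 \<psi> \<omega> \<gamma> (\<lambda>y. of_real (f y)))"
      unfolding Lp_norm_def using ennpowr_ge[OF int] p by simp
    also have "\<dots> \<le> ennreal C * ennpowr (frostman_const \<alpha> (\<mu> N)) (1 / p) * Sobolev_norm p \<sigma> (\<lambda>y. of_real (f y))"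
      by (rule estimate[OF \<mu>(1)[OF N(1)] f(1)])
    also have "\<dots> \<le> ennreal C * ennreal (M powr (1 / p)) * ennreal (D * N powr (k - (k - 1) / p + min 0 (max \<sigma> (- 2))))"
      using p by (intro mult_mono f(4) ennpowr_le[OF \<mu>(2)[OF N(1)] M]) auto
    also have "\<dots> = ennreal ((C * M powr (1 / p) * D) * N powr (k - (k - 1) / p + min 0 (max \<sigma> (- 2))))"
      using C D by (simp add: ennreal_mult[symmetric] mult_ac)
    finally have "(v powr p * N powr (r - \<beta>)) powr (1 / p) \<le> (C * M powr (1 / p) * D) * N powr (k - (k - 1) / p + min 0 (max \<sigma> (- 2)))"
      using C D by (subst (asm) ennreal_le_iff) auto
    moreover have "(v powr p * N powr (r - \<beta>)) powr (1 / p) = c' * N powr (k - max \<sigma> 0 + (r - \<beta>) / p)"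
    proof -
      have "(v powr p * N powr (r - \<beta>)) powr (1 / p) = v * N powr ((r - \<beta>) / p)"
        using v p N by (simp add: powr_mult powr_powr)
      then show ?thesis by (simp add: v_def powr_add)
    qed
    ultimately show ?thesis by simp
  qed
  \<comment> \<open>The constants do not depend on \<open>N\<close>, so letting \<open>N\<close>
    grow compares the exponents.\<close>
  have "k - max \<sigma> 0 + (r - \<beta>) / p \<le> k - (k - 1) / p + min 0 (max \<sigma> (- 2))"
    by (rule powr_comparison[OF c' main])
  then have "(r - \<beta> + k - 1) / p \<le> max \<sigma> 0 + min 0 (max \<sigma> (- 2))"
    by (simp add: add_divide_distrib diff_divide_distrib)
  also have "\<dots> = max \<sigma> (- 2)" by (simp add: max_def min_def)
  finally have fin: "(r - \<beta> + k - 1) / p \<le> max \<sigma> (- 2)" .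
  \<comment> \<open>The lower bound exceeds \<open>-2\<close>, so the truncation of \<open>\<sigma>\<close> at \<open>-2\<close> is harmless.\<close>
  have "- 2 \<le> r - \<beta> + k - 1" using \<alpha> unfolding \<beta>_def r_def k_def by (simp add: max_def)
  then have "- 2 / p \<le> (r - \<beta> + k - 1) / p" using p by (intro divide_right_mono) auto
  moreover have "- 2 < - 2 / p" using p by (simp add: field_simps)
  ultimately have "(r - \<beta> + k - 1) / p \<le> \<sigma>" using fin by (simp add: max_def split: if_splits)
  then show ?thesis unfolding \<beta>_def r_def k_def by (simp add: algebra_simps)
qed

lemma smooth_imp_continuous_on: "smooth f \<Longrightarrow> continuous_on A f"
proof -
  assume "smooth f"
  then have "f differentiable (at x)" for x
    unfolding smooth_def iter_deriv_def by (auto dest!: bspec[of _ _ "[]"])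
  then show ?thesis
    by (intro differentiable_imp_continuous_on) (auto simp: differentiable_on_def intro: differentiable_at_withinI)
qed

subsection \<open>Curves of finite type\<close>

lemma curve_deriv_has_vector_derivative:
  assumes "smooth_curve \<gamma>" "s \<in> {0..1}"
  shows "(curve_deriv k \<gamma> has_vector_derivative curve_deriv (Suc k) \<gamma> s) (at s within {0..1})"
  using assms by (auto simp: smooth_curve_def curve_deriv_def vector_derivative_works[symmetric])

lemma curve_deriv_continuous_on: "smooth_curve \<gamma> \<Longrightarrow> continuous_on {0..1} (curve_deriv k \<gamma>)"
  unfolding continuous_on_eq_continuous_within
  by (intro ballI has_vector_derivative_continuous[OF curve_deriv_has_vector_derivative])

lemma curve_component_has_derivative:
  fixes \<gamma> :: "real \<Rightarrow> real ^ 'd::finite"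
  assumes "smooth_curve \<gamma>" "s \<in> {0<..<1}"
  shows "((\<lambda>s. curve_deriv k \<gamma> s $ i) has_real_derivative curve_deriv (Suc k) \<gamma> s $ i) (at s)"
proof -
  have "(curve_deriv k \<gamma> has_vector_derivative curve_deriv (Suc k) \<gamma> s) (at s within {0<..<1})"
    by (rule has_vector_derivative_within_subset[OF curve_deriv_has_vector_derivative[OF assms(1)]])
      (use assms(2) in auto)
  then have "(curve_deriv k \<gamma> has_vector_derivative curve_deriv (Suc k) \<gamma> s) (at s)"
    using assms(2) at_within_open[of s "{0<..<1}"] by simp
  from bounded_linear.has_vector_derivative[OF bounded_linear_vec_nth this, of i]
  show ?thesis by (simp add: has_real_derivative_iff_has_vector_derivative)
qed

text \<open>If a component had vanishing derivative on an interval, all its higher derivatives would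
  vanish there too, and every determinant in the finite type condition would have a zero
  row.\<close>

lemma finite_type_derivative_nonzero:
  fixes \<gamma> :: "real \<Rightarrow> real ^ 'd::finite"
  assumes sm: "smooth_curve \<gamma>" and ft: "finite_type \<gamma>" and uv: "0 < u" "u < v" "v < 1"
  shows "\<exists>s\<in>{u<..<v}. curve_deriv 1 \<gamma> s $ i \<noteq> 0"
proof (rule ccontr)
  assume "\<not> ?thesis"
  then have z: "\<And>s. s \<in> {u<..<v} \<Longrightarrow> curve_deriv (Suc 0) \<gamma> s $ i = 0" by auto
  have zero: "\<forall>s\<in>{u<..<v}. curve_deriv (Suc k) \<gamma> s $ i = 0" for k
  proof (induction k)
    case (Suc k)
    show ?case
    proof
      fix s assume s: "s \<in> {u<..<v}"
      have "((\<lambda>s. curve_deriv (Suc k) \<gamma> s $ i) has_real_derivative curve_deriv (Suc (Suc k)) \<gamma> s $ i) (at s)"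
        using s uv by (intro curve_component_has_derivative sm) auto
      moreover have "((\<lambda>s. curve_deriv (Suc k) \<gamma> s $ i) has_real_derivative 0) (at s)"
      proof (rule has_field_derivative_transform_within_open[where S = "{u<..<v}"])
        show "((\<lambda>s::real. 0::real) has_real_derivative 0) (at s)" by simp
      qed (use s Suc.IH in auto)
      ultimately show "curve_deriv (Suc (Suc k)) \<gamma> s $ i = 0" by (rule DERIV_unique)
    qed
  qed (use z in auto)
  define s where "s = (u + v) / 2"
  have s: "s \<in> {u<..<v}" "s \<in> {0..1}" using uv by (auto simp: s_def)
  obtain a :: "'d \<Rightarrow> nat" where a: "\<And>j. a j > 0" "det (\<chi> i j. curve_deriv (a j) \<gamma> s $ i) \<noteq> 0"
    using ft s(2) unfolding finite_type_def by blast
  have "curve_deriv (a j) \<gamma> s $ i = 0" for j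
    using zero[of "a j - 1"] s(1) a(1)[of j] by simp
  then have "row i (\<chi> i j. curve_deriv (a j) \<gamma> s $ i) = 0" by (simp add: row_def vec_eq_iff)
  then have "det (\<chi> i j. curve_deriv (a j) \<gamma> s $ i) = 0" by (rule det_zero_row)
  with a(2) show False by simp
qed

text \<open>Near a point with nonzero derivative, continuity keeps the derivative at least half as
  large in absolute value, and the mean value theorem makes the component expanding.\<close>

lemma curve_expanding_interval:
  fixes \<gamma> :: "real \<Rightarrow> real ^ 'd::finite"
  assumes sm: "smooth_curve \<gamma>" and ft: "finite_type \<gamma>" and uv: "0 < u" "u < v" "v < 1"
  obtains s0 s1 c where "u \<le> s0" "s0 < s1" "s1 \<le> v" "c > 0"
    "\<And>z z'. z \<in> {s0..s1} \<Longrightarrow> z' \<in> {s0..s1} \<Longrightarrow> c * \<bar>z - z'\<bar> \<le> \<bar>\<gamma> z $ i - \<gamma> z' $ i\<bar>"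
proof -
  obtain s where s: "s \<in> {u<..<v}" "curve_deriv 1 \<gamma> s $ i \<noteq> 0"
    using finite_type_derivative_nonzero[OF assms] by blast
  define g where "g s = curve_deriv 1 \<gamma> s $ i" for s
  define c where "c = \<bar>g s\<bar> / 2"
  have c: "c > 0" using s by (simp add: c_def g_def)
  have "continuous_on {0..1} g" unfolding g_def by (intro continuous_intros curve_deriv_continuous_on sm)
  then have "continuous_on {u<..<v} g" by (rule continuous_on_subset) (use uv in auto)
  then have "isCont g s" using s by (simp add: continuous_on_eq_continuous_at)
  then obtain e where e: "e > 0" "\<And>x. dist x s < e \<Longrightarrow> dist (g x) (g s) < c"
    using c unfolding continuous_at_eps_delta by blast
  define r where "r = min (e / 2) (min (s - u) (v - s))"
  have r: "r > 0" "r < e" "r \<le> s - u" "r \<le> v - s" using s e(1) by (auto simp: r_def)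
  have lower: "c \<le> \<bar>g x\<bar>" if "x \<in> {s..s + r}" for x
  proof -
    have "\<bar>g x - g s\<bar> < c" using e(2)[of x] that r by (auto simp: dist_real_def)
    then show ?thesis unfolding c_def by linarith
  qed
  have le: "c * \<bar>z - z'\<bar> \<le> \<bar>\<gamma> z $ i - \<gamma> z' $ i\<bar>" if "z \<in> {s..s + r}" "z' \<in> {s..s + r}" "z < z'" for z z'
  proof -
    have "\<exists>y. z < y \<and> y < z' \<and> curve_deriv 0 \<gamma> z' $ i - curve_deriv 0 \<gamma> z $ i = (z' - z) * curve_deriv (Suc 0) \<gamma> y $ i"
      using that s uv r by (intro MVT2[where f = "\<lambda>z. curve_deriv 0 \<gamma> z $ i"] curve_component_has_derivative[OF sm]) auto
    then obtain y where y: "z < y" "y < z'" "\<gamma> z' $ i - \<gamma> z $ i = (z' - z) * g y"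
      by (auto simp: curve_deriv_def g_def)
    have "c * \<bar>z - z'\<bar> \<le> \<bar>g y\<bar> * \<bar>z - z'\<bar>" using that y by (intro mult_right_mono lower) auto
    also have "\<dots> = \<bar>\<gamma> z' $ i - \<gamma> z $ i\<bar>" unfolding y(3) by (simp add: abs_mult abs_minus_commute mult.commute)
    finally show ?thesis by (simp add: abs_minus_commute)
  qed
  show ?thesis
  proof (rule that[of s "s + r" c])
    fix z z' assume "z \<in> {s..s + r}" "z' \<in> {s..s + r}"
    then show "c * \<bar>z - z'\<bar> \<le> \<bar>\<gamma> z $ i - \<gamma> z' $ i\<bar>"
      using le[of z z'] le[of z' z] by (cases z z' rule: linorder_cases) (auto simp: abs_minus_commute)
  qed (use s r c in auto)
qed

lemma curve_lipschitz:
  fixes \<gamma> :: "real \<Rightarrow> real ^ 'd::finite"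
  assumes sm: "smooth_curve \<gamma>"
  obtains L where "L \<ge> 0" "\<And>z z' i. z \<in> {0..1} \<Longrightarrow> z' \<in> {0..1} \<Longrightarrow> \<bar>\<gamma> z $ i - \<gamma> z' $ i\<bar> \<le> L * \<bar>z - z'\<bar>"
    "\<And>z i. z \<in> {0..1} \<Longrightarrow> \<bar>\<gamma> z $ i\<bar> \<le> L"
proof -
  have \<gamma>0: "curve_deriv 0 \<gamma> = \<gamma>" by (simp add: curve_deriv_def)
  have bd: "\<exists>B. \<forall>z\<in>{0..1}. norm (curve_deriv k \<gamma> z) \<le> B" for k
  proof -
    have "compact (curve_deriv k \<gamma> ` {0..1})" by (intro compact_continuous_image curve_deriv_continuous_on sm) auto
    then have "bounded (curve_deriv k \<gamma> ` {0..1})" by (rule compact_imp_bounded)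
    then show ?thesis unfolding bounded_iff by blast
  qed
  from bd[of 0] obtain B0 where B0: "\<forall>z\<in>{0..1}. norm (\<gamma> z) \<le> B0" unfolding \<gamma>0 ..
  from bd[of "Suc 0"] obtain B1 where B1: "\<forall>z\<in>{0..1}. norm (curve_deriv (Suc 0) \<gamma> z) \<le> B1" ..
  define L where "L = max 0 (max B0 B1)"
  have "norm (\<gamma> z - \<gamma> z') \<le> L * norm (z - z')" if "z \<in> {0..1}" "z' \<in> {0..1}" for z z'
  proof (rule differentiable_bound[of "{0..1}" \<gamma> "\<lambda>s h. h *\<^sub>R curve_deriv (Suc 0) \<gamma> s"])
    fix x :: real assume x: "x \<in> {0..1}"
    show "(\<gamma> has_derivative (\<lambda>h. h *\<^sub>R curve_deriv (Suc 0) \<gamma> x)) (at x within {0..1})"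
      using curve_deriv_has_vector_derivative[OF sm x, of 0] by (simp add: \<gamma>0 has_vector_derivative_def)
    show "onorm (\<lambda>h. h *\<^sub>R curve_deriv (Suc 0) \<gamma> x) \<le> L"
      using B1[rule_format, OF x] by (intro onorm_bound) (auto simp: L_def mult.commute intro!: mult_left_mono)
  qed (use that in auto)
  note lip = this
  have "\<bar>\<gamma> z $ i - \<gamma> z' $ i\<bar> \<le> L * \<bar>z - z'\<bar>" if "z \<in> {0..1}" "z' \<in> {0..1}" for z z' i
    using component_le_norm_cart[of "\<gamma> z - \<gamma> z'" i] lip[OF that] by simp
  moreover have "\<bar>\<gamma> z $ i\<bar> \<le> L" if "z \<in> {0..1}" for z i
    using component_le_norm_cart[of "\<gamma> z" i] B0[rule_format, OF that] by (simp add: L_def)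
  ultimately show ?thesis by (intro that[of L]) (auto simp: L_def)
qed

section \<open>Fibres of the index map\<close>

lemma max_fibre_attained: "\<exists>j. card {i. \<omega> i = j} = max_fibre (\<omega> :: 'd::finite \<Rightarrow> 'm::finite)"
proof -
  have "max_fibre \<omega> \<in> range (\<lambda>j. card {i. \<omega> i = j})" unfolding max_fibre_def by (rule Max_in) auto
  then show ?thesis by auto
qed

text \<open>Pigeonhole: with at most one point in every fibre, \<open>\<omega>\<close> would be
  injective into a smaller set.\<close>

lemma max_fibre_ge_2:
  fixes \<omega> :: "'d::finite \<Rightarrow> 'm::finite"
  assumes "CARD('m) < CARD('d)"
  shows "2 \<le> max_fibre \<omega>"
proof (rule ccontr)
  assume "\<not> 2 \<le> max_fibre \<omega>"
  then have "max_fibre \<omega> \<le> 1" by simp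
  moreover have le: "card {i. \<omega> i = j} \<le> max_fibre \<omega>" for j unfolding max_fibre_def by (rule Max_ge) auto
  ultimately have *: "card {i. \<omega> i = j} \<le> 1" for j using le[of j] by linarith
  have "inj \<omega>"
  proof (rule injI)
    fix x y assume "\<omega> x = \<omega> y"
    then have "{x, y} \<subseteq> {i. \<omega> i = \<omega> x}" by auto
    then have "card {x, y} \<le> card {i. \<omega> i = \<omega> x}" by (intro card_mono) auto
    then have "card {x, y} \<le> 1" using *[of "\<omega> x"] by linarith
    then show "x = y" by (cases "x = y") auto
  qed
  then have "CARD('d) \<le> CARD('m)" using card_inj_on_le[of \<omega> UNIV UNIV] by auto
  with assms show False by simp
qed

section \<open>Lipschitz and expansion bounds for powers\<close>

lemma power_diff_bounds:
  fixes z z' u w :: real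
  assumes "0 < u" "z \<in> {u..w}" "z' \<in> {u..w}" "1 \<le> a"
  shows "real a * u ^ (a - 1) * \<bar>z - z'\<bar> \<le> \<bar>z ^ a - z' ^ a\<bar>" "\<bar>z ^ a - z' ^ a\<bar> \<le> real a * w ^ (a - 1) * \<bar>z - z'\<bar>"
proof -
  have "real a * u ^ (a - 1) * \<bar>z - z'\<bar> \<le> \<bar>z ^ a - z' ^ a\<bar> \<and> \<bar>z ^ a - z' ^ a\<bar> \<le> real a * w ^ (a - 1) * \<bar>z - z'\<bar>"
    if zz: "z \<in> {u..w}" "z' \<in> {u..w}" "z < z'" for z z'
  proof -
    have "\<exists>y. z < y \<and> y < z' \<and> z' ^ a - z ^ a = (z' - z) * (real a * y ^ (a - 1))"
      using zz by (intro MVT2) (auto intro!: derivative_eq_intros)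
    then obtain y where y: "z < y" "y < z'" "z' ^ a - z ^ a = (z' - z) * (real a * y ^ (a - 1))" by blast
    have "\<bar>z ^ a - z' ^ a\<bar> = real a * y ^ (a - 1) * \<bar>z - z'\<bar>"
      using y zz assms(1) by (subst abs_minus_commute) (simp add: y(3) abs_mult mult_ac)
    moreover have "real a * u ^ (a - 1) \<le> real a * y ^ (a - 1)" "real a * y ^ (a - 1) \<le> real a * w ^ (a - 1)"
      using y zz assms(1) by (auto intro!: mult_left_mono power_mono)
    ultimately show ?thesis by (auto intro!: mult_right_mono)
  qed
  from this[of z z'] this[of z' z]
  show "real a * u ^ (a - 1) * \<bar>z - z'\<bar> \<le> \<bar>z ^ a - z' ^ a\<bar>" "\<bar>z ^ a - z' ^ a\<bar> \<le> real a * w ^ (a - 1) * \<bar>z - z'\<bar>"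
    using assms(2,3) by (cases z z' rule: linorder_cases; auto simp: abs_minus_commute)+
qed

lemma powr_lipschitz:
  fixes y y' q :: real
  assumes "y \<in> {1..2}" "y' \<in> {1..2}" "q \<ge> 1"
  shows "\<bar>y powr q - y' powr q\<bar> \<le> q * 2 powr q * \<bar>y - y'\<bar>"
proof -
  have "\<bar>y powr q - y' powr q\<bar> \<le> q * 2 powr q * \<bar>y - y'\<bar>" if zz: "y \<in> {1..2}" "y' \<in> {1..2}" "y < y'" for y y' :: real
  proof -
    have "\<exists>z. y < z \<and> z < y' \<and> y' powr q - y powr q = (y' - y) * (q * z powr (q - 1))"
      using zz by (intro MVT2) (auto intro!: derivative_eq_intros)
    then obtain z where z: "y < z" "z < y'" "y' powr q - y powr q = (y' - y) * (q * z powr (q - 1))" by blast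
    have "z powr (q - 1) \<le> 2 powr (q - 1)" using z zz assms(3) by (intro powr_mono2) auto
    also have "\<dots> \<le> 2 powr q" by (intro powr_mono) auto
    finally have "q * z powr (q - 1) \<le> q * 2 powr q" using assms(3) by (intro mult_left_mono) auto
    then show ?thesis using z zz assms(3)
      by (subst (1 2) abs_minus_commute) (simp add: z(3) abs_mult mult.commute mult_left_mono)
  qed
  from this[of y y'] this[of y' y] show ?thesis
    using assms(1,2) by (cases y y' rule: linorder_cases) (auto simp: abs_minus_commute)
qed

(* The index types 'd and 'm stand for {1..d} (with its order) and {1..m}. *)
theorem proposition4p2:
  fixes \<omega> :: "'d::{finite,linorder} \<Rightarrow> 'm::finite"
    and \<gamma> :: "real \<Rightarrow> real ^ ('d::{finite,linorder})"
    and \<chi>0 \<psi> :: "real \<Rightarrow> real"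
    and u v \<alpha> p \<sigma> :: real
    and d m n :: nat
  assumes d: "d = CARD('d)" and m: "m = CARD('m)" and n: "n = d + m"
    and "d \<ge> 2" and "1 \<le> m" and "m \<le> d"
    and "surj \<omega>"
    and "smooth_curve \<gamma>" and "finite_type \<gamma>"
    and "smooth \<chi>0" and "supp \<chi>0 \<subseteq> {1/2<..<4}" and "\<forall>t\<in>{1..2}. \<chi>0 t = 1"
    and "smooth \<psi>" and "\<forall>s. \<psi> s \<ge> 0" and "supp \<psi> \<subseteq> {0..1}"
    and "0 < u" and "u < v" and "v < 1" and "\<forall>s\<in>{u..v}. \<psi> s = 1"
    and "0 < \<alpha>" and "\<alpha> \<le> real n" and "1 < p"
    and estimate: "\<exists>C::real. C \<ge> 0 \<and>
      (\<forall>\<mu> \<in> frostman \<alpha> :: ((real ^ ('d::{finite,linorder})) \<times> (real ^ 'm)) measure set.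
       \<forall>f :: real ^ ('d::{finite,linorder}) \<Rightarrow> complex. schwartz f \<longrightarrow>
         Lp_norm p \<mu> (averaging \<chi>0 \<psi> \<omega> \<gamma> f)
           \<le> ennreal C * ennpowr (frostman_const \<alpha> \<mu>) (1 / p) * Sobolev_norm p \<sigma> f)"
  shows "(m \<le> d - 1 \<longrightarrow>
            \<sigma> \<ge> (if real n - real (max_fibre \<omega>) - 1 < \<alpha> then (real n - \<alpha> - 2) / p
                 else (real (max_fibre \<omega>) - 1) / p))
       \<and> (\<forall>a :: 'd \<Rightarrow> nat.
            m = d \<and> (\<forall>i. 1 \<le> a i) \<and> strict_mono a \<and> (\<forall>s\<in>{0..1}. \<forall>i. \<gamma> s $ i = s ^ a i) \<longrightarrow>
            \<sigma> \<ge> (if real n - 3 < \<alpha> then (real n - \<alpha> - 2) / p else 1 / p))"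
proof -
  note [simp] = \<open>1 < p\<close>
  have \<gamma>: "continuous_on {0..1} \<gamma>"
    using curve_deriv_continuous_on[OF \<open>smooth_curve \<gamma>\<close>, of 0] by (simp add: curve_deriv_def)
  have \<psi>: "continuous_on {0..1} \<psi>" using \<open>smooth \<psi>\<close> by (rule smooth_imp_continuous_on)
  have \<psi>0: "\<And>s. \<psi> s \<ge> 0" using \<open>\<forall>s. \<psi> s \<ge> 0\<close> by simp
  have \<chi>: "\<And>t. t \<in> {1..2} \<Longrightarrow> \<chi>0 t = 1" using \<open>\<forall>t\<in>{1..2}. \<chi>0 t = 1\<close> by blast
  have nn: "real n = real CARD('d) + real CARD('m)" by (simp add: n d m)
  obtain C where C: "C \<ge> 0" and est: "\<And>\<mu> f. \<mu> \<in> frostman \<alpha> \<Longrightarrow> schwartz f \<Longrightarrow>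
         Lp_norm p (\<mu> :: ((real ^ ('d::{finite,linorder})) \<times> (real ^ 'm)) measure) (averaging \<chi>0 \<psi> \<omega> \<gamma> f)
           \<le> ennreal C * ennpowr (frostman_const \<alpha> \<mu>) (1 / p) * Sobolev_norm p \<sigma> f"
    using estimate by blast
  \<comment> \<open>The case distinction hidden in the exponent of
    \<open>necessary_condition\<close>; \<open>k\<close> will be the largest fibre size in part (i)
    and 2 in part (ii).\<close>
  have exponent: "real k - 1 + (real n - real k - 1) - max \<alpha> (real n - real k - 1) = (if real n - real k - 1 < \<alpha> then real n - \<alpha> - 2 else real k - 1)" for k
    by (auto simp: max_def)
  show ?thesis
  proof (intro conjI impI allI)

    \<comment> \<open>Part (i): fewer parameters than coordinates\<close>
    assume "m \<le> d - 1"
    then have "CARD('m) < CARD('d)" using \<open>d \<ge> 2\<close> by (simp add: d m)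
    then have k2: "2 \<le> max_fibre \<omega>" by (rule max_fibre_ge_2)
    obtain j0 where j0: "card {i. \<omega> i = j0} = max_fibre \<omega>" using max_fibre_attained by blast
    \<comment> \<open>All coordinates in a fibre share one parameter, so dilation multiplies this
      part of the curve by a scalar.\<close>
    define S where "S = {i. \<omega> i = j0}"
    have S: "card S = max_fibre \<omega>" "2 \<le> card S" using j0 k2 by (auto simp: S_def)
    then obtain i1 where i1: "i1 \<in> S" by fastforce
    obtain s0 s1 c where s: "u \<le> s0" "s0 < s1" "s1 \<le> v" and c: "c > 0"
      "\<And>z z'. z \<in> {s0..s1} \<Longrightarrow> z' \<in> {s0..s1} \<Longrightarrow> c * \<bar>z - z'\<bar> \<le> \<bar>\<gamma> z $ i1 - \<gamma> z' $ i1\<bar>"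
      using curve_expanding_interval[OF \<open>smooth_curve \<gamma>\<close> \<open>finite_type \<gamma>\<close> \<open>0 < u\<close> \<open>u < v\<close> \<open>v < 1\<close>] by blast
    obtain L where L: "L \<ge> 0" "\<And>z z' i. z \<in> {0..1} \<Longrightarrow> z' \<in> {0..1} \<Longrightarrow> \<bar>\<gamma> z $ i - \<gamma> z' $ i\<bar> \<le> L * \<bar>z - z'\<bar>"
      "\<And>z i. z \<in> {0..1} \<Longrightarrow> \<bar>\<gamma> z $ i\<bar> \<le> L"
      using curve_lipschitz[OF \<open>smooth_curve \<gamma>\<close>] by blast
    have sub: "z \<in> {0..1}" if "z \<in> {s0..s1}" for z using that s \<open>0 < u\<close> \<open>v < 1\<close> by auto
    have \<psi>1: "\<And>s. s \<in> {s0..s1} \<Longrightarrow> \<psi> s = 1" using \<open>\<forall>s\<in>{u..v}. \<psi> s = 1\<close> s by auto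
    have scale: "\<bar>3/2 * x - 3/2 * y\<bar> = 3/2 * \<bar>x - y\<bar>" for x y :: real by (simp add: abs_if)
    have "(real (card S) - 1 + (real n - real (card S) - 1) - max \<alpha> (real n - real (card S) - 1)) / p \<le> \<sigma>"
    \<comment> \<open>The fixed curve is the original one dilated by \<open>3/2\<close>, the
      constant value of \<open>h\<close>. The parameter of the fibre exceeds \<open>3/2\<close> by
      at most \<open>1 / N\<close> and the curve is bounded by \<open>L\<close>, hence
      \<open>Cn = L\<close>; the other parameters range over \<open>[1, 2]\<close>.\<close>
    proof (rule necessary_condition[where \<Gamma> = "\<lambda>i z. 3/2 * \<gamma> z $ i" and h = "\<lambda>_. 3/2" and Lh = 0 and e = 1
        and A = s0 and A' = s1 and \<delta> = "3/2 * c" and LG = "3/2 * L" and Cn = L and js = j0,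
        OF \<gamma> \<psi> \<psi>0 _ s(2) _ \<psi>1 \<chi> i1 S(2) _ _ _ _ _ _ _ _ _ _ _ _ _ nn \<open>0 < \<alpha>\<close> \<open>\<alpha> \<le> real n\<close> \<open>1 < p\<close> C est])
      show "\<bar>3/2 * \<gamma> z $ i - 3/2 * \<gamma> z' $ i\<bar> \<le> 3/2 * L * \<bar>z - z'\<bar>" if "z \<in> {s0..s1}" "z' \<in> {s0..s1}" for i z z'
        unfolding scale mult.assoc using that by (intro mult_left_mono L(2) sub) auto
      show "3/2 * c * \<bar>z - z'\<bar> \<le> \<bar>3/2 * \<gamma> z $ i1 - 3/2 * \<gamma> z' $ i1\<bar>" if "z \<in> {s0..s1}" "z' \<in> {s0..s1}" for z z'
        unfolding scale mult.assoc using that by (intro mult_left_mono c(2)) auto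
      fix N :: real and \<tau> :: "real ^ 'm" and s
      assume N: "2 \<le> N" and \<tau>: "\<And>j. 0 \<le> \<tau> $ j \<and> \<tau> $ j \<le> (if j = j0 then 1 / N else 1)" and s: "s \<in> {s0..s1}"
      have "\<bar>shear j0 (\<lambda>_. 3/2) 1 \<tau> $ \<omega> i * \<gamma> s $ i - 3/2 * \<gamma> s $ i\<bar> \<le> L / N" if "i \<in> S" for i
      proof -
        have "shear j0 (\<lambda>_. 3/2) 1 \<tau> $ \<omega> i * \<gamma> s $ i - 3/2 * \<gamma> s $ i = \<tau> $ j0 * \<gamma> s $ i"
          using that by (simp add: shear_def S_def algebra_simps)
        moreover have "\<bar>\<tau> $ j0 * \<gamma> s $ i\<bar> \<le> 1 / N * L"
          unfolding abs_mult using \<tau>[of j0] L(3)[OF sub[OF s]] N by (intro mult_mono) auto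
        ultimately show ?thesis by simp
      qed
      then show "\<exists>z\<in>{s0..s1}. \<forall>i\<in>S. \<bar>shear j0 (\<lambda>_. 3/2) 1 \<tau> $ \<omega> i * \<gamma> s $ i - 3/2 * \<gamma> z $ i\<bar> \<le> L / N"
        using s by blast
    qed (use s c L \<open>0 < u\<close> \<open>v < 1\<close> in auto)
    then show "\<sigma> \<ge> (if real n - real (max_fibre \<omega>) - 1 < \<alpha> then (real n - \<alpha> - 2) / p
                 else (real (max_fibre \<omega>) - 1) / p)"
      unfolding exponent S(1) by (simp split: if_splits)
  next

    \<comment> \<open>Part (ii): monomial curves with independent dilations\<close>
    fix a :: "'d \<Rightarrow> nat"
    assume "m = d \<and> (\<forall>i. 1 \<le> a i) \<and> strict_mono a \<and> (\<forall>s\<in>{0..1}. \<forall>i. \<gamma> s $ i = s ^ a i)"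
    then have md: "m = d" and a1: "\<And>i. 1 \<le> a i" and am: "strict_mono a" and mono: "\<And>s i. s \<in> {0..1} \<Longrightarrow> \<gamma> s $ i = s ^ a i" by auto
    \<comment> \<open>A surjection between finite sets of equal size is injective, so different
      coordinates are dilated by different parameters.\<close>
    have "inj \<omega>" using \<open>surj \<omega>\<close> md unfolding d m by (metis card_image_le eq_card_imp_inj_on finite)
    obtain i1 i2 :: 'd where i12: "i1 < i2"
    proof -
      have "\<not> is_singleton (UNIV :: 'd set)" using \<open>d \<ge> 2\<close> by (auto simp: is_singleton_altdef d)
      then obtain x y :: 'd where "x \<noteq> y" by (metis UNIV_I is_singletonI' empty_iff)
      then show ?thesis using that by (meson linorder_neqE)
    qed
    define S where "S = {i1, i2}"
    have S: "i1 \<in> S" "card S = 2" "2 \<le> card S" using i12 by (auto simp: S_def)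
    define j0 where "j0 = \<omega> i2"
    define j1 where "j1 = \<omega> i1"
    have j01: "j1 \<noteq> j0" using \<open>inj \<omega>\<close> i12 by (auto simp: j0_def j1_def inj_eq)
    \<comment> \<open>With \<open>t j0 = (t j1)\<close> to the power \<open>q\<close>, the dilated curve in the coordinates \<open>S\<close> is
      the original one reparametrized by \<open>z\<close> below.\<close>
    define q where "q = real (a i2) / real (a i1)"
    have q: "q \<ge> 1" using am i12 a1[of i1] by (simp add: q_def strict_mono_less_eq)
    \<comment> \<open>Chosen so that \<open>1 + e\<close>, the largest base occurring in
      \<open>h\<close> on the unit cube, has \<open>q\<close>-th power \<open>3/2\<close>, the
      largest value allowed for \<open>h\<close>.\<close>
    define e where "e = (3/2) powr (1 / q) - 1"
    have e: "0 < e" "e \<le> 1" "(1 + e) powr q = 3/2"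
    proof -
      have "(3/2::real) powr 0 < (3/2) powr (1 / q)" using q by (intro powr_less_mono) auto
      then show "0 < e" by (simp add: e_def)
      have "(3/2::real) powr (1 / q) \<le> (3/2) powr 1" using q by (intro powr_mono) auto
      then show "e \<le> 1" by (simp add: e_def)
      show "(1 + e) powr q = 3/2" using q by (simp add: e_def powr_powr)
    qed
    \<comment> \<open>The absolute value makes the base at least 1 everywhere, hence
      \<open>h\<close> continuous on the whole space; on the unit cube it changes nothing.\<close>
    define h where "h \<tau> = (1 + e * \<bar>\<tau> $ j1\<bar>) powr q" for \<tau> :: "real ^ 'm"
    have ye: "1 \<le> 1 + e * t" "1 + e * t \<le> 1 + e" "1 + e * t \<le> 2" if "t \<in> {0..1}" for t
    proof -
      have "e * t \<le> e" "0 \<le> e * t" using that e(1) by (auto intro: mult_left_le)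
      then show "1 \<le> 1 + e * t" "1 + e * t \<le> 1 + e" "1 + e * t \<le> 2" using e(2) by auto
    qed
    have sub: "z \<in> {0..1}" if "z \<in> {u..v}" for z using that \<open>0 < u\<close> \<open>v < 1\<close> by auto
    have \<psi>1: "\<And>s. s \<in> {u..v} \<Longrightarrow> \<psi> s = 1" using \<open>\<forall>s\<in>{u..v}. \<psi> s = 1\<close> by auto
    define LG where "LG = real (a i1) * 2 ^ (a i1 - 1) + real (a i2) * 2 ^ (a i2 - 1)"
    have "(real (card S) - 1 + (real n - real (card S) - 1) - max \<alpha> (real n - real (card S) - 1)) / p \<le> \<sigma>"
    \<comment> \<open>Here \<open>\<Gamma>\<close> is the monomial curve on \<open>{u..2}\<close>,
      an interval containing \<open>s * y powr (1 / a i1)\<close> for all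
      \<open>s \<in> {u..v}\<close> and \<open>1 \<le> y \<le> 2\<close>. The mean value theorem
      gives \<open>\<delta>\<close> and \<open>LG\<close>.\<close>
    proof (rule necessary_condition[where \<Gamma> = "\<lambda>i z. z ^ a i" and h = h and Lh = "q * 2 powr q * e" and e = e
        and A = u and A' = 2 and \<delta> = "real (a i1) * u ^ (a i1 - 1)" and LG = LG and Cn = 1 and js = j0,
        OF \<gamma> \<psi> \<psi>0 _ \<open>u < v\<close> _ \<psi>1 \<chi> S(1,3) _ _ _ _ e(1,2) _ _ _ _ _ _ _ nn \<open>0 < \<alpha>\<close> \<open>\<alpha> \<le> real n\<close> \<open>1 < p\<close> C est])
      show "continuous_on UNIV h" unfolding h_def
      proof (intro continuous_intros ballI)
        fix x :: "real ^ 'm"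
        have "0 \<le> e * \<bar>x $ j1\<bar>" using e(1) by simp
        then show "1 + e * \<bar>x $ j1\<bar> \<noteq> 0" by linarith
      qed
      show "h \<tau> \<in> {1..3/2}" if "\<And>j. \<tau> $ j \<in> {0..1}" for \<tau>
      proof -
        have "1 + e * \<bar>\<tau> $ j1\<bar> \<ge> 1" "1 + e * \<bar>\<tau> $ j1\<bar> \<le> 1 + e" using ye[OF that[of j1]] that[of j1] by auto
        then have "1 powr q \<le> h \<tau>" "h \<tau> \<le> (1 + e) powr q" unfolding h_def using q by (intro powr_mono2; simp)+
        then show ?thesis by (simp add: e)
      qed
      show "\<bar>h \<tau> - h \<tau>'\<bar> \<le> q * 2 powr q * e * (\<Sum>j\<in>UNIV - {j0}. \<bar>\<tau> $ j - \<tau>' $ j\<bar>)"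
        if b: "\<And>j. \<tau> $ j \<in> {0..1}" "\<And>j. \<tau>' $ j \<in> {0..1}" for \<tau> \<tau>'
      proof -
        have "\<bar>h \<tau> - h \<tau>'\<bar> \<le> q * 2 powr q * \<bar>(1 + e * \<bar>\<tau> $ j1\<bar>) - (1 + e * \<bar>\<tau>' $ j1\<bar>)\<bar>"
          unfolding h_def using ye[OF b(1)[of j1]] ye[OF b(2)[of j1]] b(1)[of j1] b(2)[of j1] q by (intro powr_lipschitz) auto
        also have "\<dots> = q * 2 powr q * e * \<bar>\<tau> $ j1 - \<tau>' $ j1\<bar>"
          using b(1)[of j1] b(2)[of j1] e(1) by (simp add: right_diff_distrib[symmetric] abs_mult)
        also have "\<dots> \<le> q * 2 powr q * e * (\<Sum>j\<in>UNIV - {j0}. \<bar>\<tau> $ j - \<tau>' $ j\<bar>)"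
          using j01 q e(1) by (intro mult_left_mono member_le_sum[where i = j1]) auto
        finally show ?thesis .
      qed
      show "\<bar>z ^ a i - z' ^ a i\<bar> \<le> LG * \<bar>z - z'\<bar>" if "i \<in> S" "z \<in> {u..2}" "z' \<in> {u..2}" for i z z'
      proof -
        have "\<bar>z ^ a i - z' ^ a i\<bar> \<le> real (a i) * 2 ^ (a i - 1) * \<bar>z - z'\<bar>"
          by (rule power_diff_bounds(2)[OF \<open>0 < u\<close> that(2,3) a1])
        also have "\<dots> \<le> LG * \<bar>z - z'\<bar>" using that(1) by (intro mult_right_mono) (auto simp: S_def LG_def)
        finally show ?thesis .
      qed
      show "real (a i1) * u ^ (a i1 - 1) * \<bar>z - z'\<bar> \<le> \<bar>z ^ a i1 - z' ^ a i1\<bar>" if "z \<in> {u..2}" "z' \<in> {u..2}" for z z'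
        by (rule power_diff_bounds(1)[OF \<open>0 < u\<close> that a1])
      fix N :: real and \<tau> :: "real ^ 'm" and s
      assume N: "2 \<le> N" and \<tau>: "\<And>j. 0 \<le> \<tau> $ j \<and> \<tau> $ j \<le> (if j = j0 then 1 / N else 1)" and s: "s \<in> {u..v}"
      define y where "y = 1 + e * \<tau> $ j1"
      have \<tau>1: "\<tau> $ j1 \<in> {0..1}" using \<tau>[of j1] j01 by auto
      have y: "1 \<le> y" "y \<le> 2" using ye[OF \<tau>1] by (auto simp: y_def)
      define z where "z = s * y powr (1 / real (a i1))"
      have s0: "0 < s" "s \<le> 1" using s \<open>0 < u\<close> \<open>v < 1\<close> by auto
      have "y powr 0 \<le> y powr (1 / real (a i1))" "y powr (1 / real (a i1)) \<le> y powr 1"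
        using y a1[of i1] by (intro powr_mono; simp)+
      then have yb: "1 \<le> y powr (1 / real (a i1))" "y powr (1 / real (a i1)) \<le> 2" using y by auto
      have z: "z \<in> {u..2}"
      proof -
        have "s * 1 \<le> z" "z \<le> 1 * 2" unfolding z_def using yb s0 by (intro mult_mono; simp)+
        then show ?thesis using s by auto
      qed
      have zp: "z ^ k = s ^ k * y powr (real k / real (a i1))" for k
        using y by (simp add: z_def power_mult_distrib powr_power)
      \<comment> \<open>The coordinate \<open>i1\<close> is matched exactly; in \<open>i2\<close>
        the thin parameter \<open>\<tau> $ j0\<close> is the only source of error.\<close>
      have "\<bar>shear j0 h e \<tau> $ \<omega> i * \<gamma> s $ i - z ^ a i\<bar> \<le> 1 / N" if "i \<in> S" for i
      proof (cases "i = i1")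
        case True
        have "shear j0 h e \<tau> $ \<omega> i = y" using True j01 by (simp add: shear_def y_def j1_def)
        then show ?thesis using True mono[OF sub[OF s]] y a1[of i1] N by (simp add: zp)
      next
        case False
        then have i: "i = i2" using that by (simp add: S_def)
        have "shear j0 h e \<tau> $ \<omega> i = y powr q + \<tau> $ j0" using i \<tau>1 by (simp add: shear_def h_def y_def j0_def)
        then have "shear j0 h e \<tau> $ \<omega> i * \<gamma> s $ i - z ^ a i = \<tau> $ j0 * s ^ a i2"
          using i mono[OF sub[OF s]] by (simp add: zp q_def algebra_simps)
        moreover have "\<bar>\<tau> $ j0 * s ^ a i2\<bar> \<le> 1 / N * 1"
          unfolding abs_mult using \<tau>[of j0] s0 N by (intro mult_mono) (auto simp: power_le_one)
        ultimately show ?thesis by simp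
      qed
      then show "\<exists>z\<in>{u..2}. \<forall>i\<in>S. \<bar>shear j0 h e \<tau> $ \<omega> i * \<gamma> s $ i - z ^ a i\<bar> \<le> 1 / N"
        using z by blast
    qed (use q e a1[of i1] \<open>0 < u\<close> \<open>u < v\<close> \<open>v < 1\<close> in \<open>auto simp: LG_def\<close>)
    then show "\<sigma> \<ge> (if real n - 3 < \<alpha> then (real n - \<alpha> - 2) / p else 1 / p)"
      unfolding exponent S(2) by (simp split: if_splits)
  qed
qed

end
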